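(* For any fixed constant $\epsilon>0$, there is a polynomial time algorithm for the stochastic bin packing problem that outputs a packing of all items using at most $\mathsf{OPT}$ bins, such that for each bin the probability that the total size of the items in that bin exceeds $(1+\epsilon)\mathbb{C}$ is at most $p+\epsilon$.
   Context: Stochastic bin packing: we are given items $b_1,\dots,b_n$ and an overflow probability $0<p<1$. The size of item $b_i$ is a random variable $X_i$ with an explicitly given discrete distribution; the $X_i$ are mutually independent (distributions may differ). Each bin has capacity $\mathbb{C}$. A packing assigns every item to a bin; a bin with item set $S$ has overflow probability $\Pr[\sum_{i\in S}X_i>\mathbb{C}]$ (with capacity $\mathbb{C}$). $\mathsf{OPT}$ denotes the minimum number of bins in a packing of all items in which every bin, with capacity $\mathbb{C}$, has overflow probability at most $p$. *)

theory Defs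
  imports "HOL-Probability.Probability" "HOL-Library.Log_Nat"
    "HOL-Computational_Algebra.Polynomial"
begin

section \<open>Model of computation\<close>

text \<open>
  Structured while-programs over a finite set of variables that hold binary trees with integers at
  the leaves, under the logarithmic cost criterion: evaluating an expression costs the bit size of
  the values of all its subexpressions (so in particular operands and results of arithmetic
  operations are charged for their length, and copying or pairing values is charged for the whole
  value). All primitive operations are computable in time polynomial in the bit size of their
  operands, and each value present in the store has a size bounded by the input size plus the cost
  spent so far. Hence polynomial time in this model is polynomial time on Turing machines.
\<close>

datatype data = Atom int | Node data data

fun dsize :: "data \<Rightarrow> nat" where
  "dsize (Atom i) = 1 + floorlog 2 (nat \<bar>i\<bar>)"
| "dsize (Node a b) = 1 + dsize a + dsize b"

fun the_atom :: "data \<Rightarrow> int" where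
  "the_atom (Atom i) = i"
| "the_atom (Node _ _) = 0"

fun left :: "data \<Rightarrow> data" where
  "left (Atom _) = Atom 0"
| "left (Node a _) = a"

fun right :: "data \<Rightarrow> data" where
  "right (Atom _) = Atom 0"
| "right (Node _ b) = b"

fun is_node :: "data \<Rightarrow> bool" where
  "is_node (Atom _) = False"
| "is_node (Node _ _) = True"

datatype binop = Add | Sub | Mul | Div | Mod | Leq

fun apply_binop :: "binop \<Rightarrow> int \<Rightarrow> int \<Rightarrow> int" where
  "apply_binop Add i j = i + j"
| "apply_binop Sub i j = i - j"
| "apply_binop Mul i j = i * j"
| "apply_binop Div i j = i div j"
| "apply_binop Mod i j = i mod j"
| "apply_binop Leq i j = of_bool (i \<le> j)"

datatype expr =
    Var nat
  | Lit int
  | Cons expr expr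
  | Left expr
  | Right expr
  | IsNode expr
  | Bin binop expr expr

type_synonym state = "nat \<Rightarrow> data"

fun eval_expr :: "expr \<Rightarrow> state \<Rightarrow> data" where
  "eval_expr (Var v) s = s v"
| "eval_expr (Lit i) s = Atom i"
| "eval_expr (Cons a b) s = Node (eval_expr a s) (eval_expr b s)"
| "eval_expr (Left a) s = left (eval_expr a s)"
| "eval_expr (Right a) s = right (eval_expr a s)"
| "eval_expr (IsNode a) s = Atom (of_bool (is_node (eval_expr a s)))"
| "eval_expr (Bin f a b) s =
     Atom (apply_binop f (the_atom (eval_expr a s)) (the_atom (eval_expr b s)))"

fun expr_cost :: "expr \<Rightarrow> state \<Rightarrow> nat" where
  "expr_cost (Var v) s = dsize (eval_expr (Var v) s)"
| "expr_cost (Lit i) s = dsize (eval_expr (Lit i) s)"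
| "expr_cost (Cons a b) s = expr_cost a s + expr_cost b s + dsize (eval_expr (Cons a b) s)"
| "expr_cost (Left a) s = expr_cost a s + dsize (eval_expr (Left a) s)"
| "expr_cost (Right a) s = expr_cost a s + dsize (eval_expr (Right a) s)"
| "expr_cost (IsNode a) s = expr_cost a s + dsize (eval_expr (IsNode a) s)"
| "expr_cost (Bin f a b) s = expr_cost a s + expr_cost b s + dsize (eval_expr (Bin f a b) s)"

datatype prog =
    Skip
  | Assign nat expr
  | Seq prog prog
  | If expr prog prog
  | While expr prog

definition holds :: "expr \<Rightarrow> state \<Rightarrow> bool" where
  "holds e s \<longleftrightarrow> the_atom (eval_expr e s) \<noteq> 0"

text \<open>\<open>exec c s t s'\<close>: started in \<open>s\<close>, program \<open>c\<close> halts in \<open>s'\<close> after time \<open>t\<close>.\<close>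

inductive exec :: "prog \<Rightarrow> state \<Rightarrow> nat \<Rightarrow> state \<Rightarrow> bool" where
  Skip: "exec Skip s 1 s"
| Assign: "exec (Assign v e) s (1 + expr_cost e s) (s(v := eval_expr e s))"
| Seq: "exec c s t s' \<Longrightarrow> exec d s' u s'' \<Longrightarrow> exec (Seq c d) s (1 + t + u) s''"
| IfTrue: "holds e s \<Longrightarrow> exec c s t s' \<Longrightarrow> exec (If e c d) s (1 + expr_cost e s + t) s'"
| IfFalse: "\<not> holds e s \<Longrightarrow> exec d s t s' \<Longrightarrow> exec (If e c d) s (1 + expr_cost e s + t) s'"
| WhileFalse: "\<not> holds e s \<Longrightarrow> exec (While e c) s (1 + expr_cost e s) s"
| WhileTrue: "holds e s \<Longrightarrow> exec c s t s' \<Longrightarrow> exec (While e c) s' u s'' \<Longrightarrow>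
    exec (While e c) s (1 + expr_cost e s + t + u) s''"

lemma exec_deterministic:
  "exec c s t s' \<Longrightarrow> exec c s u s'' \<Longrightarrow> u = t \<and> s'' = s'"
proof (induction arbitrary: u s'' rule: exec.induct)
  case (Seq c s t s' d u s'')
  from Seq.prems show ?case by cases (use Seq.IH in blast)
next
  case (IfTrue e s c t s' d)
  from IfTrue.prems show ?case by cases (use IfTrue.IH IfTrue.hyps in blast)+
next
  case (IfFalse e s d t s' c)
  from IfFalse.prems show ?case by cases (use IfFalse.IH IfFalse.hyps in blast)+
next
  case (WhileTrue e s c t s' u s'')
  from WhileTrue.prems show ?case by cases (use WhileTrue.IH WhileTrue.hyps in blast)+
qed (auto elim: exec.cases)

text \<open>Variable \<open>0\<close> holds the input initially and the output at the end.\<close>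

definition runs :: "prog \<Rightarrow> data \<Rightarrow> nat \<Rightarrow> data \<Rightarrow> bool" where
  "runs c x t y \<longleftrightarrow> (\<exists>s. exec c ((\<lambda>_. Atom 0)(0 := x)) t s \<and> s 0 = y)"

definition outputs :: "prog \<Rightarrow> data \<Rightarrow> data \<Rightarrow> bool" where
  "outputs c x y \<longleftrightarrow> (\<exists>t. runs c x t y)"

definition polynomial_time_on :: "prog \<Rightarrow> data set \<Rightarrow> bool" where
  "polynomial_time_on c A \<longleftrightarrow>
     (\<exists>q :: nat poly. \<forall>x\<in>A. \<exists>t y. runs c x t y \<and> t \<le> poly q (dsize x))"


section \<open>Stochastic bin packing\<close>

text \<open>
  An item is the explicit list of the pairs (size, probability) of its distribution. The overflow
  probability is the bound \<open>p\<close> on the overflow probability of the bins.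
\<close>

type_synonym item = "(rat \<times> rat) list"

record sbp =
  items :: "item list"
  capacity :: rat
  overflow_prob :: rat

definition real_item :: "item \<Rightarrow> (real \<times> real) list" where
  "real_item b = map (map_prod of_rat of_rat) b"

definition size_pmf :: "item \<Rightarrow> real pmf" where
  "size_pmf b = pmf_of_list (real_item b)"

definition sbp_instance :: "sbp \<Rightarrow> bool" where
  "sbp_instance I \<longleftrightarrow>
     (\<forall>b\<in>set (items I). pmf_of_list_wf (real_item b) \<and> (\<forall>(x, _)\<in>set b. 0 \<le> x)) \<and>
     0 < capacity I \<and> 0 < overflow_prob I \<and> overflow_prob I < 1"

text \<open>The joint distribution of the independent item sizes \<open>X 0, \<dots>, X (n - 1)\<close>.\<close>

definition sizes_pmf :: "sbp \<Rightarrow> (nat \<Rightarrow> real) pmf" where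
  "sizes_pmf I = Pi_pmf {..<length (items I)} 0 (\<lambda>i. size_pmf (items I ! i))"

definition prob_exceeds :: "sbp \<Rightarrow> nat set \<Rightarrow> real \<Rightarrow> real" where
  "prob_exceeds I S c = measure_pmf.prob (sizes_pmf I) {X. (\<Sum>i\<in>S. X i) > c}"

text \<open>
  A packing is the list of the bins of the successive items. Its bins are thus the elements of
  \<open>set f\<close>.
\<close>

definition is_packing :: "sbp \<Rightarrow> nat list \<Rightarrow> bool" where
  "is_packing I f \<longleftrightarrow> length f = length (items I)"

definition num_bins :: "nat list \<Rightarrow> nat" where
  "num_bins f = card (set f)"

definition items_in :: "nat list \<Rightarrow> nat \<Rightarrow> nat set" where
  "items_in f j = {i. i < length f \<and> f ! i = j}"

definition feasible_packing :: "sbp \<Rightarrow> nat list \<Rightarrow> bool" where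
  "feasible_packing I f \<longleftrightarrow> is_packing I f \<and>
     (\<forall>j\<in>set f. prob_exceeds I (items_in f j) (of_rat (capacity I)) \<le> of_rat (overflow_prob I))"

text \<open>Only meaningful if some feasible packing exists.\<close>

definition OPT :: "sbp \<Rightarrow> nat" where
  "OPT I = (LEAST k. \<exists>f. feasible_packing I f \<and> num_bins f = k)"


section \<open>Encoding of inputs and outputs\<close>

fun encode_list :: "('a \<Rightarrow> data) \<Rightarrow> 'a list \<Rightarrow> data" where
  "encode_list enc [] = Atom 0"
| "encode_list enc (x # xs) = Node (enc x) (encode_list enc xs)"

text \<open>Rationals are encoded by numerator and denominator in lowest terms.\<close>

definition encode_rat :: "rat \<Rightarrow> data" where
  "encode_rat r = (case quotient_of r of (a, b) \<Rightarrow> Node (Atom a) (Atom b))"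

definition encode_item :: "item \<Rightarrow> data" where
  "encode_item = encode_list (\<lambda>(x, q). Node (encode_rat x) (encode_rat q))"

definition encode_sbp :: "sbp \<Rightarrow> data" where
  "encode_sbp I = Node (encode_list encode_item (items I))
     (Node (encode_rat (capacity I)) (encode_rat (overflow_prob I)))"

definition encode_packing :: "nat list \<Rightarrow> data" where
  "encode_packing = encode_list (\<lambda>j. Atom (int j))"

lemma inj_encode_list: "inj enc \<Longrightarrow> inj (encode_list enc)"
proof (rule injI)
  fix xs ys assume "inj enc" "encode_list enc xs = encode_list enc ys"
  then show "xs = ys"
  proof (induction xs arbitrary: ys)
    case Nil then show ?case by (cases ys) auto
  next
    case (Cons x xs) then show ?case by (cases ys) (auto dest: injD)
  qed
qed

lemma inj_encode_rat: "inj encode_rat"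
  by (rule injI) (auto simp: encode_rat_def quotient_of_inject split: prod.splits)

lemma inj_encode_item: "inj encode_item"
  unfolding encode_item_def
  by (rule inj_encode_list) (auto intro!: injI dest: injD[OF inj_encode_rat])

lemma inj_encode_sbp: "inj encode_sbp"
  by (rule injI)
    (auto simp: encode_sbp_def intro!: sbp.equality
      dest: injD[OF inj_encode_rat] injD[OF inj_encode_list[OF inj_encode_item]])

lemma inj_encode_packing: "inj encode_packing"
  unfolding encode_packing_def by (rule inj_encode_list) (auto intro!: injI)

end

theory Submission
  imports Defs "HOL-Library.Poly_Mapping" "HOL-Library.Sublist"
begin

text \<open>
  Let the capacity be \<open>1\<close>. If \<open>p \<ge> 1 - \<epsilon>\<close>, one bin suffices. Otherwise the truncated sizes of the
  items in a feasible bin have bounded total expectation, since the expectation of \<open>exp (- \<Sum>i. X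
  i)\<close> is bounded from below. The overflow probability is sandwiched by the expectation of a smooth
  step \<open>\<phi>\<close> of the total size. By a Lindeberg argument, rounding every size randomly to a grid of
  constant width while preserving its mean hardly changes this expectation, because the second
  differences of \<open>\<phi>\<close> are small. An item is now a mass, the probability to be nonzero, together
  with a conditional distribution, which is rounded to one of constantly many directions. Up to a
  small error, light items (of tiny mass) of one direction matter only through their total mass,
  since a sum of rare events is nearly Poisson. The few heavy items in a bin have constantly many
  classes after rounding their masses as well.

  Hence a bin is described by one of constantly many configurations, whose quality is a constant
  that can be hardwired into the program. The program tries all multisets of configurations, fills
  them greedily class by class, where each bin exceeds its light room by at most one item per
  class, and returns the best result.
\<close>

section \<open>Polynomial-time computability\<close>

text \<open>The bound \<open>OPT\<close> leaves no spare bin, so every loss must be absorbed by the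
  two slacks \<open>\<epsilon>\<close>. A bin may hold arbitrarily many items, so errors must add up
  with the mass of the items and not with their number. This excludes rounding sizes up to a grid of
  width \<open>1/g\<close>, an error of first order. The mean-preserving rounding errs by
  \<open>\<kappa> / g\<^sup>2\<close> per unit of the mass \<open>ramps g xs 0\<close>; a feasible
  bin has mass at most \<open>M\<close>, which is linear in \<open>g\<close>, so the total is of
  order \<open>1/g\<close>. The number of directions is fixed by \<open>g\<close> and
  \<open>G\<close> alone. The threshold \<open>1/D\<close> for light items is chosen afterwards, so
  small that one item in excess per direction does no harm. Distributions live in the ring
  \<open>real \<Rightarrow>\<^sub>0 real\<close>, where sums of independent variables are products,
  so that factors can be exchanged one at a time. The qualities of the configurations are reals that
  the program never computes: \<open>p\<close> enters through one of \<open>R\<close> levels only,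
  and for each level the list of admissible configurations is a constant.\<close>

definition poly_bounded :: "'a set \<Rightarrow> ('a \<Rightarrow> data) \<Rightarrow> ('a \<Rightarrow> nat) \<Rightarrow> bool" where
  "poly_bounded A e T \<longleftrightarrow> (\<exists>k. \<forall>a\<in>A. T a \<le> (dsize (e a) + 1) ^ k)"

text \<open>The program works in place on variable \<open>b\<close> and may overwrite all variables above \<open>b\<close>.\<close>

definition implements ::
    "prog \<Rightarrow> nat \<Rightarrow> 'a set \<Rightarrow> ('a \<Rightarrow> data) \<Rightarrow> ('a \<Rightarrow> data) \<Rightarrow> ('a \<Rightarrow> nat) \<Rightarrow> bool" where
  "implements c b A e f T \<longleftrightarrow> (\<forall>a\<in>A. \<forall>s. s b = e a \<longrightarrow>
     (\<exists>t s'. exec c s t s' \<and> s' b = f a \<and> (\<forall>v<b. s' v = s v) \<and> t \<le> T a))"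

text \<open>All base variables \<open>b\<close> are required so that a subcomputation can be placed
  above the variables that have to survive it. The time bound is common to all
  \<open>b\<close>.\<close>

definition poly_time :: "'a set \<Rightarrow> ('a \<Rightarrow> data) \<Rightarrow> ('a \<Rightarrow> data) \<Rightarrow> bool" where
  "poly_time A e f \<longleftrightarrow> (\<exists>T. poly_bounded A e T \<and> (\<forall>b. \<exists>c. implements c b A e f T))"

lemma implementsI:
  assumes "\<And>a s. a \<in> A \<Longrightarrow> s b = e a \<Longrightarrow>
     \<exists>t s'. exec c s t s' \<and> s' b = f a \<and> (\<forall>v<b. s' v = s v) \<and> t \<le> T a"
  shows "implements c b A e f T"
  using assms unfolding implements_def by blast

lemma implementsE:
  assumes "implements c b A e f T" "a \<in> A" "s b = e a"
  obtains t s' where "exec c s t s'" "s' b = f a" "\<And>v. v < b \<Longrightarrow> s' v = s v" "t \<le> T a"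
  using assms unfolding implements_def by blast

lemma poly_timeI:
  assumes "poly_bounded A e T" "\<And>b. \<exists>c. implements c b A e f T"
  shows "poly_time A e f"
  using assms unfolding poly_time_def by blast

lemma poly_timeE:
  assumes "poly_time A e f"
  obtains T where "poly_bounded A e T" "\<forall>b. \<exists>c. implements c b A e f T"
  using assms unfolding poly_time_def by blast

lemma dsize_ge_1: "1 \<le> dsize x"
  by (cases x) auto

lemma poly_bounded_mono:
  "poly_bounded A e T \<Longrightarrow> (\<And>a. a \<in> A \<Longrightarrow> T' a \<le> T a) \<Longrightarrow> poly_bounded A e T'"
  unfolding poly_bounded_def by (meson le_trans)

lemma poly_bounded_subset: "poly_bounded A e T \<Longrightarrow> B \<subseteq> A \<Longrightarrow> poly_bounded B e T"
  unfolding poly_bounded_def by blast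

text \<open>As \<open>dsize\<close> is at least 1, the base of the power is at least 2 and absorbs
  \<open>n\<close> with the exponent \<open>n\<close>. Therefore \<open>poly_bounded\<close> does
  without coefficients.\<close>

lemma poly_bounded_const: "poly_bounded A e (\<lambda>_. n)"
proof -
  have "n \<le> (dsize (e a) + 1) ^ n" for a
  proof -
    have "n \<le> 2 ^ n" by (simp add: less_imp_le)
    also have "\<dots> \<le> (dsize (e a) + 1) ^ n" using dsize_ge_1[of "e a"] by (intro power_mono) auto
    finally show ?thesis .
  qed
  then show ?thesis unfolding poly_bounded_def by blast
qed

lemma poly_bounded_mult:
  assumes "poly_bounded A e T" "poly_bounded A e T'"
  shows "poly_bounded A e (\<lambda>a. T a * T' a)"
proof -
  from assms obtain k l where "\<forall>a\<in>A. T a \<le> (dsize (e a) + 1) ^ k" "\<forall>a\<in>A. T' a \<le> (dsize (e a) + 1) ^ l"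
    unfolding poly_bounded_def by blast
  then have "\<forall>a\<in>A. T a * T' a \<le> (dsize (e a) + 1) ^ (k + l)"
    by (auto simp: power_add intro!: mult_mono)
  then show ?thesis unfolding poly_bounded_def by blast
qed

lemma poly_bounded_add:
  assumes "poly_bounded A e T" "poly_bounded A e T'"
  shows "poly_bounded A e (\<lambda>a. T a + T' a)"
proof -
  have "poly_bounded A e (\<lambda>a. (T a + 1) * (T' a + 1))" 
  proof (rule poly_bounded_mult)
    have *: "poly_bounded A e (\<lambda>a. T a + 1)" if "poly_bounded A e T" for T
    proof -
      from that obtain k where k: "\<forall>a\<in>A. T a \<le> (dsize (e a) + 1) ^ k"
        unfolding poly_bounded_def by blast
      have "T a + 1 \<le> (dsize (e a) + 1) ^ (k + 1)" if "a \<in> A" for a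
      proof -
        have "T a + 1 \<le> (dsize (e a) + 1) ^ k + (dsize (e a) + 1) ^ k"
          by (intro add_mono k[rule_format] that) simp
        also have "\<dots> \<le> (dsize (e a) + 1) * (dsize (e a) + 1) ^ k"
          using dsize_ge_1[of "e a"] mult_le_mono1[of 1 "dsize (e a)" "(dsize (e a) + 1) ^ k"]
          by (simp add: algebra_simps)
        finally show ?thesis by simp
      qed
      then show ?thesis unfolding poly_bounded_def by blast
    qed
    show "poly_bounded A e (\<lambda>a. T a + 1)" "poly_bounded A e (\<lambda>a. T' a + 1)"
      using * assms by auto
  qed
  then show ?thesis by (rule poly_bounded_mono) simp
qed

lemma poly_bounded_dsize: "poly_bounded A e (\<lambda>a. dsize (e a))"
  unfolding poly_bounded_def by (intro exI[of _ 1]) auto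

lemma poly_bounded_comp:
  assumes T: "poly_bounded B f T" and g: "\<And>a. a \<in> A \<Longrightarrow> g a \<in> B"
    and f: "poly_bounded A e (\<lambda>a. dsize (f (g a)))"
  shows "poly_bounded A e (\<lambda>a. T (g a))"
proof -
  from T obtain k where k: "\<forall>a\<in>B. T a \<le> (dsize (f a) + 1) ^ k" unfolding poly_bounded_def by blast
  have "poly_bounded A e (\<lambda>a. dsize (f (g a)) + 1)" using f by (intro poly_bounded_add poly_bounded_const)
  then obtain l where l: "\<forall>a\<in>A. dsize (f (g a)) + 1 \<le> (dsize (e a) + 1) ^ l"
    unfolding poly_bounded_def by blast
  have "T (g a) \<le> (dsize (e a) + 1) ^ (l * k)" if "a \<in> A" for a
  proof -
    have "T (g a) \<le> (dsize (f (g a)) + 1) ^ k" using k g that by blast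
    also have "\<dots> \<le> ((dsize (e a) + 1) ^ l) ^ k" using l that by (intro power_mono) auto
    finally show ?thesis by (simp add: power_mult)
  qed
  then show ?thesis unfolding poly_bounded_def by blast
qed

lemma expr_cost_ge: "dsize (eval_expr e s) \<le> expr_cost e s"
  by (cases e) auto

text \<open>An assigned value is charged in full, so no value outgrows the time spent. This turns
  time bounds into the size bounds that compositions need.\<close>

lemma exec_dsize: "exec c s t s' \<Longrightarrow> dsize (s' v) \<le> dsize (s v) + t"
proof (induction rule: exec.induct)
  case (Assign w e s)
  then show ?case using expr_cost_ge[of e s] by auto
qed auto

lemma poly_time_dsize:
  assumes "poly_time A e f" shows "poly_bounded A e (\<lambda>a. dsize (f a))"
proof -
  from assms obtain T where T: "poly_bounded A e T" "\<forall>b. \<exists>c. implements c b A e f T"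
    by (rule poly_timeE)
  from T(2) obtain c where c: "implements c 0 A e f T" by blast
  have "dsize (f a) \<le> dsize (e a) + T a" if "a \<in> A" for a
  proof -
    from implementsE[where s = "\<lambda>_. e a", OF c that] obtain t s'
      where "exec c (\<lambda>_. e a) t s'" "s' 0 = f a" "t \<le> T a" by auto
    then show ?thesis using exec_dsize[of c "\<lambda>_. e a" t s' 0] by simp
  qed
  then show ?thesis
    by (rule poly_bounded_mono[OF poly_bounded_add[OF poly_bounded_dsize T(1)]])
qed

lemma poly_time_id: "poly_time A e e"
proof (rule poly_timeI[OF poly_bounded_const[of _ _ 1]], rule exI[of _ Skip], rule implementsI)
  fix b a and s :: state assume "s b = e a"
  then show "\<exists>t s'. exec Skip s t s' \<and> s' b = e a \<and> (\<forall>v<b. s' v = s v) \<and> t \<le> 1"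
    by (intro exI[of _ 1] exI[of _ s]) (auto intro: exec.Skip[simplified])
qed

lemma poly_time_subset: 
  assumes "poly_time A e f" "B \<subseteq> A" shows "poly_time B e f"
proof -
  from assms(1) obtain T where T: "poly_bounded A e T" "\<forall>b. \<exists>c. implements c b A e f T"
    by (rule poly_timeE)
  have "implements c b B e f T" if "implements c b A e f T" for c b
    using that assms(2) unfolding implements_def by blast
  then show ?thesis
    by (intro poly_timeI[OF poly_bounded_subset[OF T(1) assms(2)]]) (metis T(2))
qed

lemma poly_time_cong:
  assumes "poly_time A e f" "\<And>a. a \<in> A \<Longrightarrow> f a = g a" shows "poly_time A e g"
proof -
  have "implements c b A e g T" if "implements c b A e f T" for c b T
    using that assms(2) unfolding implements_def by simp
  then show ?thesis using assms(1) unfolding poly_time_def by blast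
qed

lemma poly_time_comp:
  assumes h: "poly_time A e (\<lambda>a. e' (h a))" and B: "\<And>a. a \<in> A \<Longrightarrow> h a \<in> B"
    and g: "poly_time B e' g"
  shows "poly_time A e (\<lambda>a. g (h a))"
proof -
  from h obtain T where T: "poly_bounded A e T" "\<forall>b. \<exists>c. implements c b A e (\<lambda>a. e' (h a)) T"
    by (rule poly_timeE)
  from g obtain U where U: "poly_bounded B e' U" "\<forall>b. \<exists>c. implements c b B e' g U"
    by (rule poly_timeE)
  show ?thesis
  proof (rule poly_timeI)
    show "poly_bounded A e (\<lambda>a. 1 + T a + U (h a))"
      by (intro poly_bounded_add poly_bounded_const T(1)
          poly_bounded_comp[OF U(1) B poly_time_dsize[OF h]])
    fix b
    from T(2) obtain c where c: "implements c b A e (\<lambda>a. e' (h a)) T" by blast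
    from U(2) obtain d where d: "implements d b B e' g U" by blast
    have "implements (Seq c d) b A e (\<lambda>a. g (h a)) (\<lambda>a. 1 + T a + U (h a))"
    proof (rule implementsI)
      fix a and s :: state assume a: "a \<in> A" "s b = e a"
      obtain t s' where 1: "exec c s t s'" "s' b = e' (h a)" "\<And>v. v < b \<Longrightarrow> s' v = s v" "t \<le> T a"
        using implementsE[where s = s, OF c a] by metis
      obtain u s'' where 2: "exec d s' u s''" "s'' b = g (h a)"
        "\<And>v. v < b \<Longrightarrow> s'' v = s' v" "u \<le> U (h a)"
        using implementsE[where s = s', OF d B[OF a(1)] 1(2)] by metis
      show "\<exists>t s'. exec (Seq c d) s t s' \<and> s' b = g (h a) \<and> (\<forall>v<b. s' v = s v) \<and>
          t \<le> 1 + T a + U (h a)"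
        using exec.Seq[OF 1(1) 2(1)] 1 2 by (intro exI[of _ "1 + t + u"] exI[of _ s'']) auto
    qed
    then show "\<exists>c. implements c b A e (\<lambda>a. g (h a)) (\<lambda>a. 1 + T a + U (h a))" by blast
  qed
qed

lemma poly_time_unary:
  assumes F: "\<And>v s. eval_expr (F (Var v)) s = G (s v)"
    and C: "\<And>v s. expr_cost (F (Var v)) s = dsize (s v) + dsize (G (s v))"
    and le: "\<And>x. dsize (G x) \<le> dsize x + 2"
    and f: "poly_time A e f"
  shows "poly_time A e (\<lambda>a. G (f a))"
proof (rule poly_time_comp[of A e "\<lambda>x. x" f UNIV G])
  show "poly_time UNIV (\<lambda>x. x) G"
  proof (rule poly_timeI)
    show "poly_bounded UNIV (\<lambda>x. x) (\<lambda>x. 3 + 2 * dsize x)"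
      by (intro poly_bounded_add poly_bounded_mult poly_bounded_const poly_bounded_dsize)
    fix b
    have "implements (Assign b (F (Var b))) b UNIV (\<lambda>x. x) G (\<lambda>x. 3 + 2 * dsize x)"
    proof (rule implementsI)
      fix a and s :: state assume "s b = a"
      then show "\<exists>t s'. exec (Assign b (F (Var b))) s t s' \<and> s' b = G a \<and>
        (\<forall>v<b. s' v = s v) \<and> t \<le> 3 + 2 * dsize a"
        using exec.Assign[of b "F (Var b)" s] le[of a]
        by (intro exI[of _ "1 + expr_cost (F (Var b)) s"] exI[of _ "s(b := G a)"]) (auto simp: F C)
    qed
    then show "\<exists>c. implements c b UNIV (\<lambda>x. x) G (\<lambda>x. 3 + 2 * dsize x)" by blast
  qed
qed (use f in auto)

lemma dsize_left: "dsize (left x) \<le> dsize x + 2" by (cases x) (auto simp: floorlog_eq_zero_iff[THEN iffD2])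
lemma dsize_right: "dsize (right x) \<le> dsize x + 2" by (cases x) (auto simp: floorlog_eq_zero_iff[THEN iffD2])

lemma poly_time_left: "poly_time A e f \<Longrightarrow> poly_time A e (\<lambda>a. left (f a))"
  by (rule poly_time_unary[of Left left]) (auto simp: dsize_left[simplified])

lemma poly_time_right: "poly_time A e f \<Longrightarrow> poly_time A e (\<lambda>a. right (f a))"
  by (rule poly_time_unary[of Right right]) (auto simp: dsize_right[simplified])

text \<open>Programs work in place, so each component gets a copy of the input. The second copy is
  made only after the first computation, which may overwrite everything above
  \<open>Suc b\<close>.\<close>

lemma poly_time_Node:
  assumes f: "poly_time A e f" and g: "poly_time A e g"
  shows "poly_time A e (\<lambda>a. Node (f a) (g a))"
proof -
  from f obtain T where T: "poly_bounded A e T" "\<forall>b. \<exists>c. implements c b A e f T"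
    by (rule poly_timeE)
  from g obtain U where U: "poly_bounded A e U" "\<forall>b. \<exists>c. implements c b A e g U"
    by (rule poly_timeE)
  define W where "W = (\<lambda>a. 10 + 2 * dsize (e a) + T a + U a + 2 * dsize (f a) + 2 * dsize (g a))"
  show ?thesis
  proof (rule poly_timeI)
    show "poly_bounded A e W" unfolding W_def
      by (intro poly_bounded_add poly_bounded_mult poly_bounded_const poly_bounded_dsize T U
          poly_time_dsize f g)
    fix b
    from T(2) obtain c where c: "implements c (Suc b) A e f T" by blast
    from U(2) obtain d where d: "implements d (Suc (Suc b)) A e g U" by blast
    let ?p1 = "Assign (Suc b) (Var b)" and ?p2 = "Assign (Suc (Suc b)) (Var b)"
    let ?p3 = "Assign b (Cons (Var (Suc b)) (Var (Suc (Suc b))))"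
    let ?p = "Seq ?p1 (Seq c (Seq ?p2 (Seq d ?p3)))"
    have "implements ?p b A e (\<lambda>a. Node (f a) (g a)) W"
    proof (rule implementsI)
      fix a and s :: state assume a: "a \<in> A" "s b = e a"
      let ?s1 = "s(Suc b := e a)"
      have 1: "exec ?p1 s (1 + dsize (e a)) ?s1"
        using exec.Assign[of "Suc b" "Var b" s] a by simp
      have "?s1 (Suc b) = e a" by simp
      from implementsE[where s = ?s1, OF c a(1) this]
      obtain t s' where 2: "exec c ?s1 t s'" "s' (Suc b) = f a"
        "\<And>v. v < Suc b \<Longrightarrow> s' v = ?s1 v" "t \<le> T a" by metis
      let ?s2 = "s'(Suc (Suc b) := e a)"
      have sb: "s' b = e a" using 2 a by simp
      have 3: "exec ?p2 s' (1 + dsize (e a)) ?s2"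
        using exec.Assign[of "Suc (Suc b)" "Var b" s'] sb by simp
      have "?s2 (Suc (Suc b)) = e a" by simp
      from implementsE[where s = ?s2, OF d a(1) this]
      obtain u s'' where 4: "exec d ?s2 u s''" "s'' (Suc (Suc b)) = g a"
         "\<And>v. v < Suc (Suc b) \<Longrightarrow> s'' v = ?s2 v" "u \<le> U a" by metis
      have sb: "s'' (Suc b) = f a" using 4 2 by simp
      let ?s3 = "s''(b := Node (f a) (g a))"
      have 5: "exec ?p3 s'' (2 + (dsize (f a) + dsize (g a) + (dsize (f a) + dsize (g a)))) ?s3"
        using exec.Assign[of b "Cons (Var (Suc b)) (Var (Suc (Suc b)))" s''] sb 4(2)
        by simp
      note E = exec.Seq[OF 1 exec.Seq[OF 2(1) exec.Seq[OF 3 exec.Seq[OF 4(1) 5]]]]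
      show "\<exists>t s'. exec ?p s t s' \<and> s' b = Node (f a) (g a) \<and> (\<forall>v<b. s' v = s v) \<and> t \<le> W a"
      proof (intro exI conjI)
        from E show "exec ?p s (1 + (1 + dsize (e a)) + (1 + t + (1 + (1 + dsize (e a)) +
          (1 + u + (2 + (dsize (f a) + dsize (g a) + (dsize (f a) + dsize (g a)))))))) ?s3" .
        show "\<forall>v<b. ?s3 v = s v" using 2(3) 4(3) by simp
      qed (use 2(4) 4(4) in \<open>auto simp: W_def\<close>)
    qed
    then show "\<exists>c. implements c b A e (\<lambda>a. Node (f a) (g a)) W" by blast
  qed
qed

lemma dsize_Atom_le_iff: "dsize (Atom i) \<le> Suc k \<longleftrightarrow> \<bar>i\<bar> < 2 ^ k"
proof -
  have "floorlog 2 (nat \<bar>i\<bar>) \<le> k \<longleftrightarrow> nat \<bar>i\<bar> < 2 ^ k" by (simp add: floorlog_le_iff)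
  also have "\<dots> \<longleftrightarrow> \<bar>i\<bar> < 2 ^ k" by (simp add: nat_less_iff)
  finally show ?thesis by simp
qed

lemma abs_div_int_le: "\<bar>i div j\<bar> \<le> \<bar>i\<bar>" for i j :: int
proof -
  have pos: "\<bar>i div j\<bar> \<le> \<bar>i\<bar>" if "j > 0" for i j :: int
  proof (cases "i < 0")
    case True
    then have "i \<le> i div j" using zdiv_mono2_neg[of i 1 j] that by simp
    moreover have "i div j < 0" using True that by (simp add: pos_imp_zdiv_neg_iff)
    ultimately show ?thesis by simp
  next
    case False
    then have "i div j \<le> i" using zdiv_mono2[of i 1 j] that by simp
    moreover have "i div j \<ge> 0" using False that by (simp add: pos_imp_zdiv_nonneg_iff)
    ultimately show ?thesis by simp
  qed
  show ?thesis
  proof (cases j "0 :: int" rule: linorder_cases)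
    case less
    then show ?thesis using pos[of "-j" "-i"] by simp
  qed (use pos in auto)
qed

lemma dsize_apply_binop:
  "dsize (Atom (apply_binop f i j)) \<le> dsize (Atom i) + dsize (Atom j) + 10"
proof -
  obtain k l where kl: "dsize (Atom i) = Suc k" "dsize (Atom j) = Suc l" by auto
  then have i: "\<bar>i\<bar> < 2 ^ k" and j: "\<bar>j\<bar> < 2 ^ l"
    using dsize_Atom_le_iff[of i k] dsize_Atom_le_iff[of j l] by auto
  have p: "(2::int) ^ k \<le> 2 ^ (k + l)" "(2::int) ^ l \<le> 2 ^ (k + l)" "(1::int) \<le> 2 ^ (k + l)"
    by (auto intro: power_increasing)
  have "\<bar>apply_binop f i j\<bar> < 2 ^ (k + l + 1)"
  proof (cases f)
    case Add
    have "\<bar>i + j\<bar> < 2 * 2 ^ (k + l)" using i j p by linarith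
    then show ?thesis using Add by simp
  next
    case Sub
    have "\<bar>i - j\<bar> < 2 * 2 ^ (k + l)" using i j p by linarith
    then show ?thesis using Sub by simp
  next
    case Leq
    have "\<bar>of_bool (i \<le> j)\<bar> \<le> (1 :: int)" by simp
    then have "\<bar>of_bool (i \<le> j)\<bar> < (2 * 2 ^ (k + l) :: int)" using p(3) by linarith
    then show ?thesis using Leq by simp
  next
    case Mul
    have "\<bar>i * j\<bar> < 2 ^ k * 2 ^ l"
      unfolding abs_mult using i j by (intro mult_strict_mono') auto
    then show ?thesis using Mul by (simp add: power_add)
  next
    case Div
    have "\<bar>i div j\<bar> \<le> \<bar>i\<bar>" by (rule abs_div_int_le)
    then have "\<bar>i div j\<bar> < 2 ^ k" using i by linarith
    with p have "\<bar>i div j\<bar> < 2 * 2 ^ (k + l)" by linarith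
    then show ?thesis using Div by simp
  next
    case Mod
    have "\<bar>i mod j\<bar> \<le> \<bar>i\<bar> + \<bar>j\<bar>"
      using abs_mod_less[of j i] by (cases "j = 0") auto
    with i j p have "\<bar>i mod j\<bar> < 2 * 2 ^ (k + l)" by linarith
    then show ?thesis using Mod by simp
  qed
  then have "dsize (Atom (apply_binop f i j)) \<le> Suc (k + l + 1)"
    using dsize_Atom_le_iff by blast
  then show ?thesis using kl by simp
qed

lemma poly_time_Bin_apply:
  "poly_time UNIV (\<lambda>(i, j). Node (Atom i) (Atom j)) (\<lambda>(i, j). Atom (apply_binop f i j))"
    (is "poly_time UNIV ?e ?f")
proof (rule poly_timeI)
  let ?W = "\<lambda>a. 100 * dsize (?e a) + 100"
  show "poly_bounded UNIV ?e ?W"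
    by (intro poly_bounded_add poly_bounded_mult poly_bounded_const poly_bounded_dsize)
  fix b
  let ?p = "Bin f (Left (Var b)) (Right (Var b))"
  have "implements (Assign b ?p) b UNIV ?e ?f ?W"
  proof (rule implementsI)
    fix a and s :: state assume s: "s b = ?e a"
    obtain i j where a: "a = (i, j)" by (cases a)
    have "dsize (Atom (apply_binop f i j)) \<le> dsize (Atom i) + dsize (Atom j) + 10"
      by (rule dsize_apply_binop)
    then show "\<exists>t s'. exec (Assign b ?p) s t s' \<and> s' b = ?f a \<and> (\<forall>v<b. s' v = s v) \<and> t \<le> ?W a"
      using exec.Assign[of b ?p s] s
      by (intro exI[of _ "1 + expr_cost ?p s"] exI[of _ "s(b := Atom (apply_binop f i j))"]) (auto simp: a)
  qed
  then show "\<exists>c. implements c b UNIV ?e ?f ?W" by blast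
qed

lemma poly_time_Bin:
  assumes f: "poly_time A e (\<lambda>a. Atom (f a))" and g: "poly_time A e (\<lambda>a. Atom (g a))"
  shows "poly_time A e (\<lambda>a. Atom (apply_binop op (f a) (g a)))"
  using poly_time_comp[of A e "\<lambda>(i, j). Node (Atom i) (Atom j)" "\<lambda>a. (f a, g a)",
      OF _ _ poly_time_Bin_apply[of op]] poly_time_Node[OF f g] by simp

lemmas poly_time_add = poly_time_Bin[where op = Add, simplified]
lemmas poly_time_diff = poly_time_Bin[where op = Sub, simplified]
lemmas poly_time_mult = poly_time_Bin[where op = Mul, simplified]
lemmas poly_time_div = poly_time_Bin[where op = Div, simplified]
lemmas poly_time_leq = poly_time_Bin[where op = Leq, simplified]

lemma poly_time_const: "poly_time A e (\<lambda>_. x)"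
proof (induction x)
  case (Atom i)
  show ?case
  proof (rule poly_timeI)
    show "poly_bounded A e (\<lambda>_. 1 + dsize (Atom i))" by (rule poly_bounded_const)
    fix b
    have "implements (Assign b (Lit i)) b A e (\<lambda>_. Atom i) (\<lambda>_. 1 + dsize (Atom i))"
    proof (rule implementsI)
      fix a and s :: state
      show "\<exists>t s'. exec (Assign b (Lit i)) s t s' \<and> s' b = Atom i \<and> (\<forall>v<b. s' v = s v) \<and>
          t \<le> 1 + dsize (Atom i)"
        using exec.Assign[of b "Lit i" s]
        by (intro exI[of _ "1 + dsize (Atom i)"] exI[of _ "s(b := Atom i)"]) auto
    qed
    then show "\<exists>c. implements c b A e (\<lambda>_. Atom i) (\<lambda>_. 1 + dsize (Atom i))" by blast
  qed
qed (auto intro: poly_time_Node)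

text \<open>The condition is computed into a pair together with the input, since the test alone
  would destroy the input. Each branch has to be polynomial only where it is taken; finite case
  distinctions rely on this.\<close>

lemma poly_time_If:
  assumes P: "poly_time A e (\<lambda>a. Atom (of_bool (P a)))"
    and f: "poly_time {a\<in>A. P a} e f" and g: "poly_time {a\<in>A. \<not> P a} e g"
  shows "poly_time A e (\<lambda>a. if P a then f a else g a)"
proof -
  from f obtain T where T: "poly_bounded {a\<in>A. P a} e T"
      "\<forall>b. \<exists>c. implements c b {a\<in>A. P a} e f T"
    by (rule poly_timeE)
  from g obtain U where U: "poly_bounded {a\<in>A. \<not> P a} e U"
      "\<forall>b. \<exists>c. implements c b {a\<in>A. \<not> P a} e g U"
    by (rule poly_timeE)
  have "poly_time A e (\<lambda>a. Node (e a) (Atom (of_bool (P a))))"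
    by (intro poly_time_Node poly_time_id P)
  then obtain V where V: "poly_bounded A e V"
      "\<forall>b. \<exists>c. implements c b A e (\<lambda>a. Node (e a) (Atom (of_bool (P a)))) V"
    by (rule poly_timeE)
  define X where "X = (\<lambda>a. if P a then T a else U a)"
  define W where "W = (\<lambda>a. 100 + 3 * dsize (e a) + V a + X a)"
  have X: "poly_bounded A e X"
  proof -
    from T(1) U(1) obtain k l where k: "\<forall>a\<in>{a\<in>A. P a}. T a \<le> (dsize (e a) + 1) ^ k"
      and l: "\<forall>a\<in>{a\<in>A. \<not> P a}. U a \<le> (dsize (e a) + 1) ^ l"
      unfolding poly_bounded_def by blast
    have "X a \<le> (dsize (e a) + 1) ^ (k + l)" if "a \<in> A" for a
    proof -
      have "X a \<le> (dsize (e a) + 1) ^ (if P a then k else l)" using k l that by (auto simp: X_def)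
      also have "\<dots> \<le> (dsize (e a) + 1) ^ (k + l)" by (intro power_increasing) auto
      finally show ?thesis .
    qed
    then show ?thesis unfolding poly_bounded_def by blast
  qed
  show ?thesis
  proof (rule poly_timeI)
    show "poly_bounded A e W" unfolding W_def
      by (intro poly_bounded_add poly_bounded_mult poly_bounded_const poly_bounded_dsize V X)
    fix b
    from T(2) obtain c where c: "implements c b {a\<in>A. P a} e f T" by blast
    from U(2) obtain d where d: "implements d b {a\<in>A. \<not> P a} e g U" by blast
    from V(2) obtain m where m: "implements m b A e (\<lambda>a. Node (e a) (Atom (of_bool (P a)))) V" by blast
    let ?q = "Assign b (Left (Var b))"
    let ?p = "Seq m (If (Right (Var b)) (Seq ?q c) (Seq ?q d))"
    have "implements ?p b A e (\<lambda>a. if P a then f a else g a) W"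
    proof (rule implementsI)
      fix a and s :: state assume a: "a \<in> A" "s b = e a"
      from implementsE[where s = s, OF m a]
      obtain t s' where 1: "exec m s t s'" "s' b = Node (e a) (Atom (of_bool (P a)))"
        "\<And>v. v < b \<Longrightarrow> s' v = s v" "t \<le> V a" by metis
      let ?s = "s'(b := e a)"
      have h: "holds (Right (Var b)) s' \<longleftrightarrow> P a" using 1 by (simp add: holds_def)
      have 2: "exec ?q s' (1 + expr_cost (Left (Var b)) s') ?s"
        using exec.Assign[of b "Left (Var b)" s'] 1 by simp
      have s: "?s b = e a" by simp
      have cost: "expr_cost (Left (Var b)) s' \<le> 2 * dsize (e a) + 10"
        "expr_cost (Right (Var b)) s' \<le> dsize (e a) + 10"
        using 1 dsize_Atom_le_iff[of 1 1] dsize_Atom_le_iff[of 0 0] by (cases "P a"; simp)+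
      have "\<exists>u s''. exec (If (Right (Var b)) (Seq ?q c) (Seq ?q d)) s' u s'' \<and>
         s'' b = (if P a then f a else g a) \<and> (\<forall>v<b. s'' v = s' v) \<and> u \<le> 50 + 3 * dsize (e a) + X a"
      proof (cases "P a")
        case True
        with a have "a \<in> {a\<in>A. P a}" by simp
        from implementsE[where s = ?s, OF c this s]
        obtain u s'' where 3: "exec c ?s u s''" "s'' b = f a" "\<And>v. v < b \<Longrightarrow> s'' v = ?s v" "u \<le> T a"
          by metis
        from True h have hh: "holds (Right (Var b)) s'" by simp
        show ?thesis
          using exec.IfTrue[OF hh exec.Seq[OF 2 3(1)], of "Seq ?q d"] 3 True cost
          by (intro exI conjI) (assumption | auto simp: X_def)+
      next
        case False
        with a have "a \<in> {a\<in>A. \<not> P a}" by simp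
        from implementsE[where s = ?s, OF d this s]
        obtain u s'' where 3: "exec d ?s u s''" "s'' b = g a" "\<And>v. v < b \<Longrightarrow> s'' v = ?s v" "u \<le> U a"
          by metis
        from False h have hh: "\<not> holds (Right (Var b)) s'" by simp
        show ?thesis
          using exec.IfFalse[OF hh exec.Seq[OF 2 3(1)], of "Seq ?q c"] 3 False cost
          by (intro exI conjI) (assumption | auto simp: X_def)+
      qed
      then obtain u s'' where 2: "exec (If (Right (Var b)) (Seq ?q c) (Seq ?q d)) s' u s''"
         "s'' b = (if P a then f a else g a)" "\<forall>v<b. s'' v = s' v" "u \<le> 50 + 3 * dsize (e a) + X a"
        by blast
      show "\<exists>t s'. exec ?p s t s' \<and> s' b = (if P a then f a else g a) \<and> (\<forall>v<b. s' v = s v) \<and> t \<le> W a"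
        by (rule exI[of _ "1 + t + u"], rule exI[of _ s''])
          (use exec.Seq[OF 1(1) 2(1)] 1 2 in \<open>auto simp: W_def\<close>)
    qed
    then show "\<exists>c. implements c b A e (\<lambda>a. if P a then f a else g a) W" by blast
  qed
qed

text \<open>A loop over a list whose body also sees the rest of the list.\<close>

fun tfold :: "('b \<Rightarrow> 'x \<Rightarrow> 'x list \<Rightarrow> 'b) \<Rightarrow> 'b \<Rightarrow> 'x list \<Rightarrow> 'b" where
  "tfold f y [] = y"
| "tfold f y (x # xs) = tfold f (f y x xs) xs"

lemma dsize_encode_list_suffix: "dsize (encode_list enc ys) \<le> dsize (encode_list enc (xs @ ys))"
  by (induction xs) auto

lemma length_le_dsize: "length xs \<le> dsize (encode_list enc xs)"
proof (induction xs)
  case (Cons x xs)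
  then show ?case using dsize_ge_1[of "enc x"] by simp
qed simp

text \<open>Polynomially many polynomial steps may still blow up a value exponentially, as repeated
  squaring does. The invariant \<open>P\<close> with the bound \<open>T\<close> on the accumulator
  excludes this; it also sees the rest of the list, so that growth per step can be budgeted.\<close>

theorem poly_time_tfold:
  fixes xs :: "'a \<Rightarrow> 'x list" and f :: "'a \<Rightarrow> 'b \<Rightarrow> 'x \<Rightarrow> 'x list \<Rightarrow> 'b"
  assumes xs: "poly_time A e (\<lambda>a. encode_list enc (xs a))"
    and ini: "poly_time A e (\<lambda>a. enc' (ini a))"
    and step: "poly_time {(a, y, x, r). a \<in> A \<and> P a y (x # r)}
      (\<lambda>(a, y, x, r). Node (e a) (Node (enc' y) (Node (enc x) (encode_list enc r))))
      (\<lambda>(a, y, x, r). enc' (f a y x r))" (is "poly_time ?B ?e' _")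
    and P_ini: "\<And>a. a \<in> A \<Longrightarrow> P a (ini a) (xs a)"
    and P_step: "\<And>a y x r. a \<in> A \<Longrightarrow> P a y (x # r) \<Longrightarrow> P a (f a y x r) r"
    and T: "poly_bounded A e T" and P_le: "\<And>a y l. a \<in> A \<Longrightarrow> P a y l \<Longrightarrow> dsize (enc' y) \<le> T a"
  shows "poly_time A e (\<lambda>a. enc' (tfold (f a) (ini a) (xs a)))"
proof -
  define st where "st = (\<lambda>a y l. Node (e a) (Node (enc' y) (encode_list enc l)))"
  have e': "poly_time ?B ?e' ?e'" by (rule poly_time_id)
  have "poly_time ?B ?e' (\<lambda>z. Node (left (?e' z))
      (Node (case z of (a, y, x, r) \<Rightarrow> enc' (f a y x r)) (right (right (right (?e' z))))))"
    by (intro poly_time_Node poly_time_left poly_time_right step e')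
  then have body: "poly_time ?B ?e' (\<lambda>(a, y, x, r). st a (f a y x r) r)"
    by (rule poly_time_cong) (auto simp: st_def)
  then obtain U where U: "poly_bounded ?B ?e' U"
      "\<forall>b. \<exists>c. implements c b ?B ?e' (\<lambda>(a, y, x, r). st a (f a y x r) r) U"
    by (rule poly_timeE)
  from U(1) obtain k where k: "\<forall>z\<in>?B. U z \<le> (dsize (?e' z) + 1) ^ k"
    unfolding poly_bounded_def by blast
  define N where "N = (\<lambda>a. dsize (e a) + T a + dsize (encode_list enc (xs a)) + 10)"
  define C where "C = (\<lambda>a. 1 + 4 * N a + N a ^ k)"
  have N: "poly_bounded A e N" unfolding N_def
    by (intro poly_bounded_add poly_bounded_const poly_bounded_dsize T poly_time_dsize xs)
  have Nk: "poly_bounded A e (\<lambda>a. N a ^ l)" for l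
    by (induction l) (auto intro!: poly_bounded_const poly_bounded_mult N)
  have C: "poly_bounded A e C" unfolding C_def
    by (intro poly_bounded_add poly_bounded_mult poly_bounded_const N Nk)
  define g where "g = (\<lambda>b. IsNode (Right (Right (Var b))))"
  have loop: "\<exists>t s'. exec (While (g b) c) s t s' \<and> s' b = st a (tfold (f a) y l) [] \<and>
      (\<forall>v<b. s' v = s v) \<and> t \<le> (length l + 1) * C a"
    if c: "implements c b ?B ?e' (\<lambda>(a, y, x, r). st a (f a y x r) r) U"
      and "a \<in> A" "xs a = pre @ l" "P a y l" "s b = st a y l" for a b c pre l y s
    using that(3-)
  proof (induction l arbitrary: pre y s)
    case Nil
    have "dsize (enc' y) \<le> T a" using Nil P_le \<open>a \<in> A\<close> by auto
    moreover have "dsize (encode_list enc ([]::'x list)) \<le> dsize (encode_list enc (xs a))"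
      by (metis append_Nil2 dsize_encode_list_suffix)
    ultimately have "expr_cost (g b) s \<le> 4 * N a"
      using Nil dsize_Atom_le_iff[of 0 0] by (simp add: g_def st_def N_def)
    moreover have "\<not> holds (g b) s" using Nil by (simp add: g_def holds_def st_def)
    ultimately show ?case
      by (intro exI[of _ "1 + expr_cost (g b) s"] exI[of _ s])
        (use Nil in \<open>auto intro!: exec.WhileFalse[simplified] simp: C_def st_def\<close>)
  next
    case (Cons x r)
    have T: "dsize (enc' y) \<le> T a" using Cons P_le \<open>a \<in> A\<close> by auto
    have L: "dsize (encode_list enc (x # r)) \<le> dsize (encode_list enc (xs a))"
      unfolding Cons.prems(1) by (rule dsize_encode_list_suffix)
    have g: "expr_cost (g b) s \<le> 4 * N a"
      using Cons.prems T L dsize_Atom_le_iff[of 1 1] by (simp add: g_def st_def N_def)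
    have h: "holds (g b) s" using Cons by (simp add: g_def holds_def st_def)
    have z: "(a, y, x, r) \<in> ?B" using \<open>a \<in> A\<close> Cons.prems by simp
    have "s b = ?e' (a, y, x, r)" using Cons.prems by (simp add: st_def)
    from implementsE[where s = s, OF c z this] obtain t s' where
      1: "exec c s t s'" "s' b = st a (f a y x r) r" "\<And>v. v < b \<Longrightarrow> s' v = s v" "t \<le> U (a, y, x, r)"
      by auto
    have "xs a = (pre @ [x]) @ r" using Cons.prems by simp
    from Cons.IH[where s = s', OF this P_step[OF \<open>a \<in> A\<close> Cons.prems(2)] 1(2)] obtain u s'' where
      2: "exec (While (g b) c) s' u s''" "s'' b = st a (tfold (f a) (f a y x r) r) []"
         "\<forall>v<b. s'' v = s' v" "u \<le> (length r + 1) * C a" by auto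
    have "U (a, y, x, r) \<le> (dsize (?e' (a, y, x, r)) + 1) ^ k" using k z by blast
    also have "\<dots> \<le> N a ^ k" using T L by (intro power_mono) (auto simp: N_def)
    finally have "1 + expr_cost (g b) s + t + u \<le> (length (x # r) + 1) * C a"
      using 1(4) 2(4) g by (simp add: C_def)
    then show ?case
      using exec.WhileTrue[OF h 1(1) 2(1)] 1 2
      by (intro exI[of _ "1 + expr_cost (g b) s + t + u"] exI[of _ s'']) auto
  qed
  have "poly_time A e (\<lambda>a. st a (ini a) (xs a))"
    unfolding st_def by (intro poly_time_Node poly_time_id ini xs)
  then obtain V where V: "poly_bounded A e V"
      "\<forall>b. \<exists>c. implements c b A e (\<lambda>a. st a (ini a) (xs a)) V"
    by (rule poly_timeE)
  have "poly_time A e (\<lambda>a. st a (tfold (f a) (ini a) (xs a)) [])"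
  proof (rule poly_timeI)
    let ?W = "\<lambda>a. 1 + V a + (dsize (encode_list enc (xs a)) + 1) * C a"
    show "poly_bounded A e ?W"
      by (intro poly_bounded_add poly_bounded_mult poly_bounded_const V C poly_time_dsize xs)
    fix b
    from V(2) obtain m where m: "implements m b A e (\<lambda>a. st a (ini a) (xs a)) V" by blast
    from U(2) obtain c where c: "implements c b ?B ?e' (\<lambda>(a, y, x, r). st a (f a y x r) r) U" by blast
    have "implements (Seq m (While (g b) c)) b A e (\<lambda>a. st a (tfold (f a) (ini a) (xs a)) []) ?W"
    proof (rule implementsI)
      fix a and s :: state assume a: "a \<in> A" "s b = e a"
      from implementsE[where s = s, OF m a] obtain t s' where
        1: "exec m s t s'" "s' b = st a (ini a) (xs a)" "\<And>v. v < b \<Longrightarrow> s' v = s v" "t \<le> V a" by metis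
      obtain u s'' where 2: "exec (While (g b) c) s' u s''" "s'' b = st a (tfold (f a) (ini a) (xs a)) []"
          "\<forall>v<b. s'' v = s' v" "u \<le> (length (xs a) + 1) * C a"
        using loop[OF c a(1), of "[]" "xs a" "ini a" s'] P_ini[OF a(1)] 1(2) by auto
      have "(length (xs a) + 1) * C a \<le> (dsize (encode_list enc (xs a)) + 1) * C a"
        using length_le_dsize[of "xs a" enc] by (intro mult_right_mono) auto
      with 2(4) have "u \<le> (dsize (encode_list enc (xs a)) + 1) * C a" by (rule le_trans)
      then show "\<exists>t s'. exec (Seq m (While (g b) c)) s t s' \<and>
          s' b = st a (tfold (f a) (ini a) (xs a)) [] \<and> (\<forall>v<b. s' v = s v) \<and> t \<le> ?W a"
        by (intro exI[of _ "1 + t + u"] exI[of _ s'']) (use exec.Seq[OF 1(1) 2(1)] 1 2(2,3) in auto)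
    qed
    then show "\<exists>c. implements c b A e (\<lambda>a. st a (tfold (f a) (ini a) (xs a)) []) ?W" by blast
  qed
  then have "poly_time A e (\<lambda>a. left (right (st a (tfold (f a) (ini a) (xs a)) [])))"
    by (intro poly_time_left poly_time_right)
  then show ?thesis by (simp add: st_def)
qed

lemma poly_time_of_bool_eq:
  assumes "poly_time A e (\<lambda>a. Atom (f a))" "poly_time A e (\<lambda>a. Atom (g a))"
  shows "poly_time A e (\<lambda>a. Atom (of_bool (f a = g a)))"
proof -
  have "poly_time A e (\<lambda>a. Atom (of_bool (f a \<le> g a) * of_bool (g a \<le> f a)))"
    by (intro poly_time_mult poly_time_leq assms)
  then show ?thesis by (rule poly_time_cong) auto
qed

lemma poly_time_min:
  assumes "poly_time A e (\<lambda>a. Atom (f a))" "poly_time A e (\<lambda>a. Atom (g a))"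
  shows "poly_time A e (\<lambda>a. Atom (min (f a) (g a)))"
proof -
  have "poly_time A e (\<lambda>a. if f a \<le> g a then Atom (f a) else Atom (g a))"
    by (intro poly_time_If poly_time_leq assms) (use assms in \<open>auto intro: poly_time_subset\<close>)
  then show ?thesis by (rule poly_time_cong) (auto simp: min_def)
qed

lemma poly_time_max:
  assumes "poly_time A e (\<lambda>a. Atom (f a))" "poly_time A e (\<lambda>a. Atom (g a))"
  shows "poly_time A e (\<lambda>a. Atom (max (f a) (g a)))"
proof -
  have "poly_time A e (\<lambda>a. if f a \<le> g a then Atom (g a) else Atom (f a))"
    by (intro poly_time_If poly_time_leq assms) (use assms in \<open>auto intro: poly_time_subset\<close>)
  then show ?thesis by (rule poly_time_cong) (auto simp: max_def)
qed

text \<open>This is how constants get hardwired: each of the \<open>K\<close> values has its own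
  program, so \<open>h\<close> may depend on its index in any way, computable or not.\<close>

lemma poly_time_finite:
  fixes n :: "'a \<Rightarrow> nat"
  assumes "poly_time A e (\<lambda>a. Atom (int (n a)))" "\<And>a. a \<in> A \<Longrightarrow> n a < K"
    and "\<And>i. i < K \<Longrightarrow> poly_time {a\<in>A. n a = i} e (h i)"
  shows "poly_time A e (\<lambda>a. h (n a) a)"
  using assms
proof (induction K arbitrary: A)
  case 0
  then have "A = {}" by auto
  then show ?case using poly_time_const[of A e "Atom 0"] by (auto intro: poly_time_cong)
next
  case (Suc K)
  have 1: "poly_time {a\<in>A. int K \<le> int (n a)} e (\<lambda>a. h (n a) a)"
  proof (rule poly_time_cong)
    have "{a\<in>A. int K \<le> int (n a)} = {a\<in>A. n a = K}" using Suc.prems(2) by force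
    then show "poly_time {a\<in>A. int K \<le> int (n a)} e (h K)" using Suc.prems(3)[of K] by simp
    show "h K a = h (n a) a" if "a \<in> {a\<in>A. int K \<le> int (n a)}" for a
    proof -
      have "n a = K" using Suc.prems(2)[of a] that by force
      then show ?thesis by simp
    qed
  qed
  have 2: "poly_time {a\<in>A. \<not> int K \<le> int (n a)} e (\<lambda>a. h (n a) a)"
  proof (rule Suc.IH)
    show "poly_time {a\<in>A. \<not> int K \<le> int (n a)} e (\<lambda>a. Atom (int (n a)))"
      by (rule poly_time_subset[OF Suc.prems(1)]) auto
    show "poly_time {a \<in> {a \<in> A. \<not> int K \<le> int (n a)}. n a = i} e (h i)" if "i < K" for i
      by (rule poly_time_subset[OF Suc.prems(3)]) (use that in auto)
  qed auto
  have "poly_time A e (\<lambda>a. if int K \<le> int (n a) then h (n a) a else h (n a) a)"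
    by (intro poly_time_If poly_time_leq poly_time_const Suc.prems(1) 1 2)
  then show ?case by simp
qed

text \<open>The list takes only finitely many values, so an arbitrary function \<open>g\<close> of
  it becomes a lookup table in the program.\<close>

lemma poly_time_finite_list:
  fixes fs :: "('a \<Rightarrow> nat) list" and g :: "nat list \<Rightarrow> data"
  assumes "\<And>f. f \<in> set fs \<Longrightarrow> poly_time A e (\<lambda>a. Atom (int (f a)))"
    and "\<And>f a. f \<in> set fs \<Longrightarrow> a \<in> A \<Longrightarrow> f a < K"
  shows "poly_time A e (\<lambda>a. g (map (\<lambda>f. f a) fs))"
  using assms
proof (induction fs arbitrary: A g)
  case Nil
  show ?case by (simp add: poly_time_const)
next
  case (Cons f fs)
  have "poly_time A e (\<lambda>a. (\<lambda>i a. g (i # map (\<lambda>f. f a) fs)) (f a) a)"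
  proof (rule poly_time_finite[where K = K])
    fix i
    show "poly_time {a\<in>A. f a = i} e (\<lambda>a. g (i # map (\<lambda>f. f a) fs))"
      by (rule Cons.IH) (use Cons.prems in \<open>auto intro: poly_time_subset\<close>)
  qed (use Cons.prems in auto)
  then show ?case by simp
qed

text \<open>Needed for partial sums: the position of an item depends on the weight of the items
  after it, and the position of a bin on the room of the bins after it.\<close>

fun map_rest :: "('x \<Rightarrow> 'x list \<Rightarrow> 'y) \<Rightarrow> 'x list \<Rightarrow> 'y list" where
  "map_rest f [] = []"
| "map_rest f (x # xs) = f x xs # map_rest f xs"

lemma map_rest_map: "map_rest (\<lambda>x _. f x) xs = map f xs"
  by (induction xs) auto

lemma length_map_rest [simp]: "length (map_rest f xs) = length xs"
  by (induction xs) auto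

lemma tfold_Cons: "tfold (\<lambda>y x r. f x r # y) ys xs = rev (map_rest f xs) @ ys"
  by (induction xs arbitrary: ys) auto

lemma tfold_add: "tfold (\<lambda>y x r. y + f x r) (i :: int) xs = i + sum_list (map_rest f xs)"
  by (induction xs arbitrary: i) auto

definition enc_rest :: "('a \<Rightarrow> data) \<Rightarrow> ('x \<Rightarrow> data) \<Rightarrow> 'a \<times> 'x \<times> 'x list \<Rightarrow> data" where
  "enc_rest e enc = (\<lambda>(a, x, r). Node (e a) (Node (enc x) (encode_list enc r)))"

definition enc_pair :: "('a \<Rightarrow> data) \<Rightarrow> ('x \<Rightarrow> data) \<Rightarrow> 'a \<times> 'x \<Rightarrow> data" where
  "enc_pair e enc = (\<lambda>(a, x). Node (e a) (enc x))"

text \<open>Only genuine suffixes of the traversed list occur, so that a bound in terms of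
  \<open>(a, x, r)\<close> is also a bound in terms of \<open>a\<close>, see
  \<open>poly_bounded_rests\<close>.\<close>

definition rests :: "'a set \<Rightarrow> ('a \<Rightarrow> 'x list) \<Rightarrow> ('a \<times> 'x \<times> 'x list) set" where
  "rests A xs = {(a, x, r). a \<in> A \<and> suffix (x # r) (xs a)}"

lemma poly_bounded_rests:
  assumes U: "poly_bounded (rests A xs) (enc_rest e enc) U"
    and xs: "poly_time A e (\<lambda>a. encode_list enc (xs a))"
  obtains M where "poly_bounded A e M" "\<And>a x r. a \<in> A \<Longrightarrow> suffix (x # r) (xs a) \<Longrightarrow> U (a, x, r) \<le> M a"
proof -
  from U obtain k where k: "\<forall>z\<in>rests A xs. U z \<le> (dsize (enc_rest e enc z) + 1) ^ k"
    unfolding poly_bounded_def by blast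
  define N where "N = (\<lambda>a. dsize (e a) + dsize (encode_list enc (xs a)) + 5)"
  have N: "poly_bounded A e N" unfolding N_def
    by (intro poly_bounded_add poly_bounded_const poly_bounded_dsize poly_time_dsize xs)
  have "poly_bounded A e (\<lambda>a. N a ^ k)"
    by (induction k) (auto intro!: poly_bounded_const poly_bounded_mult N)
  moreover have "U (a, x, r) \<le> N a ^ k" if "a \<in> A" "suffix (x # r) (xs a)" for a x r
  proof -
    have "(a, x, r) \<in> rests A xs" using that by (simp add: rests_def)
    then have "U (a, x, r) \<le> (dsize (enc_rest e enc (a, x, r)) + 1) ^ k" using k by blast
    moreover have "dsize (encode_list enc (x # r)) \<le> dsize (encode_list enc (xs a))"
      using that(2) dsize_encode_list_suffix unfolding suffix_def by metis
    then have "(dsize (enc_rest e enc (a, x, r)) + 1) ^ k \<le> N a ^ k"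
      by (intro power_mono) (auto simp: N_def enc_rest_def)
    ultimately show ?thesis by simp
  qed
  ultimately show ?thesis using that by blast
qed

lemma dsize_encode_list_le:
  "(\<And>x. x \<in> set xs \<Longrightarrow> dsize (enc x) \<le> m) \<Longrightarrow> dsize (encode_list enc xs) \<le> length xs * (m + 1) + 1"
proof (induction xs)
  case Nil
  then show ?case using dsize_Atom_le_iff[of 0 0] by simp
next
  case (Cons x xs)
  then have "dsize (enc x) \<le> m" "dsize (encode_list enc xs) \<le> length xs * (m + 1) + 1" by auto
  then show ?case by simp
qed

lemma poly_time_rests_step:
  assumes f: "poly_time (rests A xs) (enc_rest e enc) (\<lambda>(a, x, r). f a x r)"
    and PP: "\<And>a y x r. P a y (x # r) \<Longrightarrow> suffix (x # r) (xs a)"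
  shows "poly_time {(a, y, x, r). a \<in> A \<and> P a y (x # r)}
      (\<lambda>(a, y, x, r). Node (e a) (Node (enc' y) (Node (enc x) (encode_list enc r))))
      (\<lambda>(a, y, x, r). f a x r)" (is "poly_time ?B ?e _")
proof -
  let ?h = "\<lambda>(a, y, x, r). (a, x, r)"
  have e': "poly_time ?B ?e ?e" by (rule poly_time_id)
  have "poly_time ?B ?e (\<lambda>z. Node (left (?e z)) (right (right (?e z))))"
    by (intro poly_time_Node poly_time_left poly_time_right e')
  then have "poly_time ?B ?e (\<lambda>z. enc_rest e enc (?h z))"
    by (rule poly_time_cong) (auto simp: enc_rest_def)
  then have "poly_time ?B ?e (\<lambda>z. (\<lambda>(a, x, r). f a x r) (?h z))"
    by (rule poly_time_comp[OF _ _ f]) (use PP in \<open>auto simp: rests_def\<close>)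
  then show ?thesis by (rule poly_time_cong) auto
qed

lemma poly_time_rests_acc:
  "poly_time B (\<lambda>(a, y, x, r). Node (e a) (Node (enc' y) (Node (enc x) (encode_list enc r))))
      (\<lambda>(a, y, x, r). enc' y)" (is "poly_time _ ?e _")
proof -
  have "poly_time B ?e (\<lambda>z. left (right (?e z)))"
    by (intro poly_time_left poly_time_right poly_time_id)
  then show ?thesis by (rule poly_time_cong) auto
qed

lemma poly_time_rev_map_rest:
  assumes xs: "poly_time A e (\<lambda>a. encode_list enc (xs a))"
    and f: "poly_time (rests A xs) (enc_rest e enc) (\<lambda>(a, x, r). enc' (f a x r))"
  shows "poly_time A e (\<lambda>a. encode_list enc' (rev (map_rest (f a) (xs a))))"
proof -
  obtain M where M: "poly_bounded A e M"
    "\<And>a x r. a \<in> A \<Longrightarrow> suffix (x # r) (xs a) \<Longrightarrow> dsize (enc' (f a x r)) \<le> M a"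
    by (rule poly_bounded_rests[OF poly_time_dsize[OF f] xs]) (auto 0 3)
  \<comment> \<open>Every step moves one entry from the rest to the accumulator, and all entries
    produced have size at most \<open>M a\<close>.\<close>
  define P where "P = (\<lambda>a y l. suffix l (xs a) \<and> length y + length l = length (xs a) \<and>
     (\<forall>z\<in>set y. dsize (enc' z) \<le> M a))"
  have "poly_time A e (\<lambda>a. encode_list enc' (tfold (\<lambda>y x r. f a x r # y) [] (xs a)))"
  proof (rule poly_time_tfold[OF xs, where P = P])
    show "poly_time A e (\<lambda>a. encode_list enc' [])" by (rule poly_time_const)
    let ?B = "{(a, y, x, r). a \<in> A \<and> P a y (x # r)}"
    have "poly_time ?B
     (\<lambda>(a, y, x, r). Node (e a) (Node (encode_list enc' y) (Node (enc x) (encode_list enc r))))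
     (\<lambda>z. Node (case z of (a, y, x, r) \<Rightarrow> enc' (f a x r)) (case z of (a, y, x, r) \<Rightarrow> encode_list enc' y))"
      by (intro poly_time_Node poly_time_rests_step[OF f] poly_time_rests_acc) (auto simp: P_def)
    then show "poly_time ?B
     (\<lambda>(a, y, x, r). Node (e a) (Node (encode_list enc' y) (Node (enc x) (encode_list enc r))))
     (\<lambda>(a, y, x, r). encode_list enc' (f a x r # y))" by (rule poly_time_cong) auto
    show "poly_bounded A e (\<lambda>a. dsize (encode_list enc (xs a)) * (M a + 1) + 1)"
      by (intro poly_bounded_add poly_bounded_mult poly_bounded_const M poly_time_dsize xs)
    show "dsize (encode_list enc' y) \<le> dsize (encode_list enc (xs a)) * (M a + 1) + 1"
      if "P a y l" for a y l
    proof -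
      have "dsize (encode_list enc' y) \<le> length y * (M a + 1) + 1"
        by (rule dsize_encode_list_le) (use that in \<open>auto simp: P_def\<close>)
      also have "\<dots> \<le> length (xs a) * (M a + 1) + 1"
        using that by (intro add_mono mult_right_mono) (auto simp: P_def)
      also have "\<dots> \<le> dsize (encode_list enc (xs a)) * (M a + 1) + 1"
        using length_le_dsize[of "xs a" enc] by (intro add_mono mult_right_mono) auto
      finally show ?thesis .
    qed
  qed (use M(2) in \<open>auto simp: P_def suffix_ConsD\<close>)
  then show ?thesis by (simp add: tfold_Cons)
qed

lemma poly_time_rev:
  assumes "poly_time A e (\<lambda>a. encode_list enc (xs a))"
  shows "poly_time A e (\<lambda>a. encode_list enc (rev (xs a)))"
proof -
  have "poly_time (rests A xs) (enc_rest e enc) (\<lambda>z. left (right (enc_rest e enc z)))"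
    by (intro poly_time_left poly_time_right poly_time_id)
  then have "poly_time (rests A xs) (enc_rest e enc) (\<lambda>(a, x, r). enc x)"
    by (rule poly_time_cong) (auto simp: enc_rest_def)
  from poly_time_rev_map_rest[where f = "\<lambda>_ x _. x", OF assms this] show ?thesis by (simp add: map_rest_map)
qed

lemma poly_time_map_rest:
  assumes "poly_time A e (\<lambda>a. encode_list enc (xs a))"
    and "poly_time (rests A xs) (enc_rest e enc) (\<lambda>(a, x, r). enc' (f a x r))"
  shows "poly_time A e (\<lambda>a. encode_list enc' (map_rest (f a) (xs a)))"
  using poly_time_rev[OF poly_time_rev_map_rest[where f = f and xs = xs, OF assms]] by simp

lemma poly_time_drop_rest:
  assumes "poly_time {(a, x). a \<in> A \<and> x \<in> set (xs a)} (enc_pair e enc) (\<lambda>(a, x). f a x)"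
  shows "poly_time (rests A xs) (enc_rest e enc) (\<lambda>(a, x, r). f a x)"
proof -
  let ?h = "\<lambda>(a, x, r). (a, x)"
  have "poly_time (rests A xs) (enc_rest e enc)
     (\<lambda>z. Node (left (enc_rest e enc z)) (left (right (enc_rest e enc z))))"
    by (intro poly_time_Node poly_time_left poly_time_right poly_time_id)
  then have "poly_time (rests A xs) (enc_rest e enc) (\<lambda>z. enc_pair e enc (?h z))"
    by (rule poly_time_cong) (auto simp: enc_rest_def enc_pair_def)
  then have "poly_time (rests A xs) (enc_rest e enc) (\<lambda>z. (\<lambda>(a, x). f a x) (?h z))"
    by (rule poly_time_comp[OF _ _ assms]) (auto simp: rests_def dest: set_mono_suffix)
  then show ?thesis by (rule poly_time_cong) auto
qed

lemma poly_time_map: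
  assumes "poly_time A e (\<lambda>a. encode_list enc (xs a))"
    and "poly_time {(a, x). a \<in> A \<and> x \<in> set (xs a)} (enc_pair e enc) (\<lambda>(a, x). enc' (f a x))"
  shows "poly_time A e (\<lambda>a. encode_list enc' (map (f a) (xs a)))"
  using poly_time_map_rest[where f = "\<lambda>a x _. f a x" and xs = xs, OF assms(1) poly_time_drop_rest[where f = "\<lambda>a x. enc' (f a x)" and xs = xs, OF assms(2)]] by (simp add: map_rest_map)

lemma poly_time_sum_rest:
  assumes xs: "poly_time A e (\<lambda>a. encode_list enc (xs a))"
    and f: "poly_time (rests A xs) (enc_rest e enc) (\<lambda>(a, x, r). Atom (f a x r))"
  shows "poly_time A e (\<lambda>a. Atom (sum_list (map_rest (f a) (xs a))))"
proof -
  obtain M where M: "poly_bounded A e M"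
    "\<And>a x r. a \<in> A \<Longrightarrow> suffix (x # r) (xs a) \<Longrightarrow> dsize (Atom (f a x r)) \<le> M a"
    by (rule poly_bounded_rests[OF poly_time_dsize[OF f] xs]) (auto 0 3)
  \<comment> \<open>One addition lengthens the partial sum by at most \<open>M a + 10\<close>; the
    10 comes from \<open>dsize_apply_binop\<close>.\<close>
  define P where "P = (\<lambda>a y l. suffix l (xs a) \<and>
     dsize (Atom y) + length l * (M a + 10) \<le> length (xs a) * (M a + 10) + 1)"
  have "poly_time A e (\<lambda>a. Atom (tfold (\<lambda>y x r. y + f a x r) 0 (xs a)))"
  proof (rule poly_time_tfold[OF xs, where P = P])
    show "poly_time A e (\<lambda>a. Atom 0)" by (rule poly_time_const)
    let ?B = "{(a, y, x, r). a \<in> A \<and> P a y (x # r)}"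
    let ?e = "\<lambda>(a, y, x, r). Node (e a) (Node (Atom y) (Node (enc x) (encode_list enc r)))"
    have 1: "poly_time ?B ?e (\<lambda>z. Atom (case z of (a, y, x, r) \<Rightarrow> f a x r))"
      using poly_time_rests_step[OF f, of P Atom] by (rule poly_time_cong) (auto simp: P_def)
    have 2: "poly_time ?B ?e (\<lambda>z. Atom (case z of (a, y, x, r) \<Rightarrow> y))"
      using poly_time_rests_acc[of ?B e Atom enc] by (rule poly_time_cong) auto
    from poly_time_add[OF 2 1]
    show "poly_time ?B ?e (\<lambda>(a, y, x, r). Atom (y + f a x r))" by (rule poly_time_cong) auto
    show "poly_bounded A e (\<lambda>a. dsize (encode_list enc (xs a)) * (M a + 10) + 1)"
      by (intro poly_bounded_add poly_bounded_mult poly_bounded_const M poly_time_dsize xs)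
    show "dsize (Atom y) \<le> dsize (encode_list enc (xs a)) * (M a + 10) + 1"
      if "P a y l" for a y l
    proof -
      have "dsize (Atom y) \<le> length (xs a) * (M a + 10) + 1" using that by (auto simp: P_def)
      also have "\<dots> \<le> dsize (encode_list enc (xs a)) * (M a + 10) + 1"
        using length_le_dsize[of "xs a" enc] by (intro add_mono mult_right_mono) auto
      finally show ?thesis .
    qed
    show "P a (y + f a x r) r" if "a \<in> A" "P a y (x # r)" for a y x r
    proof -
      have "dsize (Atom (y + f a x r)) \<le> dsize (Atom y) + M a + 10"
        using dsize_apply_binop[of Add y "f a x r"] M(2)[of a x r] that by (simp add: P_def)
      then show ?thesis using that by (auto simp: P_def suffix_ConsD)
    qed
  qed (use dsize_Atom_le_iff[of 0 0] in \<open>auto simp: P_def\<close>)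
  then show ?thesis by (simp add: tfold_add)
qed

lemma poly_time_sum:
  assumes "poly_time A e (\<lambda>a. encode_list enc (xs a))"
    and "poly_time {(a, x). a \<in> A \<and> x \<in> set (xs a)} (enc_pair e enc) (\<lambda>(a, x). Atom (f a x))"
  shows "poly_time A e (\<lambda>a. Atom (\<Sum>x\<leftarrow>xs a. f a x))"
  using poly_time_sum_rest[where f = "\<lambda>a x _. f a x" and xs = xs, OF assms(1) poly_time_drop_rest[where f = "\<lambda>a x. Atom (f a x)" and xs = xs, OF assms(2)]] by (simp add: map_rest_map)

lemma poly_time_length:
  assumes "poly_time A e (\<lambda>a. encode_list enc (xs a))"
  shows "poly_time A e (\<lambda>a. Atom (int (length (xs a))))"
proof -
  have "poly_time A e (\<lambda>a. Atom (\<Sum>x\<leftarrow>xs a. 1))"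
    by (intro poly_time_sum[OF assms]) (auto intro: poly_time_cong[OF poly_time_const[of _ _ "Atom 1"]])
  moreover have "(\<Sum>x\<leftarrow>ys. 1) = int (length ys)" for ys :: "'b list" by (induction ys) auto
  ultimately show ?thesis by simp
qed

lemma dsize_encode_list_append:
  "dsize (encode_list enc (xs @ ys)) + 1 = dsize (encode_list enc xs) + dsize (encode_list enc ys)"
  by (induction xs) (use dsize_Atom_le_iff[of 0 0] in auto)

lemma dsize_encode_list_rev: "dsize (encode_list enc (rev xs)) = dsize (encode_list enc xs)"
proof (induction xs)
  case (Cons x xs)
  then show ?case using dsize_encode_list_append[of enc "rev xs" "[x]"] dsize_Atom_le_iff[of 0 0] by auto
qed simp

lemma tfold_rev_append: "tfold (\<lambda>y x r. x # y) ys xs = rev xs @ ys"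
  by (induction xs arbitrary: ys) auto

lemma poly_time_rev_append:
  assumes xs: "poly_time A e (\<lambda>a. encode_list enc (xs a))"
    and ys: "poly_time A e (\<lambda>a. encode_list enc (ys a))"
  shows "poly_time A e (\<lambda>a. encode_list enc (rev (xs a) @ ys a))"
proof -
  define T where "T = (\<lambda>a. dsize (encode_list enc (xs a)) + dsize (encode_list enc (ys a)))"
  define P where "P = (\<lambda>a y l. dsize (encode_list enc y) + dsize (encode_list enc l) \<le> T a)"
  have "poly_time A e (\<lambda>a. encode_list enc (tfold (\<lambda>y x r. x # y) (ys a) (xs a)))"
  proof (rule poly_time_tfold[where P = P and xs = xs and ini = ys and enc = enc, OF xs ys])
    let ?B = "{(a, y, x, r). a \<in> A \<and> P a y (x # r)}"
    let ?e = "\<lambda>(a, y, x, r). Node (e a) (Node (encode_list enc y) (Node (enc x) (encode_list enc r)))"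
    have e: "poly_time ?B ?e ?e" by (rule poly_time_id)
    have "poly_time ?B ?e (\<lambda>z. Node (left (right (right (?e z)))) (left (right (?e z))))"
      by (intro poly_time_Node poly_time_left poly_time_right e)
    then show "poly_time ?B ?e (\<lambda>(a, y, x, r). encode_list enc (x # y))" by (rule poly_time_cong) auto
    show "poly_bounded A e T" unfolding T_def by (intro poly_bounded_add poly_time_dsize xs ys)
  qed (auto simp: P_def T_def)
  then show ?thesis by (simp add: tfold_rev_append)
qed

lemma tfold_rev_concat: "tfold (\<lambda>y x r. rev x @ y) ys xss = rev (concat xss) @ ys"
  by (induction xss arbitrary: ys) auto

lemma poly_time_rev_concat:
  assumes xss: "poly_time A e (\<lambda>a. encode_list (encode_list enc) (xss a))"
  shows "poly_time A e (\<lambda>a. encode_list enc (rev (concat (xss a))))"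
proof -
  define T where "T = (\<lambda>a. 1 + dsize (encode_list (encode_list enc) (xss a)))"
  define P where "P = (\<lambda>a y l. dsize (encode_list enc y) + dsize (encode_list (encode_list enc) l) \<le> T a)"
  have "poly_time A e (\<lambda>a. encode_list enc (tfold (\<lambda>y x r. rev x @ y) [] (xss a)))"
  proof (rule poly_time_tfold[OF xss, where P = P])
    show "poly_time A e (\<lambda>a. encode_list enc [])" by (rule poly_time_const)
    let ?B = "{(a, y, x, r). a \<in> A \<and> P a y (x # r)}"
    let ?e = "\<lambda>(a, y, x, r). Node (e a) (Node (encode_list enc y)
        (Node (encode_list enc x) (encode_list (encode_list enc) r)))"
    have e: "poly_time ?B ?e ?e" by (rule poly_time_id)
    have 1: "poly_time ?B ?e (\<lambda>z. encode_list enc (fst (snd (snd z))))"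
      using poly_time_left[OF poly_time_right[OF poly_time_right[OF e]]] by (rule poly_time_cong) auto
    have 2: "poly_time ?B ?e (\<lambda>z. encode_list enc (fst (snd z)))"
      using poly_time_left[OF poly_time_right[OF e]] by (rule poly_time_cong) auto
    from poly_time_rev_append[OF 1 2]
    show "poly_time ?B ?e (\<lambda>(a, y, x, r). encode_list enc (rev x @ y))" by (rule poly_time_cong) auto
    show "poly_bounded A e T" unfolding T_def
      by (intro poly_bounded_add poly_bounded_const poly_time_dsize xss)
    show "P a (rev x @ y) r" if "P a y (x # r)" for a y x r
      using that dsize_encode_list_append[of enc "rev x" y] dsize_encode_list_rev[of enc x]
      by (simp add: P_def)
  qed (use dsize_Atom_le_iff[of 0 0] in \<open>auto simp: P_def T_def\<close>)
  then show ?thesis by (simp add: tfold_rev_concat)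
qed

section \<open>Distributions as elements of a group algebra\<close>

text \<open>The integral of \<open>f\<close> against a finitely supported signed measure.
  Multiplication in \<open>real \<Rightarrow>\<^sub>0 real\<close> is convolution, so independent
  sums become products and differences of distributions make sense.\<close>

definition ga_ev :: "(real \<Rightarrow> real) \<Rightarrow> (real \<Rightarrow>\<^sub>0 real) \<Rightarrow> real" where
  "ga_ev f P = (\<Sum>x\<in>Poly_Mapping.keys P. Poly_Mapping.lookup P x * f x)"

lemma ga_ev_superset:
  "finite F \<Longrightarrow> Poly_Mapping.keys P \<subseteq> F \<Longrightarrow> ga_ev f P = (\<Sum>x\<in>F. Poly_Mapping.lookup P x * f x)"
  unfolding ga_ev_def by (rule sum.mono_neutral_left) (auto simp: in_keys_iff)

lemma ga_ev_add: "ga_ev f (P + Q) = ga_ev f P + ga_ev f Q"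
proof -
  let ?F = "Poly_Mapping.keys P \<union> Poly_Mapping.keys Q"
  have "Poly_Mapping.keys (P + Q) \<subseteq> ?F" by (rule Poly_Mapping.keys_add)
  then show ?thesis
    using ga_ev_superset[of ?F P f] ga_ev_superset[of ?F Q f] ga_ev_superset[of ?F "P + Q" f]
    by (simp add: lookup_add ring_distribs sum.distrib)
qed

lemma ga_ev_single [simp]: "ga_ev f (Poly_Mapping.single x c) = c * f x"
  using ga_ev_superset[of "{x}" "Poly_Mapping.single x c" f] by (cases "c = 0") auto

lemma ga_ev_0 [simp]: "ga_ev f 0 = 0"
  by (simp add: ga_ev_def)

lemma ga_ev_1 [simp]: "ga_ev f 1 = f 0"
  using ga_ev_single[of f 0 1] by simp

lemma ga_ev_uminus: "ga_ev f (- P) = - ga_ev f P"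
  using ga_ev_add[of f P "- P"] by simp

lemma ga_ev_diff: "ga_ev f (P - Q) = ga_ev f P - ga_ev f Q"
  using ga_ev_add[of f P "- Q"] by (simp add: ga_ev_uminus)

lemma ga_ev_sum: "ga_ev f (\<Sum>i\<in>I. P i) = (\<Sum>i\<in>I. ga_ev f (P i))"
  by (induction I rule: infinite_finite_induct) (auto simp: ga_ev_add)

lemma ga_ev_sum_list: "ga_ev f (\<Sum>i\<leftarrow>I. P i) = (\<Sum>i\<leftarrow>I. ga_ev f (P i))"
  by (induction I) (auto simp: ga_ev_add)

lemma sum_singles: "P = (\<Sum>x\<in>Poly_Mapping.keys P. Poly_Mapping.single x (Poly_Mapping.lookup P x))"
  by (rule poly_mapping_eqI)
    (auto simp: lookup_sum lookup_single when_def in_keys_iff sum.delta')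

lemma ga_ev_single_mult: "ga_ev f (Poly_Mapping.single w c * P) = c * ga_ev (\<lambda>x. f (w + x)) P"
proof -
  have "Poly_Mapping.single w c * P =
      (\<Sum>x\<in>Poly_Mapping.keys P. Poly_Mapping.single (w + x) (c * Poly_Mapping.lookup P x))"
    by (subst sum_singles[of P]) (simp add: sum_distrib_left mult_single)
  then show ?thesis by (simp add: ga_ev_sum ga_ev_def[of _ P] sum_distrib_left mult.assoc)
qed

abbreviation cst :: "real \<Rightarrow> real \<Rightarrow>\<^sub>0 real" where "cst \<equiv> Poly_Mapping.single 0"

lemma cst_simps: "cst a * cst b = cst (a * b)" "cst a + cst b = cst (a + b)"
    "cst a - cst b = cst (a - b)"
  by (simp_all add: mult_single single_add single_diff)

text \<open>The points are nonnegative as well as the coefficients, because \<open>le_upto\<close>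
  only survives shifts to the right. The inductive form reduces claims that are linear in the
  measure to point masses.\<close>

inductive_set nonneg :: "(real \<Rightarrow>\<^sub>0 real) set" where
  zero: "0 \<in> nonneg"
| single: "0 \<le> x \<Longrightarrow> 0 \<le> c \<Longrightarrow> Poly_Mapping.single x c \<in> nonneg"
| add: "P \<in> nonneg \<Longrightarrow> Q \<in> nonneg \<Longrightarrow> P + Q \<in> nonneg"

abbreviation mass :: "(real \<Rightarrow>\<^sub>0 real) \<Rightarrow> real" where
  "mass \<equiv> ga_ev (\<lambda>_. 1)"

definition prob :: "(real \<Rightarrow>\<^sub>0 real) set" where
  "prob = {P \<in> nonneg. mass P = 1}"

lemma nonneg_mult: "P \<in> nonneg \<Longrightarrow> Q \<in> nonneg \<Longrightarrow> P * Q \<in> nonneg"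
proof (induction P rule: nonneg.induct)
  case (single x c)
  show ?case using single(3,1,2)
    by (induction Q rule: nonneg.induct) (auto simp: mult_single ring_distribs intro: nonneg.intros)
qed (auto simp: ring_distribs intro: nonneg.intros)

text \<open>Used for the constant 1, which gives the mass of a product, and for
  \<open>exp (- x)\<close>, the Laplace transform.\<close>

lemma ga_ev_mult_hom:
  assumes "\<And>x y. f (x + y) = f x * f y" shows "ga_ev f (P * Q) = ga_ev f P * ga_ev f Q"
proof -
  have "P * Q = (\<Sum>x\<in>Poly_Mapping.keys P. Poly_Mapping.single x (Poly_Mapping.lookup P x) * Q)"
    by (subst sum_singles[of P]) (simp add: sum_distrib_right)
  moreover have "ga_ev (\<lambda>y. f x * f y) Q = f x * ga_ev f Q" for x
    by (simp add: ga_ev_def sum_distrib_left algebra_simps)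
  ultimately show ?thesis
    by (simp add: ga_ev_sum ga_ev_single_mult assms sum_distrib_right ga_ev_def[of _ P] mult.assoc)
qed

lemma mass_mult: "mass (P * Q) = mass P * mass Q"
  by (rule ga_ev_mult_hom) simp

lemma prob_1: "1 \<in> prob"
  using nonneg.single[of 0 1] by (simp add: prob_def)

lemma prob_mult: "P \<in> prob \<Longrightarrow> Q \<in> prob \<Longrightarrow> P * Q \<in> prob"
  by (simp add: prob_def nonneg_mult mass_mult)

lemma prob_prod: "(\<And>i. i \<in> I \<Longrightarrow> P i \<in> prob) \<Longrightarrow> (\<Prod>i\<in>I. P i) \<in> prob"
  by (induction I rule: infinite_finite_induct) (auto simp: prob_1 prob_mult)

lemma prob_power: "P \<in> prob \<Longrightarrow> P ^ n \<in> prob"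
  by (induction n) (auto simp: prob_1 prob_mult)

lemma nonneg_sum_list: "(\<And>x. x \<in> set xs \<Longrightarrow> f x \<in> nonneg) \<Longrightarrow> (\<Sum>x\<leftarrow>xs. f x) \<in> nonneg"
  by (induction xs) (auto intro: nonneg.intros)

section \<open>Comparison of distributions through a monotone test function\<close>

locale step_function =
  fixes \<phi> :: "real \<Rightarrow> real"
  assumes mono: "x \<le> y \<Longrightarrow> \<phi> x \<le> \<phi> y" and ge_0: "0 \<le> \<phi> x" and le_1: "\<phi> x \<le> 1"
begin

abbreviation ev_at :: "real \<Rightarrow> (real \<Rightarrow>\<^sub>0 real) \<Rightarrow> real" where
  "ev_at s \<equiv> ga_ev (\<lambda>x. \<phi> (s + x))"

text \<open>
  The nonnegative shift \<open>s\<close> stands for the items that have been summed up already; it makes the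
  relation stable under convolution with further items.
\<close>

definition le_upto :: "real \<Rightarrow> (real \<Rightarrow>\<^sub>0 real) \<Rightarrow> (real \<Rightarrow>\<^sub>0 real) \<Rightarrow> bool" where
  "le_upto e P Q \<longleftrightarrow> (\<forall>s\<ge>0. ev_at s P \<le> ev_at s Q + e)"

lemma le_upto_absI:
  assumes "\<And>s. 0 \<le> s \<Longrightarrow> \<bar>ev_at s P - ev_at s Q\<bar> \<le> e"
  shows "le_upto e P Q" "le_upto e Q P"
  using assms unfolding le_upto_def by (force simp: abs_le_iff)+

lemma le_uptoD: "le_upto e P Q \<Longrightarrow> ga_ev \<phi> P \<le> ga_ev \<phi> Q + e"
  unfolding le_upto_def by (drule spec[of _ 0]) simp

lemma le_upto_refl: "0 \<le> e \<Longrightarrow> le_upto e P P"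
  by (simp add: le_upto_def)

lemma le_upto_trans: "le_upto e P Q \<Longrightarrow> le_upto e' Q R \<Longrightarrow> le_upto (e + e') P R"
  unfolding le_upto_def by force

lemma le_upto_mono: "le_upto e P Q \<Longrightarrow> e \<le> e' \<Longrightarrow> le_upto e' P Q"
  unfolding le_upto_def by force

lemma ev_at_nonneg: "P \<in> nonneg \<Longrightarrow> mass P * \<phi> s \<le> ev_at s P \<and> ev_at s P \<le> mass P"
proof (induction P rule: nonneg.induct)
  case (single x c)
  then show ?case using mono[of s "s + x"] le_1[of "s + x"] by (auto intro: mult_left_mono mult_left_le)
qed (auto simp: ga_ev_add ring_distribs)

lemma ev_at_prob: "P \<in> prob \<Longrightarrow> 0 \<le> ev_at s P \<and> ev_at s P \<le> 1"
  using ev_at_nonneg[of P s] ge_0[of s] by (auto simp: prob_def)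

lemma le_upto_1: "P \<in> prob \<Longrightarrow> le_upto 0 1 P"
  using ev_at_nonneg[of P] by (auto simp: le_upto_def prob_def)

text \<open>Convolution with a point mass at \<open>x\<close> replaces the shift \<open>s\<close> by
  \<open>s + x\<close>, which is again nonnegative; the rest is linearity.\<close>

lemma le_upto_mult_nonneg:
  assumes "W \<in> nonneg" "le_upto e P Q"
  shows "le_upto (mass W * e) (W * P) (W * Q)"
  using assms(1)
proof (induction W rule: nonneg.induct)
  case (single x c)
  have "ev_at s (Poly_Mapping.single x c * P) \<le> ev_at s (Poly_Mapping.single x c * Q) + c * e"
    if "s \<ge> 0" for s
  proof -
    have "ev_at (s + x) P \<le> ev_at (s + x) Q + e"
      using assms(2) that single unfolding le_upto_def by simp
    then have "c * ev_at (s + x) P \<le> c * (ev_at (s + x) Q + e)"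
      using single by (intro mult_left_mono)
    then show ?thesis by (simp add: ga_ev_single_mult ring_distribs add.assoc)
  qed
  then show ?case by (simp add: le_upto_def)
qed (force simp: le_upto_def ring_distribs ga_ev_add)+

lemma le_upto_mult_left: "W \<in> prob \<Longrightarrow> le_upto e P Q \<Longrightarrow> le_upto e (W * P) (W * Q)"
  using le_upto_mult_nonneg[of W e P Q] by (simp add: prob_def)

text \<open>A hybrid argument: factors are exchanged one by one while the remaining product is a
  probability distribution and hence does not amplify the error.\<close>

lemma le_upto_prod:
  assumes "finite I" "\<And>i. i \<in> I \<Longrightarrow> P i \<in> prob" "\<And>i. i \<in> I \<Longrightarrow> Q i \<in> prob"
    and "\<And>i. i \<in> I \<Longrightarrow> le_upto (e i) (P i) (Q i)"
  shows "le_upto (\<Sum>i\<in>I. e i) (\<Prod>i\<in>I. P i) (\<Prod>i\<in>I. Q i)"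
  using assms
proof (induction I rule: finite_induct)
  case empty
  show ?case by (simp add: le_upto_refl)
next
  case (insert i I)
  have "le_upto (\<Sum>i\<in>I. e i) (P i * (\<Prod>i\<in>I. P i)) (P i * (\<Prod>i\<in>I. Q i))"
    by (intro le_upto_mult_left insert) (use insert in auto)
  moreover have "le_upto (e i) ((\<Prod>i\<in>I. Q i) * P i) ((\<Prod>i\<in>I. Q i) * Q i)"
    by (intro le_upto_mult_left prob_prod insert) (use insert in auto)
  ultimately show ?case
    using le_upto_trans insert(1,2) by (fastforce simp: mult.commute add.commute)
qed

lemma le_upto_power:
  assumes "P \<in> prob" "Q \<in> prob" "le_upto e P Q"
  shows "le_upto (real n * e) (P ^ n) (Q ^ n)"
  using le_upto_prod[of "{..<n}" "\<lambda>_. P" "\<lambda>_. Q" "\<lambda>_. e"] assms by simp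

text \<open>The additional factors are nonnegative variables, and the test function is
  monotone.\<close>

lemma le_upto_power_mono:
  assumes "P \<in> prob" "m \<le> n" shows "le_upto 0 (P ^ m) (P ^ n)"
proof -
  have "le_upto 0 (P ^ m * 1) (P ^ m * P ^ (n - m))"
    by (intro le_upto_mult_left le_upto_1 prob_power assms)
  then show ?thesis using assms(2) by (simp flip: power_add)
qed

text \<open>A thinned variable: a coin of bias \<open>c\<close> decides between \<open>P\<close> and
  the size 0.\<close>

definition bern :: "real \<Rightarrow> (real \<Rightarrow>\<^sub>0 real) \<Rightarrow> (real \<Rightarrow>\<^sub>0 real)" where
  "bern c P = cst (1 - c) + cst c * P"

lemma prob_bern: "P \<in> prob \<Longrightarrow> 0 \<le> c \<Longrightarrow> c \<le> 1 \<Longrightarrow> bern c P \<in> prob"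
  by (auto simp: prob_def bern_def ga_ev_add mass_mult intro!: nonneg.intros nonneg_mult)

lemma ga_ev_bern: "ga_ev f (bern c P * Q) = (1 - c) * ga_ev f Q + c * ga_ev f (P * Q)"
proof -
  have "bern c P * Q = cst (1 - c) * Q + cst c * (P * Q)" by (simp add: bern_def algebra_simps)
  then show ?thesis by (simp add: ga_ev_add ga_ev_single_mult)
qed

lemma bern_le_1:
  assumes "P \<in> prob" "0 \<le> c" "c \<le> 1" shows "le_upto c (bern c P) 1"
proof -
  have "ev_at s (bern c P) \<le> \<phi> s + c" if "s \<ge> 0" for s
  proof -
    have "ev_at s (bern c P) = (1 - c) * \<phi> s + c * ev_at s P" using ga_ev_bern[of _ c P 1] by simp
    moreover have "c * ev_at s P \<le> c" using ev_at_prob[OF assms(1), of s] assms(2) by (simp add: mult_left_le)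
    moreover have "0 \<le> c * \<phi> s" using ge_0[of s] assms(2) by simp
    ultimately show ?thesis by (simp add: algebra_simps)
  qed
  then show ?thesis by (simp add: le_upto_def)
qed

text \<open>
  Both sides agree up to the term \<open>u * v * (P - 1)\<^sup>2\<close>. Iterating this replaces Le Cam's comparison
  with a Poisson distribution: a product of Bernoulli variables is compared with a power of a
  common tiny one.
\<close>

lemma bern_mult:
  assumes "P \<in> prob" "0 \<le> u" "0 \<le> v"
  shows "le_upto (2 * u * v) (bern u P * bern v P) (bern (u + v) P)"
    and "le_upto (2 * u * v) (bern (u + v) P) (bern u P * bern v P)"
proof -
  have *: "\<bar>ev_at s (bern u P * bern v P) - ev_at s (bern (u + v) P)\<bar> \<le> 2 * u * v" for s
  proof -
    define a b c where abc: "a = \<phi> s" "b = ev_at s P" "c = ev_at s (P * P)"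
    have bd: "0 \<le> a" "a \<le> 1" "0 \<le> b" "b \<le> 1" "0 \<le> c" "c \<le> 1"
      using ge_0[of s] le_1[of s] ev_at_prob[OF assms(1), of s] ev_at_prob[OF prob_mult[OF assms(1,1)], of s]
      by (auto simp: abc)
    have 1: "ev_at s (bern w P) = (1 - w) * a + w * b" for w using ga_ev_bern[of _ w P 1] by (simp add: abc)
    have 2: "ev_at s (P * bern w P) = (1 - w) * b + w * c" for w
      using ga_ev_bern[of _ w P P] by (simp add: abc mult.commute)
    have "ev_at s (bern u P * bern v P) - ev_at s (bern (u + v) P) = u * v * (a - 2 * b + c)"
      unfolding ga_ev_bern 1 2 by algebra
    \<comment> \<open>The factor \<open>a - 2 * b + c\<close> is the evaluation of
      \<open>(P - 1)\<^sup>2\<close>; with all three numbers between 0 and 1 it lies between -2 and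
      2.\<close>
    moreover have "\<bar>u * v * (a - 2 * b + c)\<bar> \<le> u * v * 2"
      unfolding abs_mult using assms bd by (intro mult_mono) auto
    ultimately show ?thesis by simp
  qed
  show "le_upto (2 * u * v) (bern u P * bern v P) (bern (u + v) P)"
    and "le_upto (2 * u * v) (bern (u + v) P) (bern u P * bern v P)"
    by (rule le_upto_absI(1)[OF *]) (rule le_upto_absI(2)[OF *])
qed

text \<open>Merging one more factor into a variable of mass \<open>k * u\<close> costs
  \<open>2 * u * (k * u)\<close>. Over all \<open>k\<close> below \<open>K\<close> this sums to at
  most \<open>(K * u)\<^sup>2\<close>.\<close>

lemma bern_power:
  assumes P: "P \<in> prob" and u: "0 \<le> u" "real K * u \<le> 1"
  shows "le_upto ((K * u)\<^sup>2) (bern u P ^ K) (bern (K * u) P) \<and>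
         le_upto ((K * u)\<^sup>2) (bern (K * u) P) (bern u P ^ K)"
  using u(2)
proof (induction K)
  case 0
  show ?case by (simp add: bern_def le_upto_refl)
next
  case (Suc K)
  have K: "K * u \<le> 1" using Suc.prems u(1) by (simp add: algebra_simps)
  have u1: "u \<le> 1" using Suc.prems u(1) mult_right_mono[of 1 "real (Suc K)" u] by simp
  have B: "bern u P \<in> prob" by (rule prob_bern[OF P u(1) u1])
  have e: "(real K * u)\<^sup>2 + 2 * u * (K * u) \<le> (Suc K * u)\<^sup>2"
    by (simp add: power2_eq_square algebra_simps)
  have s: "u + K * u = Suc K * u" by (simp add: algebra_simps)
  have Ku: "0 \<le> K * u" using u(1) by simp
  note m = bern_mult[OF P u(1) Ku, unfolded s]
  show ?case
  proof
    have "le_upto ((K * u)\<^sup>2) (bern u P * bern u P ^ K) (bern u P * bern (K * u) P)"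
      using Suc.IH[OF K] B by (blast intro: le_upto_mult_left)
    from le_upto_mono[OF le_upto_trans[OF this m(1)] e]
    show "le_upto ((Suc K * u)\<^sup>2) (bern u P ^ Suc K) (bern (Suc K * u) P)" by simp
    have "le_upto ((K * u)\<^sup>2) (bern u P * bern (K * u) P) (bern u P * bern u P ^ K)"
      using Suc.IH[OF K] B by (blast intro: le_upto_mult_left)
    from le_upto_trans[OF m(2) this] e
    show "le_upto ((Suc K * u)\<^sup>2) (bern (Suc K * u) P) (bern u P ^ Suc K)"
      by (simp add: le_upto_mono add.commute)
  qed
qed

section \<open>Light items of one direction: masses in multiples of a tiny \<open>u\<close>, rooms
  in multiples of \<open>\<eta>\<close>\<close>

context
  fixes S :: "'i set" and K :: "'i \<Rightarrow> nat" and P :: "real \<Rightarrow>\<^sub>0 real" and V D :: nat and u \<eta> :: real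
  assumes S: "finite S" and P: "P \<in> prob" and V: "V \<ge> 1" and D: "D \<ge> 1"
    and u: "u = 1 / (real D * V)" and eta: "\<eta> = 1 / D" and K: "\<And>i. i \<in> S \<Longrightarrow> K i \<le> V"
begin

lemma unit_mass_bounds: "V * u = \<eta>" "0 \<le> u" "0 \<le> \<eta>" "\<eta> \<le> 1" "u \<le> 1"
proof -
  show "V * u = \<eta>" "0 \<le> u" "0 \<le> \<eta>" "\<eta> \<le> 1" using V D by (auto simp: u eta field_simps)
  have "1 \<le> D * V" using V D by simp
  then have "(1::real) \<le> real D * V" by (simp del: of_nat_mult add: of_nat_mult[symmetric] One_nat_def)
  then show "u \<le> 1" by (simp add: u field_simps)
qed

lemma mass_le: "i \<in> S \<Longrightarrow> K i * u \<le> \<eta>"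
  using K[of i] mult_right_mono[of "real (K i)" V u] unit_mass_bounds by simp

text \<open>An item of mass \<open>K i * u\<close> is split into \<open>K i\<close> copies of mass
  \<open>u\<close>. The error is quadratic in its mass, which is at most \<open>\<eta>\<close>, so
  the total error is \<open>\<eta>\<close> times the total mass, however many items there are.
  Afterwards only the sum of the \<open>K i\<close> matters.\<close>

lemma bern_prod_power:
  "le_upto (\<eta> * (\<Sum>i\<in>S. K i * u)) (\<Prod>i\<in>S. bern (K i * u) P) (bern u P ^ (\<Sum>i\<in>S. K i)) \<and>
   le_upto (\<eta> * (\<Sum>i\<in>S. K i * u)) (bern u P ^ (\<Sum>i\<in>S. K i)) (\<Prod>i\<in>S. bern (K i * u) P)"
proof -
  have le: "(K i * u)\<^sup>2 \<le> \<eta> * (K i * u)" if "i \<in> S" for i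
    using mass_le[OF that] unit_mass_bounds(2) by (simp add: power2_eq_square mult_right_mono)
  have K1: "K i * u \<le> 1" if "i \<in> S" for i using mass_le[OF that] unit_mass_bounds by linarith
  note b = bern_power[OF P unit_mass_bounds(2) K1]
  have p: "bern (K i * u) P \<in> prob" "bern u P ^ K i \<in> prob" if "i \<in> S" for i
    using K1[OF that] unit_mass_bounds by (auto intro!: prob_bern prob_power P)
  have "le_upto (\<Sum>i\<in>S. \<eta> * (K i * u)) (\<Prod>i\<in>S. bern (K i * u) P) (\<Prod>i\<in>S. bern u P ^ K i)"
    by (rule le_upto_prod[OF S p]) (use b le le_upto_mono in blast)+
  moreover have "le_upto (\<Sum>i\<in>S. \<eta> * (K i * u)) (\<Prod>i\<in>S. bern u P ^ K i) (\<Prod>i\<in>S. bern (K i * u) P)"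
    by (rule le_upto_prod[OF S p(2,1)]) (use b le le_upto_mono in blast)+
  ultimately show ?thesis by (simp add: power_sum sum_distrib_left)
qed

text \<open>The other half of the comparison: \<open>V\<close> tiny copies merge into one variable
  of mass \<open>V * u = \<eta>\<close> at the price \<open>\<eta>\<^sup>2\<close>.\<close>

lemma bern_group_power:
  "le_upto (c * \<eta>\<^sup>2) (bern u P ^ (c * V)) (bern \<eta> P ^ c) \<and>
   le_upto (c * \<eta>\<^sup>2) (bern \<eta> P ^ c) (bern u P ^ (c * V))"
proof -
  have V1: "V * u \<le> 1" using unit_mass_bounds by simp
  have "bern u P ^ (c * V) = (bern u P ^ V) ^ c" by (simp add: mult.commute power_mult)
  then show ?thesis
    using bern_power[OF P unit_mass_bounds(2) V1] le_upto_power[of "bern u P ^ V" "bern \<eta> P" "\<eta>\<^sup>2" c]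
      le_upto_power[of "bern \<eta> P" "bern u P ^ V" "\<eta>\<^sup>2" c] unit_mass_bounds
    by (auto simp: prob_bern prob_power P)
qed

lemma bern_upper:
  assumes "(\<Sum>i\<in>S. K i) \<le> (c + 1) * V"
  shows "le_upto (2 * (real c + 1) * \<eta>\<^sup>2 + \<eta>) (\<Prod>i\<in>S. bern (K i * u) P) (bern \<eta> P ^ c)"
proof -
  note p = prob_bern[OF P unit_mass_bounds(2,5)] and q = prob_bern[OF P unit_mass_bounds(3,4)]
  have 1: "le_upto 0 (bern u P ^ (\<Sum>i\<in>S. K i)) (bern u P ^ ((c + 1) * V))"
    by (rule le_upto_power_mono[OF p assms])
  have "le_upto \<eta> (bern \<eta> P ^ c * bern \<eta> P) (bern \<eta> P ^ c * 1)"
    by (intro le_upto_mult_left bern_le_1 P unit_mass_bounds prob_power q)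
  then have 2: "le_upto \<eta> (bern \<eta> P ^ (c + 1)) (bern \<eta> P ^ c)" by (simp add: mult.commute)
  have "(\<Sum>i\<in>S. K i * u) = real (\<Sum>i\<in>S. K i) * u" by (simp add: sum_distrib_right)
  also have "\<dots> \<le> real ((c + 1) * V) * u" using unit_mass_bounds(2) by (intro mult_right_mono of_nat_mono assms)
  also have "\<dots> = (c + 1) * \<eta>" by (simp add: algebra_simps flip: unit_mass_bounds(1))
  finally have "\<eta> * (\<Sum>i\<in>S. K i * u) \<le> \<eta> * ((c + 1) * \<eta>)" using unit_mass_bounds(3) by (rule mult_left_mono)
  then have e: "\<eta> * (\<Sum>i\<in>S. K i * u) + 0 + real (c + 1) * \<eta>\<^sup>2 + \<eta> \<le> 2 * (real c + 1) * \<eta>\<^sup>2 + \<eta>"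
    by (simp add: power2_eq_square algebra_simps)
  note le_upto_trans[OF le_upto_trans[OF conjunct1[OF bern_prod_power] 1]
      conjunct1[OF bern_group_power[of "c + 1"]]]
  from le_upto_trans[OF this 2] e show ?thesis by (rule le_upto_mono)
qed

text \<open>Here \<open>c\<close> may be the total weight rounded up to whole groups, hence at most
  one group too large. That group is discarded first, at the price \<open>\<eta>\<close>; the others
  are covered by the items.\<close>

lemma bern_lower:
  assumes "c * V \<le> (\<Sum>i\<in>S. K i) + V"
  shows "le_upto (\<eta> * (\<Sum>i\<in>S. K i * u) + c * \<eta>\<^sup>2 + \<eta>) (bern \<eta> P ^ c) (\<Prod>i\<in>S. bern (K i * u) P)"
proof (cases c)
  case 0
  have "K i * u \<le> 1" if "i \<in> S" for i using mass_le[OF that] unit_mass_bounds by linarith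
  then have "le_upto 0 1 (\<Prod>i\<in>S. bern (K i * u) P)"
    using unit_mass_bounds by (intro le_upto_1 prob_prod prob_bern P) auto
  moreover have "0 \<le> \<eta> * (\<Sum>i\<in>S. K i * u) + c * \<eta>\<^sup>2 + \<eta>"
    using unit_mass_bounds by (intro add_nonneg_nonneg mult_nonneg_nonneg sum_nonneg) auto
  ultimately show ?thesis using 0 by (auto intro: le_upto_mono)
next
  case (Suc c')
  note p = prob_bern[OF P unit_mass_bounds(2,5)] and q = prob_bern[OF P unit_mass_bounds(3,4)]
  have "c' * V \<le> (\<Sum>i\<in>S. K i)" using assms Suc by simp
  then have 1: "le_upto 0 (bern u P ^ (c' * V)) (bern u P ^ (\<Sum>i\<in>S. K i))"
    by (rule le_upto_power_mono[OF p])
  have "le_upto \<eta> (bern \<eta> P ^ c' * bern \<eta> P) (bern \<eta> P ^ c' * 1)"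
    by (intro le_upto_mult_left bern_le_1 P unit_mass_bounds prob_power q)
  then have 2: "le_upto \<eta> (bern \<eta> P ^ c) (bern \<eta> P ^ c')" by (simp add: mult.commute Suc)
  have e: "\<eta> + real c' * \<eta>\<^sup>2 + 0 + \<eta> * (\<Sum>i\<in>S. K i * u) \<le>
      \<eta> * (\<Sum>i\<in>S. K i * u) + c * \<eta>\<^sup>2 + \<eta>"
    using unit_mass_bounds(3) by (simp add: Suc algebra_simps)
  note le_upto_trans[OF le_upto_trans[OF le_upto_trans[OF 2 conjunct2[OF bern_group_power]] 1]
      conjunct2[OF bern_prod_power]]
  from this e show ?thesis by (rule le_upto_mono)
qed

end

end

subsection \<open>A smooth step and the discretisation of items\<close>

text \<open>The factor \<open>\<theta>\<close> in the error makes it proportional to the probability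
  of a move, so that arbitrarily many items of small mass stay harmless. By \<open>eq_1\<close> a
  grid up to 2 suffices.\<close>

locale smooth_step = step_function +
  fixes \<kappa> :: real
  assumes eq_1: "2 \<le> x \<Longrightarrow> \<phi> x = 1"
    and interpolation: "0 \<le> \<theta> \<Longrightarrow> \<theta> \<le> 1 \<Longrightarrow> 0 \<le> h \<Longrightarrow>
      \<bar>(1 - \<theta>) * \<phi> x + \<theta> * \<phi> (x + h) - \<phi> (x + \<theta> * h)\<bar> \<le> \<kappa> * \<theta> * h\<^sup>2"
    and kappa: "0 \<le> \<kappa>"

text \<open>
  The variable on the grid \<open>0, 1/g, \<dots>, L/g\<close> that is at least \<open>(k + 1)/g\<close> with probability \<open>r k\<close>.
\<close>

definition tails :: "nat \<Rightarrow> nat \<Rightarrow> (nat \<Rightarrow> real) \<Rightarrow> (real \<Rightarrow>\<^sub>0 real)" where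
  "tails g L r = 1 + (\<Sum>k<L. cst (r k) *
     (Poly_Mapping.single (real (Suc k) / g) 1 - Poly_Mapping.single (real k / g) 1))"

lemma tails_Suc: "tails g (Suc L) r = tails g L r + cst (r L) *
     (Poly_Mapping.single (real (Suc L) / g) 1 - Poly_Mapping.single (real L / g) 1)"
  by (simp add: tails_def add.assoc)

text \<open>Summation by parts: the weights of the grid points are differences of consecutive tails.
  The subtracted weight \<open>r L\<close> is what the next step moves on from the last point, which
  makes the induction work.\<close>

lemma tails_nonneg:
  assumes "\<And>k. r (Suc k) \<le> r k" "\<And>k. 0 \<le> r k" "r 0 \<le> 1"
  shows "tails g L r - Poly_Mapping.single (real L / g) (r L) \<in> nonneg"
proof (induction L)
  case 0
  have "tails g 0 r - Poly_Mapping.single 0 (r 0) = cst (1 - r 0)"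
    by (simp add: tails_def single_diff)
  then show ?case using assms(3) by (simp add: nonneg.single)
next
  case (Suc L)
  let ?m = "\<lambda>k. Poly_Mapping.single (real k / g)"
  have "tails g (Suc L) r - ?m (Suc L) (r (Suc L)) =
      (tails g L r - ?m L (r L)) + ?m (Suc L) (r L - r (Suc L))"
    by (simp add: tails_Suc algebra_simps mult_single single_diff del: of_nat_Suc)
  also have "\<dots> \<in> nonneg" by (intro nonneg.add Suc nonneg.single) (use assms in auto)
  finally show ?case .
qed

lemma mass_tails: "mass (tails g L r) = 1"
  by (induction L) (auto simp: tails_Suc ga_ev_add ga_ev_single_mult ga_ev_diff tails_def[of _ 0])

lemma tails_prob:
  assumes "\<And>k. r (Suc k) \<le> r k" "\<And>k. 0 \<le> r k" "r 0 \<le> 1"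
  shows "tails g L r \<in> prob"
proof -
  have "(tails g L r - Poly_Mapping.single (real L / g) (r L)) + Poly_Mapping.single (real L / g) (r L) \<in> nonneg"
    by (intro nonneg.add tails_nonneg assms nonneg.single) (use assms in auto)
  then show ?thesis by (simp add: prob_def mass_tails)
qed

lemma ga_ev_tails: "ga_ev f (tails g L r) = f 0 + (\<Sum>k<L. r k * (f (real (Suc k) / g) - f (real k / g)))"
  by (simp add: tails_def ga_ev_add ga_ev_sum ga_ev_single_mult ga_ev_diff)

context step_function
begin

text \<open>The tails enter linearly. This is the decomposition of an item into its mass
  \<open>c\<close> and its direction, the conditional distribution with tails
  \<open>a\<close>.\<close>

lemma tails_scale: "tails g L (\<lambda>k. c * a k) = bern c (tails g L a)"
proof -
  have "bern c (tails g L a) = 1 + (\<Sum>k<L. cst c * (cst (a k) *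
     (Poly_Mapping.single (real (Suc k) / g) 1 - Poly_Mapping.single (real k / g) 1)))"
    by (simp add: bern_def tails_def ring_distribs(1) sum_distrib_left single_diff)
  also have "\<dots> = tails g L (\<lambda>k. c * a k)"
    by (simp add: tails_def mult.assoc[symmetric] cst_simps)
  finally show ?thesis by simp
qed

text \<open>The increments of the test function along the grid are nonnegative and telescope to at
  most 1, so the error does not depend on the number of grid points.\<close>

lemma tails_le:
  assumes "\<And>k. k < L \<Longrightarrow> r k \<le> r' k + e" "0 \<le> e"
  shows "le_upto e (tails g L r) (tails g L r')"
  unfolding le_upto_def
proof (intro allI impI)
  fix s :: real
  let ?d = "\<lambda>k. \<phi> (s + real (Suc k) / g) - \<phi> (s + real k / g)"
  have d: "0 \<le> ?d k" for k by (simp add: mono divide_right_mono)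
  have "(\<Sum>k<L. r k * ?d k) \<le> (\<Sum>k<L. (r' k + e) * ?d k)"
    by (intro sum_mono mult_right_mono d) (use assms in auto)
  also have "\<dots> = (\<Sum>k<L. r' k * ?d k) + e * (\<Sum>k<L. ?d k)"
    by (simp add: ring_distribs(2) sum.distrib sum_distrib_left)
  also have "(\<Sum>k<L. ?d k) = \<phi> (s + real L / g) - \<phi> s"
    using sum_lessThan_telescope[of "\<lambda>k. \<phi> (s + real k / g)" L] by simp
  also have "e * (\<phi> (s + real L / g) - \<phi> s) \<le> e"
    using ge_0[of s] le_1[of "s + real L / g"] assms(2) by (intro mult_left_le) auto
  finally show "ev_at s (tails g L r) \<le> ev_at s (tails g L r') + e" by (simp add: ga_ev_tails)
qed

end

lemma sum_list_abs_le:
  fixes f h :: "'i \<Rightarrow> real"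
  shows "(\<And>x. x \<in> set xs \<Longrightarrow> \<bar>f x\<bar> \<le> h x) \<Longrightarrow> \<bar>\<Sum>x\<leftarrow>xs. f x\<bar> \<le> (\<Sum>x\<leftarrow>xs. h x)"
proof (induction xs)
  case (Cons x xs)
  then have "\<bar>f x\<bar> \<le> h x" "\<bar>\<Sum>x\<leftarrow>xs. f x\<bar> \<le> (\<Sum>x\<leftarrow>xs. h x)" by auto
  then show ?case by simp
qed simp

definition clamp01 :: "real \<Rightarrow> real" where "clamp01 x = max 0 (min 1 x)"

text \<open>The tail probabilities of the mean-preserving random rounding of an item to the grid.\<close>

definition ramps :: "nat \<Rightarrow> (real \<times> real) list \<Rightarrow> nat \<Rightarrow> real" where
  "ramps g xs k = (\<Sum>(y, q)\<leftarrow>xs. q * clamp01 (g * y - k))"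

definition item_elem :: "(real \<times> real) list \<Rightarrow> (real \<Rightarrow>\<^sub>0 real)" where
  "item_elem xs = (\<Sum>(y, q)\<leftarrow>xs. Poly_Mapping.single y q)"

context smooth_step
begin

text \<open>For \<open>y\<close> between \<open>j/g\<close> and \<open>(j + 1)/g\<close> the ramps
  are 1 below index \<open>j\<close>, the fractional part \<open>\<theta>\<close> at
  \<open>j\<close> and 0 above, so the sum telescopes to the chord of \<open>\<phi>\<close> between
  the two neighbours of \<open>y\<close>. For \<open>y\<close> at least 2 both sides have reached
  the value 1.\<close>

lemma ramp_interpolation:
  assumes g: "g \<ge> 1" and y: "0 \<le> y" and s: "0 \<le> s"
  shows "\<bar>\<phi> (s + y) - (\<phi> s + (\<Sum>k<2 * g. clamp01 (real g * y - k) *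
      (\<phi> (s + real (Suc k) / g) - \<phi> (s + real k / g))))\<bar> \<le> \<kappa> / (real g)\<^sup>2 * clamp01 (g * y)"
proof (cases "y \<ge> 2")
  case True
  have "2 * real g \<le> g * y" using True g by (simp add: mult.commute mult_left_mono)
  have "clamp01 (g * y - k) = 1" if "k < 2 * g" for k
  proof -
    have "real k + 1 \<le> 2 * real g" using that by linarith
    with \<open>2 * real g \<le> g * y\<close> have "1 \<le> g * y - k" by linarith
    then show ?thesis by (simp add: clamp01_def)
  qed
  then have "(\<Sum>k<2 * g. clamp01 (real g * y - k) * (\<phi> (s + real (Suc k) / g) - \<phi> (s + real k / g))) =
      (\<Sum>k<2 * g. (\<phi> (s + real (Suc k) / g) - \<phi> (s + real k / g)))" by simp
  also have "\<dots> = \<phi> (s + real (2 * g) / g) - \<phi> s"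
    using sum_lessThan_telescope[of "\<lambda>k. \<phi> (s + real k / g)" "2 * g"] by simp
  also have "\<phi> (s + real (2 * g) / g) = 1" using g s by (intro eq_1) simp
  finally show ?thesis using eq_1[of "s + y"] True s kappa by (simp add: clamp01_def)
next
  case False
  define j where "j = nat \<lfloor>g * y\<rfloor>"
  define \<theta> where "\<theta> = g * y - j"
  have j: "real j \<le> g * y" "g * y < real j + 1" using y g by (auto simp: j_def)
  have th: "0 \<le> \<theta>" "\<theta> \<le> 1" using j by (auto simp: \<theta>_def)
  have "g * y < 2 * g" using False g by simp
  then have jL: "j < 2 * g" using j(1) by linarith
  let ?d = "\<lambda>k. \<phi> (s + real (Suc k) / g) - \<phi> (s + real k / g)"
  have "(\<Sum>k<2 * g. clamp01 (real g * y - k) * ?d k) = (\<Sum>k\<in>{..<Suc j}. clamp01 (real g * y - k) * ?d k)"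
  proof (rule sum.mono_neutral_right)
    show "\<forall>k\<in>{..<2 * g} - {..<Suc j}. clamp01 (real g * y - k) * ?d k = 0"
      using j by (auto simp: clamp01_def)
  qed (use jL in auto)
  also have "\<dots> = (\<Sum>k<j. ?d k) + \<theta> * ?d j"
  proof -
    have "clamp01 (real g * y - k) = 1" if "k < j" for k using that j by (auto simp: clamp01_def)
    moreover have "clamp01 (real g * y - j) = \<theta>" using th by (simp add: \<theta>_def clamp01_def)
    ultimately show ?thesis by simp
  qed
  also have "(\<Sum>k<j. ?d k) = \<phi> (s + real j / g) - \<phi> s"
    using sum_lessThan_telescope[of "\<lambda>k. \<phi> (s + real k / g)" j] by simp
  finally have 1: "\<phi> s + (\<Sum>k<2 * g. clamp01 (real g * y - k) * ?d k) =
      (1 - \<theta>) * \<phi> (s + real j / g) + \<theta> * \<phi> (s + real j / g + 1 / g)"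
    by (simp add: algebra_simps add_divide_distrib)
  have 2: "s + real j / g + \<theta> * (1 / g) = s + y" using g by (simp add: \<theta>_def field_simps)
  \<comment> \<open>Equality holds if \<open>j = 0\<close>, which is the case that matters for tiny
    sizes; otherwise the right-hand side is 1.\<close>
  have "\<theta> \<le> clamp01 (g * y)"
    using j th unfolding clamp01_def \<theta>_def by (cases "j = 0") auto
  then have "\<kappa> * \<theta> * (1 / g)\<^sup>2 \<le> \<kappa> / (real g)\<^sup>2 * clamp01 (g * y)"
    using kappa by (simp add: power_divide divide_right_mono mult_left_mono)
  then show ?thesis
    using interpolation[OF th, of "1 / g" "s + real j / g"] unfolding 1 2 by (simp add: abs_minus_commute)
qed

lemma item_elem_tails:
  assumes g: "g \<ge> 1" and xs: "\<And>y q. (y, q) \<in> set xs \<Longrightarrow> 0 \<le> y \<and> 0 \<le> q"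
    and sum1: "sum_list (map snd xs) = 1"
  shows "le_upto (\<kappa> / (real g)\<^sup>2 * ramps g xs 0) (item_elem xs) (tails g (2 * g) (ramps g xs))"
    and "le_upto (\<kappa> / (real g)\<^sup>2 * ramps g xs 0) (tails g (2 * g) (ramps g xs)) (item_elem xs)"
proof -
  have *: "\<bar>ev_at s (item_elem xs) - ev_at s (tails g (2 * g) (ramps g xs))\<bar> \<le> \<kappa> / (real g)\<^sup>2 * ramps g xs 0"
    if s: "0 \<le> s" for s
  proof -
    let ?d = "\<lambda>k. \<phi> (s + real (Suc k) / g) - \<phi> (s + real k / g)"
    let ?t = "\<lambda>y. \<phi> s + (\<Sum>k<2 * g. clamp01 (real g * y - k) * ?d k)"
    have 1: "ev_at s (item_elem xs) = (\<Sum>(y, q)\<leftarrow>xs. q * \<phi> (s + y))"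
      unfolding item_elem_def ga_ev_sum_list by (simp add: case_prod_unfold)
    have "(\<Sum>(y, q)\<leftarrow>zs. q * ?t y) = sum_list (map snd zs) * \<phi> s +
        (\<Sum>k<2 * g. ramps g zs k * ?d k)" for zs
    proof (induction zs)
      case Nil
      show ?case by (simp add: ramps_def)
    next
      case (Cons z zs)
      obtain y q where z: "z = (y, q)" by force
      have "(\<Sum>k<2 * g. ramps g (z # zs) k * ?d k) =
          q * (\<Sum>k<2 * g. clamp01 (real g * y - k) * ?d k) + (\<Sum>k<2 * g. ramps g zs k * ?d k)"
        by (simp only: z ramps_def list.map sum_list.Cons prod.case distrib_right sum.distrib
            sum_distrib_left mult.assoc)
      then show ?case
        by (simp only: z list.map sum_list.Cons prod.case Cons.IH snd_conv)
          (simp only: distrib_left distrib_right add_ac)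
    qed
    then have 2: "ev_at s (tails g (2 * g) (ramps g xs)) = (\<Sum>(y, q)\<leftarrow>xs. q * ?t y)"
      by (simp add: ga_ev_tails sum1)
    have 3: "(\<Sum>(y, q)\<leftarrow>xs. q * \<phi> (s + y)) - (\<Sum>(y, q)\<leftarrow>xs. q * ?t y) =
        (\<Sum>(y, q)\<leftarrow>xs. q * (\<phi> (s + y) - ?t y))"
      by (simp add: sum_list_subtractf[symmetric] case_prod_unfold right_diff_distrib)
    have "\<bar>\<Sum>(y, q)\<leftarrow>xs. q * (\<phi> (s + y) - ?t y)\<bar> \<le> (\<Sum>(y, q)\<leftarrow>xs. \<kappa> / (real g)\<^sup>2 * (q * clamp01 (g * y)))"
    proof (rule sum_list_abs_le)
      fix z assume "z \<in> set xs"
      then obtain y q where z: "z = (y, q)" "0 \<le> y" "0 \<le> q" using xs by (metis surj_pair)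
      have "q * \<bar>\<phi> (s + y) - ?t y\<bar> \<le> q * (\<kappa> / (real g)\<^sup>2 * clamp01 (g * y))"
        by (intro mult_left_mono ramp_interpolation g s z)
      also have "\<dots> = \<kappa> / (real g)\<^sup>2 * (q * clamp01 (g * y))" by (rule mult.left_commute)
      finally show "\<bar>case z of (y, q) \<Rightarrow> q * (\<phi> (s + y) - ?t y)\<bar> \<le>
          (case z of (y, q) \<Rightarrow> \<kappa> / (real g)\<^sup>2 * (q * clamp01 (g * y)))"
        unfolding z(1) prod.case abs_mult abs_of_nonneg[OF z(3)] .
    qed
    also have "\<dots> = \<kappa> / (real g)\<^sup>2 * ramps g xs 0"
      unfolding ramps_def case_prod_unfold sum_list_const_mult by simp
    finally show ?thesis unfolding 1 2 3 .
  qed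
  show "le_upto (\<kappa> / (real g)\<^sup>2 * ramps g xs 0) (item_elem xs) (tails g (2 * g) (ramps g xs))"
    and "le_upto (\<kappa> / (real g)\<^sup>2 * ramps g xs 0) (tails g (2 * g) (ramps g xs)) (item_elem xs)"
    by (rule le_upto_absI(1)[OF *], assumption) (rule le_upto_absI(2)[OF *], assumption)
qed

end

lemma prob_item_elem:
  assumes "\<And>y q. (y, q) \<in> set xs \<Longrightarrow> 0 \<le> y \<and> 0 \<le> q" "sum_list (map snd xs) = 1"
  shows "item_elem xs \<in> prob"
proof -
  have "item_elem xs \<in> nonneg" unfolding item_elem_def
    by (intro nonneg_sum_list) (use assms(1) in \<open>auto intro: nonneg.single\<close>)
  moreover have "mass (item_elem xs) = 1"
    using assms(2) unfolding item_elem_def ga_ev_sum_list by (simp add: case_prod_unfold)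
  ultimately show ?thesis by (simp add: prob_def)
qed

section \<open>A piecewise quadratic smooth step\<close>

definition pos2 :: "real \<Rightarrow> real" where "pos2 x = (max 0 x)\<^sup>2"

text \<open>The function is convex with second derivative at most 2, so the chord lies above it by
  at most \<open>\<theta> * (1 - \<theta>) * h\<^sup>2\<close>. The cases distinguish the position
  of the kink relative to the three points.\<close>

lemma pos2_interpolation:
  fixes a :: real
  assumes "0 \<le> \<theta>" "\<theta> \<le> 1" "0 \<le> h"
  defines "\<Delta> \<equiv> (1 - \<theta>) * pos2 a + \<theta> * pos2 (a + h) - pos2 (a + \<theta> * h)"
  shows "0 \<le> \<Delta> \<and> \<Delta> \<le> \<theta> * h\<^sup>2"
proof -
  have th: "0 \<le> \<theta> * h" "\<theta> * h \<le> h" using assms by (auto simp: mult_left_le_one_le)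
  have "0 \<le> \<Delta> \<and> \<Delta> \<le> \<theta> * (1 - \<theta>) * h\<^sup>2"
  proof -
    consider "0 \<le> a" | "a + h \<le> 0" | "a < 0" "0 < a + h" "a + \<theta> * h \<le> 0" | "a < 0" "0 < a + \<theta> * h"
      by linarith
    then show ?thesis
    proof cases
      case 1
      then have "\<Delta> = \<theta> * (1 - \<theta>) * h\<^sup>2"
        using th assms(3) by (simp add: \<Delta>_def pos2_def power2_eq_square algebra_simps)
      then show ?thesis using assms by simp
    next
      case 2
      then have "\<Delta> = 0" using th assms(3) by (simp add: \<Delta>_def pos2_def)
      then show ?thesis using assms by simp
    next
      case 3
      then have D: "\<Delta> = \<theta> * (a + h)\<^sup>2" by (simp add: \<Delta>_def pos2_def)
      have "(a + h) * (a + h) \<le> ((1 - \<theta>) * h) * h"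
        using 3 assms by (intro mult_mono) (auto simp: algebra_simps)
      then have "\<theta> * (a + h)\<^sup>2 \<le> \<theta> * ((1 - \<theta>) * h * h)"
        unfolding power2_eq_square using assms(1) by (rule mult_left_mono)
      then show ?thesis using D assms by (simp add: power2_eq_square mult.assoc)
    next
      case 4
      then have "0 \<le> a + h" using th by linarith
      then have D: "\<Delta> = \<theta> * (1 - \<theta>) * h\<^sup>2 - (1 - \<theta>) * a\<^sup>2"
        using 4 by (simp add: \<Delta>_def pos2_def power2_eq_square algebra_simps)
      have "(-a) * (-a) \<le> (\<theta> * h) * (1 * h)"
        using 4 th assms by (intro mult_mono) auto
      then have "(1 - \<theta>) * a\<^sup>2 \<le> (1 - \<theta>) * (\<theta> * h\<^sup>2)"
        using assms(2) by (intro mult_left_mono) (auto simp: power2_eq_square mult.assoc)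
      moreover have "0 \<le> (1 - \<theta>) * a\<^sup>2" using assms(2) by simp
      ultimately show ?thesis using D by (simp add: algebra_simps)
    qed
  qed
  moreover have "\<theta> * (1 - \<theta>) * h\<^sup>2 \<le> \<theta> * h\<^sup>2"
    using assms by (intro mult_right_mono) (auto simp: mult_left_le)
  ultimately show ?thesis by linarith
qed

text \<open>The quadratic spline with knots 0, 1/2 and 1 that rises from 0 to 1; as a combination of
  shifts of \<open>pos2\<close> it inherits the interpolation bound.\<close>

definition unit_step :: "real \<Rightarrow> real" where
  "unit_step u = 2 * (pos2 u - 2 * pos2 (u - 1 / 2) + pos2 (u - 1))"

lemma unit_step_eq:
  "unit_step u = (if clamp01 u \<le> 1 / 2 then 2 * (clamp01 u)\<^sup>2 else 1 - 2 * (1 - clamp01 u)\<^sup>2)"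
proof -
  consider "u \<le> 0" | "0 < u" "u \<le> 1 / 2" | "1 / 2 < u" "u \<le> 1" | "1 < u" by linarith
  then show ?thesis
    by cases (simp_all add: unit_step_def pos2_def clamp01_def power2_eq_square algebra_simps)
qed

lemma unit_step_mono:
  assumes "u \<le> v" shows "unit_step u \<le> unit_step v"
proof -
  define a b where ab: "a = clamp01 u" "b = clamp01 v"
  have *: "a \<le> b" "0 \<le> a" "b \<le> 1" using assms by (auto simp: ab clamp01_def)
  have "2 * a\<^sup>2 \<le> 1 / 2" if "a \<le> 1 / 2"
    using power_mono[of a "1 / 2" 2] that * by (simp add: power_divide)
  moreover have "2 * (1 - b)\<^sup>2 \<le> 1 / 2" if "1 / 2 < b"
    using power_mono[of "1 - b" "1 / 2" 2] that * by (simp add: power_divide)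
  moreover have "a\<^sup>2 \<le> b\<^sup>2" "(1 - b)\<^sup>2 \<le> (1 - a)\<^sup>2" using * by (auto intro!: power_mono)
  ultimately show ?thesis using * by (auto simp: unit_step_eq ab[symmetric])
qed

lemma unit_step_le_0: "u \<le> 0 \<Longrightarrow> unit_step u = 0"
  by (simp add: unit_step_eq clamp01_def)

lemma unit_step_ge_1: "1 \<le> u \<Longrightarrow> unit_step u = 1"
  by (simp add: unit_step_eq clamp01_def)

lemma unit_step_bounds: "0 \<le> unit_step u \<and> unit_step u \<le> 1"
  using unit_step_mono[of "min 0 u" u] unit_step_mono[of u "max 1 u"]
  by (simp add: unit_step_le_0 unit_step_ge_1)

text \<open>Each of the three gaps lies between 0 and \<open>\<theta> * h\<^sup>2\<close>, and they
  enter with the coefficients 2, -4 and 2, whence the 4.\<close>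

lemma unit_step_interpolation:
  assumes "0 \<le> \<theta>" "\<theta> \<le> 1" "0 \<le> h"
  shows "\<bar>(1 - \<theta>) * unit_step x + \<theta> * unit_step (x + h) - unit_step (x + \<theta> * h)\<bar> \<le> 4 * \<theta> * h\<^sup>2"
proof -
  define \<Delta> where "\<Delta> = (\<lambda>a. (1 - \<theta>) * pos2 a + \<theta> * pos2 (a + h) - pos2 (a + \<theta> * h))"
  have 1: "(1 - \<theta>) * unit_step x + \<theta> * unit_step (x + h) - unit_step (x + \<theta> * h) =
      2 * (\<Delta> x - 2 * \<Delta> (x - 1 / 2) + \<Delta> (x - 1))"
    by (simp add: unit_step_def \<Delta>_def algebra_simps)
  have "0 \<le> \<Delta> a \<and> \<Delta> a \<le> \<theta> * h\<^sup>2" for a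
    using pos2_interpolation[OF assms, of a] by (simp add: \<Delta>_def)
  from this[of x] this[of "x - 1 / 2"] this[of "x - 1"] show ?thesis
    unfolding 1 by (simp add: abs_le_iff)
qed

text \<open>The rise takes place between 1 and \<open>1 + \<epsilon>\<close>, so
  \<open>\<epsilon> \<le> 1\<close> ensures that it is over at 2. Compressing the step by
  \<open>\<epsilon>\<close> divides the interpolation constant by
  \<open>\<epsilon>\<^sup>2\<close>.\<close>

lemma smooth_step_scaled:
  assumes "0 < \<epsilon>" "\<epsilon> \<le> 1"
  shows "smooth_step (\<lambda>x. unit_step ((x - 1) / \<epsilon>)) (4 / \<epsilon>\<^sup>2)"
proof
  fix \<theta> h x :: real assume *: "0 \<le> \<theta>" "\<theta> \<le> 1" "0 \<le> h"
  have "(x + h - 1) / \<epsilon> = (x - 1) / \<epsilon> + h / \<epsilon>" "(x + \<theta> * h - 1) / \<epsilon> = (x - 1) / \<epsilon> + \<theta> * (h / \<epsilon>)"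
    by (simp_all add: field_simps add_divide_distrib diff_divide_distrib)
  then show "\<bar>(1 - \<theta>) * unit_step ((x - 1) / \<epsilon>) + \<theta> * unit_step ((x + h - 1) / \<epsilon>) -
        unit_step ((x + \<theta> * h - 1) / \<epsilon>)\<bar> \<le> 4 / \<epsilon>\<^sup>2 * \<theta> * h\<^sup>2"
    using unit_step_interpolation[OF *(1,2), of "h / \<epsilon>" "(x - 1) / \<epsilon>"] *(3) assms
    by (simp add: power_divide)
qed (use assms in \<open>auto simp: unit_step_bounds unit_step_ge_1 intro!: unit_step_mono divide_right_mono\<close>)

section \<open>Overflow probabilities\<close>

text \<open>A size may occur several times in the list; the distribution adds up its
  probabilities.\<close>

lemma sum_pmf_of_list:
  assumes "pmf_of_list_wf xs" "finite A" "set (map fst xs) \<subseteq> A"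
  shows "(\<Sum>a\<in>A. pmf (pmf_of_list xs) a * h a) = (\<Sum>(x, q)\<leftarrow>xs. q * h x)"
proof -
  have "(\<Sum>a\<in>A. sum_list (map snd (filter (\<lambda>z. fst z = a) ys)) * h a) = (\<Sum>(x, q)\<leftarrow>ys. q * h x)"
    if "set (map fst ys) \<subseteq> A" for ys
    using that
  proof (induction ys)
    case (Cons y ys)
    have "(\<Sum>a\<in>A. sum_list (map snd (filter (\<lambda>z. fst z = a) (y # ys))) * h a) =
        (\<Sum>a\<in>A. (if a = fst y then snd y * h a else 0) + sum_list (map snd (filter (\<lambda>z. fst z = a) ys)) * h a)"
      by (intro sum.cong) (auto simp: ring_distribs)
    also have "\<dots> = snd y * h (fst y) + (\<Sum>(x, q)\<leftarrow>ys. q * h x)"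
      using Cons assms(2) by (simp add: sum.distrib sum.delta)
    finally show ?case by (simp add: case_prod_unfold)
  qed simp
  from this[OF assms(3)] show ?thesis by (simp add: pmf_pmf_of_list[OF assms(1)])
qed

definition scaled_item :: "real \<Rightarrow> item \<Rightarrow> (real \<times> real) list" where
  "scaled_item C b = map (\<lambda>(x, q). (x / C, q)) (real_item b)"

lemma finite_set_size_pmf:
  "pmf_of_list_wf (real_item b) \<Longrightarrow> finite (set_pmf (size_pmf b))"
  unfolding size_pmf_def by (rule finite_set_pmf_of_list)

lemma finite_set_Pi_pmf:
  assumes "finite S" "\<And>i. i \<in> S \<Longrightarrow> finite (set_pmf (p i))"
  shows "finite (set_pmf (Pi_pmf S d p))"
  unfolding set_Pi_pmf[OF assms(1)] using assms by (intro finite_PiE_dflt) auto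

text \<open>The bridge from probability to algebra. Conditioning on the size of one item shifts the
  argument of \<open>f\<close>, just as convolution with a point mass does; hence the induction is
  over all \<open>f\<close>.\<close>

lemma expectation_Pi_pmf:
  fixes S :: "'i set" and b :: "'i \<Rightarrow> item"
  assumes "finite S" "\<And>i. i \<in> S \<Longrightarrow> pmf_of_list_wf (real_item (b i))"
  shows "measure_pmf.expectation (Pi_pmf S 0 (\<lambda>i. size_pmf (b i))) (\<lambda>X. f ((\<Sum>i\<in>S. X i) / C)) =
    ga_ev f (\<Prod>i\<in>S. item_elem (scaled_item C (b i)))"
  using assms
proof (induction S arbitrary: f rule: finite_induct)
  case empty
  show ?case by simp
next
  case (insert j S)
  let ?p = "\<lambda>i. size_pmf (b i)"
  let ?A = "set (map fst (real_item (b j)))"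
  have wf: "pmf_of_list_wf (real_item (b j))" using insert by simp
  have fin: "finite (set_pmf (Pi_pmf S 0 ?p))"
    using insert by (intro finite_set_Pi_pmf finite_set_size_pmf) auto
  have "Pi_pmf (insert j S) 0 ?p = bind_pmf (?p j) (\<lambda>y. map_pmf (\<lambda>X. X(j := y)) (Pi_pmf S 0 ?p))"
    using insert(1,2) by (simp add: Pi_pmf_insert' map_pmf_def)
  then have "measure_pmf.expectation (Pi_pmf (insert j S) 0 ?p) (\<lambda>X. f ((\<Sum>i\<in>insert j S. X i) / C)) =
      (\<Sum>y\<in>?A. pmf (?p j) y *\<^sub>R measure_pmf.expectation (map_pmf (\<lambda>X. X(j := y)) (Pi_pmf S 0 ?p))
        (\<lambda>X. f ((\<Sum>i\<in>insert j S. X i) / C)))"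
    using set_pmf_of_list[OF wf] fin
    by (simp only:, intro pmf_expectation_bind) (auto simp: size_pmf_def)
  also have "\<dots> = (\<Sum>y\<in>?A. pmf (?p j) y * ga_ev (\<lambda>s. f (y / C + s)) (\<Prod>i\<in>S. item_elem (scaled_item C (b i))))"
  proof (intro sum.cong refl)
    fix y :: real
    have "(\<Sum>i\<in>S. (X(j := y)) i) = (\<Sum>i\<in>S. X i)" for X :: "'i \<Rightarrow> real"
      using insert(2) by (intro sum.cong) auto
    then show "pmf (?p j) y *\<^sub>R measure_pmf.expectation (map_pmf (\<lambda>X. X(j := y)) (Pi_pmf S 0 ?p))
        (\<lambda>X. f ((\<Sum>i\<in>insert j S. X i) / C)) =
        pmf (?p j) y * ga_ev (\<lambda>s. f (y / C + s)) (\<Prod>i\<in>S. item_elem (scaled_item C (b i)))"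
      using insert(1,2) insert.IH[of "\<lambda>s. f (y / C + s)"] insert.prems
      by (simp add: add_divide_distrib)
  qed
  also have "\<dots> = (\<Sum>(y, q)\<leftarrow>real_item (b j). q * ga_ev (\<lambda>s. f (y / C + s)) (\<Prod>i\<in>S. item_elem (scaled_item C (b i))))"
    unfolding size_pmf_def by (rule sum_pmf_of_list[OF wf]) auto
  also have "\<dots> = ga_ev f (item_elem (scaled_item C (b j)) * (\<Prod>i\<in>S. item_elem (scaled_item C (b i))))"
    unfolding item_elem_def scaled_item_def
    by (simp add: sum_list_mult_const[symmetric] ga_ev_sum_list ga_ev_single_mult case_prod_unfold o_def)
  finally show ?case using insert(1,2) by simp
qed

text \<open>By way of \<open>1 / (1 + y)\<close>: for \<open>y\<close> up to 1 one has
  \<open>(1 - y / 2) * (1 + y) = 1 + y * (1 - y) / 2\<close>, which is at least 1.\<close>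

lemma exp_minus_le: "0 \<le> y \<Longrightarrow> exp (- y) \<le> 1 - clamp01 y / (2 :: real)"
proof -
  assume y: "0 \<le> y"
  have "exp (- y) \<le> 1 / (1 + y)"
    using exp_ge_add_one_self[of y] y by (simp add: exp_minus inverse_eq_divide frac_le)
  also have "\<dots> \<le> 1 - clamp01 y / 2"
  proof (cases "y \<le> 1")
    case True
    then have "1 \<le> (1 - y / 2) * (1 + y)" using y mult_left_mono[of y 1 y] by (simp add: algebra_simps)
    then show ?thesis using True y by (simp add: clamp01_def divide_le_eq)
  next
    case False
    then show ?thesis by (simp add: clamp01_def divide_le_eq)
  qed
  finally show ?thesis .
qed

context
  fixes I :: sbp
  assumes I: "sbp_instance I"
begin

abbreviation cap :: real where "cap \<equiv> of_rat (capacity I)"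

abbreviation elem :: "nat \<Rightarrow> (real \<Rightarrow>\<^sub>0 real)" where
  "elem i \<equiv> item_elem (scaled_item cap (items I ! i))"

lemma cap_pos: "0 < cap"
  using I by (simp add: sbp_instance_def)

lemma item_wf: "i < length (items I) \<Longrightarrow> pmf_of_list_wf (real_item (items I ! i))"
  using I by (auto simp: sbp_instance_def)

lemma scaled_item_nonneg:
  assumes "i < length (items I)" "(y, q) \<in> set (scaled_item cap (items I ! i))"
  shows "0 \<le> y \<and> 0 \<le> q"
proof -
  from assms(2) obtain x r where x: "(x, r) \<in> set (items I ! i)" "y = of_rat x / cap" "q = of_rat r"
    unfolding scaled_item_def real_item_def by auto
  have "0 \<le> x" using I x(1) assms(1) by (fastforce simp: sbp_instance_def)
  moreover have "(of_rat x, of_rat r) \<in> set (real_item (items I ! i))"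
    using x(1) by (force simp: real_item_def)
  then have "0 \<le> (of_rat r :: real)" using item_wf[OF assms(1)] by (force simp: pmf_of_list_wf_def)
  ultimately show ?thesis using x cap_pos by simp
qed

lemma scaled_item_sum: "i < length (items I) \<Longrightarrow> sum_list (map snd (scaled_item cap (items I ! i))) = 1"
  using item_wf[of i] by (simp add: scaled_item_def pmf_of_list_wf_def case_prod_unfold o_def)

lemma elem_prob: "i < length (items I) \<Longrightarrow> elem i \<in> prob"
  by (intro prob_item_elem scaled_item_nonneg scaled_item_sum)

lemma finite_set_sizes_pmf: "finite (set_pmf (sizes_pmf I))"
  unfolding sizes_pmf_def using item_wf by (intro finite_set_Pi_pmf finite_set_size_pmf) auto

lemma expectation_sizes:
  assumes S: "S \<subseteq> {..<length (items I)}"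
  shows "measure_pmf.expectation (sizes_pmf I) (\<lambda>X. f ((\<Sum>i\<in>S. X i) / cap)) = ga_ev f (\<Prod>i\<in>S. elem i)"
proof -
  have fin: "finite S" using S finite_subset by blast
  have "Pi_pmf S 0 (\<lambda>i. size_pmf (items I ! i)) =
      map_pmf (\<lambda>X i. if i \<in> S then X i else 0) (sizes_pmf I)"
    unfolding sizes_pmf_def by (rule Pi_pmf_subset) (use S in auto)
  then have "measure_pmf.expectation (sizes_pmf I) (\<lambda>X. f ((\<Sum>i\<in>S. X i) / cap)) =
      measure_pmf.expectation (Pi_pmf S 0 (\<lambda>i. size_pmf (items I ! i))) (\<lambda>X. f ((\<Sum>i\<in>S. X i) / cap))"
    by simp
  then show ?thesis using expectation_Pi_pmf[OF fin, of "\<lambda>i. items I ! i" f cap] item_wf S by auto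
qed

lemma prob_exceeds_le:
  assumes S: "S \<subseteq> {..<length (items I)}" and f: "\<And>x. 0 \<le> f x" "\<And>x. c \<le> x \<Longrightarrow> 1 \<le> f x"
  shows "prob_exceeds I S (c * cap) \<le> ga_ev f (\<Prod>i\<in>S. elem i)"
proof -
  let ?A = "{X. (\<Sum>i\<in>S. X i) > c * cap}"
  have "prob_exceeds I S (c * cap) = measure_pmf.expectation (sizes_pmf I) (indicator ?A)"
    by (simp add: prob_exceeds_def)
  also have "\<dots> \<le> measure_pmf.expectation (sizes_pmf I) (\<lambda>X. f ((\<Sum>i\<in>S. X i) / cap))"
  proof (rule integral_mono)
    fix X
    show "indicator ?A X \<le> f ((\<Sum>i\<in>S. X i) / cap)"
      using f cap_pos by (auto simp: indicator_def field_simps)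
  qed (auto intro: integrable_measure_pmf_finite finite_set_sizes_pmf)
  finally show ?thesis by (simp add: expectation_sizes[OF S])
qed

lemma ev_le_prob_exceeds:
  assumes S: "S \<subseteq> {..<length (items I)}" and f: "\<And>x. f x \<le> 1" "\<And>x. x \<le> 1 \<Longrightarrow> f x \<le> 0"
  shows "ga_ev f (\<Prod>i\<in>S. elem i) \<le> prob_exceeds I S cap"
proof -
  let ?A = "{X. (\<Sum>i\<in>S. X i) > cap}"
  have "measure_pmf.expectation (sizes_pmf I) (\<lambda>X. f ((\<Sum>i\<in>S. X i) / cap)) \<le>
      measure_pmf.expectation (sizes_pmf I) (indicator ?A)"
  proof (rule integral_mono)
    fix X
    show "f ((\<Sum>i\<in>S. X i) / cap) \<le> indicator ?A X"
      using f cap_pos by (auto simp: indicator_def field_simps)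
  qed (auto intro: integrable_measure_pmf_finite finite_set_sizes_pmf)
  then show ?thesis by (simp add: expectation_sizes[OF S] prob_exceeds_def)
qed

text \<open>A Chernoff argument for the lower tail. With probability at least \<open>d\<close> the
  scaled total is at most 1, so \<open>d\<close> is at most the expectation of
  \<open>exp (1 - total)\<close>. This factors, and each factor is at most
  \<open>exp (- m / 2)\<close>, where \<open>m\<close> is the mean of the size truncated at 1. The
  factor \<open>g\<close> stems from \<open>clamp01 (g * y) \<le> g * clamp01 y\<close>.\<close>

lemma ramps_sum_le:
  assumes S: "S \<subseteq> {..<length (items I)}" and g: "g \<ge> 1" and d: "0 < d" "prob_exceeds I S cap \<le> 1 - d"
  shows "(\<Sum>i\<in>S. ramps g (scaled_item cap (items I ! i)) 0) \<le> g * (2 * (1 - ln d))"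
proof -
  let ?m = "\<lambda>i. ramps 1 (scaled_item cap (items I ! i)) 0"
  have fin: "finite S" using S finite_subset by blast
  have "d \<le> 1 - prob_exceeds I S cap" using d by simp
  also have "\<dots> \<le> ga_ev (\<lambda>x. exp (1 - x)) (\<Prod>i\<in>S. elem i)"
  proof -
    let ?A = "{X. (\<Sum>i\<in>S. X i) > cap}"
    have "1 - prob_exceeds I S cap = measure_pmf.prob (sizes_pmf I) (UNIV - ?A)"
      unfolding prob_exceeds_def by (subst measure_pmf.prob_compl[symmetric]) auto
    also have "\<dots> = measure_pmf.expectation (sizes_pmf I) (indicator (UNIV - ?A))" by simp
    also have "\<dots> \<le> measure_pmf.expectation (sizes_pmf I) (\<lambda>X. exp (1 - (\<Sum>i\<in>S. X i) / cap))"
    proof (rule integral_mono)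
      fix X
      show "indicator (UNIV - ?A) X \<le> exp (1 - (\<Sum>i\<in>S. X i) / cap)"
        using cap_pos by (auto simp: indicator_def)
    qed (auto intro: integrable_measure_pmf_finite finite_set_sizes_pmf)
    finally show ?thesis by (simp add: expectation_sizes[OF S, of "\<lambda>x. exp (1 - x)"])
  qed
  also have "\<dots> = exp 1 * ga_ev (\<lambda>x. exp (- x)) (\<Prod>i\<in>S. elem i)"
    by (simp add: ga_ev_def sum_distrib_left exp_diff exp_minus divide_inverse mult.left_commute)
  also have "ga_ev (\<lambda>x. exp (- x)) (\<Prod>i\<in>S. elem i) = (\<Prod>i\<in>S. ga_ev (\<lambda>x. exp (- x)) (elem i))"
    using fin by (induction S rule: finite_induct)
      (auto simp: ga_ev_mult_hom[where f = "\<lambda>x. exp (- x)"] exp_add[symmetric])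
  also have "\<dots> \<le> (\<Prod>i\<in>S. exp (- ?m i / 2))"
  proof (rule prod_mono, intro conjI)
    fix i assume "i \<in> S"
    then have i: "i < length (items I)" using S by auto
    let ?xs = "scaled_item cap (items I ! i)"
    have 1: "ga_ev (\<lambda>x. exp (- x)) (elem i) = (\<Sum>(y, q)\<leftarrow>?xs. q * exp (- y))"
      unfolding item_elem_def ga_ev_sum_list by (simp add: case_prod_unfold)
    have "0 \<le> (case z of (y, q) \<Rightarrow> q * exp (- y))" if "z \<in> set ?xs" for z
      using scaled_item_nonneg[OF i] that by (cases z) auto
    then show "0 \<le> ga_ev (\<lambda>x. exp (- x)) (elem i)"
      unfolding 1 by (intro sum_list_nonneg) auto
    have "(\<Sum>(y, q)\<leftarrow>?xs. q * exp (- y)) \<le> (\<Sum>(y, q)\<leftarrow>?xs. q - q * clamp01 y / 2)"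
    proof (rule sum_list_mono)
      fix z assume "z \<in> set ?xs"
      then obtain y q where z: "z = (y, q)" "0 \<le> y" "0 \<le> q"
        using scaled_item_nonneg[OF i] by (metis surj_pair)
      have "q * exp (- y) \<le> q * (1 - clamp01 y / 2)" by (intro mult_left_mono exp_minus_le z)
      then show "(case z of (y, q) \<Rightarrow> q * exp (- y)) \<le> (case z of (y, q) \<Rightarrow> q - q * clamp01 y / 2)"
        using z by (simp add: algebra_simps)
    qed
    also have "\<dots> = sum_list (map snd ?xs) - ?m i / 2"
    proof -
      have "(\<Sum>(y, q)\<leftarrow>zs. q - q * clamp01 y / 2) = sum_list (map snd zs) - ramps 1 zs 0 / 2" for zs
        by (induction zs) (auto simp: ramps_def add_divide_distrib)
      then show ?thesis .
    qed
    also have "\<dots> \<le> exp (- ?m i / 2)"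
      using exp_ge_add_one_self[of "- ?m i / 2"] scaled_item_sum[OF i] by simp
    finally show "ga_ev (\<lambda>x. exp (- x)) (elem i) \<le> exp (- ?m i / 2)" unfolding 1 .
  qed
  also have "(\<Prod>i\<in>S. exp (- ?m i / 2)) = exp (- (\<Sum>i\<in>S. ?m i) / 2)"
    by (simp add: exp_sum[OF fin, symmetric] sum_negf sum_divide_distrib)
  finally have "d \<le> exp (1 - (\<Sum>i\<in>S. ?m i) / 2)" by (simp add: exp_add[symmetric])
  then have "ln d \<le> 1 - (\<Sum>i\<in>S. ?m i) / 2" using d(1) by (metis ln_exp ln_le_cancel_iff exp_gt_zero)
  then have "(\<Sum>i\<in>S. ?m i) \<le> 2 * (1 - ln d)" by simp
  then have "g * (\<Sum>i\<in>S. ?m i) \<le> g * (2 * (1 - ln d))" by (intro mult_left_mono) auto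
  moreover have "(\<Sum>i\<in>S. ramps g (scaled_item cap (items I ! i)) 0) \<le> (\<Sum>i\<in>S. g * ?m i)"
  proof (rule sum_mono)
    fix i assume "i \<in> S"
    then have i: "i < length (items I)" using S by auto
    let ?xs = "scaled_item cap (items I ! i)"
    have "ramps g ?xs 0 \<le> (\<Sum>(y, q)\<leftarrow>?xs. real g * (q * clamp01 y))"
      unfolding ramps_def
    proof (rule sum_list_mono)
      fix z assume "z \<in> set ?xs"
      then obtain y q where z: "z = (y, q)" "0 \<le> y" "0 \<le> q"
        using scaled_item_nonneg[OF i] by (metis surj_pair)
      have "clamp01 (g * y) \<le> g * clamp01 y"
        using mult_mono[of 1 "real g" 1 y] mult_right_mono[of 1 "real g" y] g z(2)
        by (cases "1 \<le> y") (auto simp: clamp01_def)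
      then have "q * clamp01 (g * y) \<le> q * (g * clamp01 y)" using z by (intro mult_left_mono)
      then show "(case z of (y, q) \<Rightarrow> q * clamp01 (real g * y - real 0)) \<le>
          (case z of (y, q) \<Rightarrow> real g * (q * clamp01 y))"
        using z by (simp add: algebra_simps)
    qed
    also have "\<dots> = g * ?m i" unfolding ramps_def case_prod_unfold sum_list_const_mult by simp
    finally show "ramps g ?xs 0 \<le> g * ?m i" .
  qed
  ultimately show ?thesis by (simp add: sum_distrib_left)
qed

end

section \<open>Rounding the items to finitely many classes\<close>

lemma sum_list_floor_bounds:
  fixes a :: "'z \<Rightarrow> rat"
  shows "(\<Sum>z\<leftarrow>zs. a z) \<le> of_int (\<Sum>z\<leftarrow>zs. \<lfloor>a z\<rfloor> + 1)"
    and "of_int (\<Sum>z\<leftarrow>zs. \<lfloor>a z\<rfloor> + 1) \<le> (\<Sum>z\<leftarrow>zs. a z) + of_nat (length zs)"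
proof (induction zs)
  case (Cons z zs)
  {
    case 1
    show ?case using Cons(1) floor_correct[of "a z"] by simp
  next
    case 2
    show ?case using Cons(2) by (auto intro!: add_mono)
  }
qed auto

lemma ceiling_div: "0 < m \<Longrightarrow> - ((- n) div m) = \<lceil>real_of_int n / real_of_int m\<rceil>"
  using floor_divide_of_int_eq[of "- n" m, where 'a = real] by (simp add: ceiling_def)

text \<open>The grid has width \<open>1/g\<close>, directions have accuracy \<open>1/G\<close>,
  masses of heavy items accuracy \<open>1/H\<close>; \<open>1/D\<close> separates light from heavy,
  and \<open>1/K\<close> bounds the total error of rounding probabilities to integers.\<close>

locale grid =
  fixes g G H D K :: nat
  assumes g: "g \<ge> 1" and G: "G \<ge> 1" and H: "H \<ge> 1" and D: "D \<ge> 1" and K: "K \<ge> 1"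
begin

text \<open>
  Masses are integer multiples of \<open>1 / resolution\<close>. The tail probabilities of an item are rounded
  up, to a positive value; an item whose mass \<open>tail 0\<close> is at most \<open>1/D\<close> is light. All divisions
  round up.
\<close>

definition unit :: "sbp \<Rightarrow> int" where
  "unit I = int K * ((\<Sum>b\<leftarrow>items I. int (length b)) + 1)"

definition resolution :: "sbp \<Rightarrow> int" where
  "resolution I = int D * unit I"

definition tail :: "sbp \<Rightarrow> item \<Rightarrow> nat \<Rightarrow> int" where
  "tail I b k = min (resolution I) (\<Sum>(x, q)\<leftarrow>b.
     \<lfloor>of_int (resolution I) * q * max 0 (min 1 (of_nat g * x / capacity I - of_nat k))\<rfloor> + 1)"

definition light :: "sbp \<Rightarrow> item \<Rightarrow> bool" where
  "light I b \<longleftrightarrow> tail I b 0 \<le> unit I"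

definition digit :: "sbp \<Rightarrow> item \<Rightarrow> nat \<Rightarrow> nat" where
  "digit I b k = nat (- ((- (tail I b k * int G)) div tail I b 0))"

definition level :: "sbp \<Rightarrow> item \<Rightarrow> nat" where
  "level I b = (if light I b then 0 else nat (- ((- (tail I b 0 * int H)) div resolution I)))"

text \<open>
  A light item has level \<open>0\<close>. Light items of one class differ in their mass only, heavy items of
  one class are indistinguishable.
\<close>

definition class_of :: "sbp \<Rightarrow> item \<Rightarrow> nat list" where
  "class_of I b = level I b # map (digit I b) [0..<2 * g]"

text \<open>With the weight \<open>unit I\<close> for every heavy item, a room of \<open>n\<close>
  units means \<open>n\<close> heavy items or a light mass of \<open>n/D\<close>, and one filling
  procedure serves both.\<close>

definition weight :: "sbp \<Rightarrow> item \<Rightarrow> int" where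
  "weight I b = (if light I b then tail I b 0 else unit I)"

text \<open>The set depends on \<open>g\<close> and \<open>G\<close> only, so \<open>D\<close> can
  be chosen later with regard to its cardinality.\<close>

definition directions :: "nat list set" where
  "directions = {map d [0..<2 * g] | d. d 0 \<le> G \<and> (\<forall>k. d (Suc k) \<le> d k)}"

definition classes :: "nat list set" where
  "classes = {l # ds | l ds. l \<le> H \<and> ds \<in> directions}"

lemma finite_directions: "finite directions"
proof -
  have "d k \<le> G" if "d 0 \<le> G" "\<forall>k. d (Suc k) \<le> d k" for d :: "nat \<Rightarrow> nat" and k
    using that by (induction k) (auto intro: le_trans)
  then have "directions \<subseteq> {ds. set ds \<subseteq> {..G} \<and> length ds = 2 * g}"
    by (auto simp: directions_def)
  then show ?thesis using finite_lists_length_eq[of "{..G}" "2 * g"] finite_subset by blast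
qed

lemma finite_classes: "finite classes"
proof -
  have "classes = (\<lambda>(l, ds). l # ds) ` ({..H} \<times> directions)" by (auto simp: classes_def)
  then show ?thesis using finite_directions by simp
qed

lemma card_light_classes: "card {t \<in> classes. hd t = 0} = card directions"
proof -
  have "{t \<in> classes. hd t = 0} = (\<lambda>ds. 0 # ds) ` directions" by (auto simp: classes_def)
  then show ?thesis by (simp add: card_image)
qed

context
  fixes I :: sbp
  assumes I: "sbp_instance I"
begin

lemma unit_pos: "1 \<le> unit I"
proof -
  have "0 \<le> (\<Sum>b\<leftarrow>items I. int (length b))" by (intro sum_list_nonneg) auto
  then have "1 * 1 \<le> int K * ((\<Sum>b\<leftarrow>items I. int (length b)) + 1)" using K by (intro mult_mono) auto
  then show ?thesis by (simp add: unit_def)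
qed

lemma resolution_pos: "1 \<le> resolution I"
  using unit_pos mult_mono[of 1 "int D" 1 "unit I"] D by (simp add: resolution_def)

context
  fixes i b assumes i: "i < length (items I)" and b: "b = items I ! i"
begin

lemma b_nonneg: "(x, q) \<in> set b \<Longrightarrow> 0 \<le> x \<and> 0 \<le> q"
  using scaled_item_nonneg[OF I i, of "of_rat x / (cap I)" "of_rat q"] cap_pos[OF I]
  by (force simp: b scaled_item_def real_item_def zero_le_divide_iff)

lemma b_nonempty: "b \<noteq> []"
  using scaled_item_sum[OF I i] by (auto simp: b scaled_item_def real_item_def)

abbreviation r :: "nat \<Rightarrow> real" where "r \<equiv> ramps g (scaled_item (cap I) b)"

lemma ramps_rat: "r k = of_rat (\<Sum>(x, q)\<leftarrow>b. q * max 0 (min 1 (of_nat g * x / capacity I - of_nat k)))"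
proof -
  have c: "of_rat (max 0 (min 1 z)) = clamp01 (of_rat z)" for z
    by (simp add: clamp01_def max_def min_def)
  show ?thesis unfolding ramps_def scaled_item_def real_item_def
    by (induction b) (auto simp: c of_rat_add of_rat_mult of_rat_diff of_rat_divide)
qed

text \<open>Every entry of the list is rounded up by at most one multiple of
  \<open>1 / resolution\<close>, which explains the length in the error. The cut at
  \<open>resolution I\<close> respects the lower bound because \<open>r k\<close> is at most
  1.\<close>

lemma tail_bounds:
  "r k \<le> tail I b k / resolution I" "tail I b k / resolution I \<le> r k + length b / resolution I"
  "1 \<le> tail I b k" "tail I b k \<le> resolution I" "tail I b (Suc k) \<le> tail I b k"
proof -
  let ?U = "resolution I"
  let ?c = "\<lambda>k x. max 0 (min 1 (of_nat g * x / capacity I - of_nat k)) :: rat"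
  let ?f = "\<lambda>k (x, q). \<lfloor>of_int ?U * q * ?c k x\<rfloor> + 1"
  have U: "0 < real_of_int ?U" using resolution_pos by simp
  have f: "?f k = (\<lambda>z. \<lfloor>of_int ?U * (case z of (x, q) \<Rightarrow> q * ?c k x)\<rfloor> + 1)" for k
    by (auto simp: fun_eq_iff mult.assoc)
  have lo: "of_int ?U * (\<Sum>(x, q)\<leftarrow>zs. q * ?c k x) \<le> rat_of_int (\<Sum>z\<leftarrow>zs. ?f k z)" for zs k
    unfolding f sum_list_const_mult[symmetric] by (rule sum_list_floor_bounds)
  have hi: "rat_of_int (\<Sum>z\<leftarrow>zs. ?f k z) \<le> of_int ?U * (\<Sum>(x, q)\<leftarrow>zs. q * ?c k x) + of_nat (length zs)" for zs k
    unfolding f sum_list_const_mult[symmetric] by (rule sum_list_floor_bounds)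
  have lo': "?U * r k \<le> real_of_int (\<Sum>z\<leftarrow>b. ?f k z)" for k
    using lo[of k b, folded of_rat_less_eq[where 'a = real]] by (simp add: ramps_rat of_rat_mult)
  have hi': "real_of_int (\<Sum>z\<leftarrow>b. ?f k z) \<le> ?U * r k + length b" for k
    using hi[of k b, folded of_rat_less_eq[where 'a = real]] by (simp add: ramps_rat of_rat_mult of_rat_add)
  have t: "tail I b k = min ?U (\<Sum>z\<leftarrow>b. ?f k z)" for k by (simp add: tail_def case_prod_unfold)
  have pos: "0 \<le> of_int ?U * q * ?c k x" if "(x, q) \<in> set b" for x q k
    using b_nonneg[OF that] resolution_pos by simp
  have r1: "r k \<le> 1"
  proof -
    have "r k \<le> sum_list (map snd (scaled_item (cap I) b))"
      unfolding ramps_def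
    proof (rule sum_list_mono)
      fix z assume "z \<in> set (scaled_item (cap I) b)"
      then obtain y q where z: "z = (y, q)" "0 \<le> q" using scaled_item_nonneg[OF I i] b by (metis surj_pair)
      then show "(case z of (y, q) \<Rightarrow> q * clamp01 (real g * y - real k)) \<le> snd z"
        by (simp add: clamp01_def mult_left_le)
    qed
    then show ?thesis using scaled_item_sum[OF I i] by (simp add: b)
  qed
  show "r k \<le> tail I b k / ?U"
    using lo'[of k] r1 U unfolding t by (simp add: le_divide_eq mult.commute of_int_min)
  show "tail I b k / ?U \<le> r k + length b / ?U"
  proof -
    have "real_of_int (tail I b k) \<le> ?U * r k + length b"
      using hi'[of k] unfolding t by (simp add: of_int_min)
    then show ?thesis using U by (simp add: field_simps)
  qed
  show "1 \<le> tail I b k"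
  proof -
    obtain z zs where zs: "b = z # zs" using b_nonempty by (cases b) auto
    have f1: "1 \<le> ?f k z" if "z \<in> set b" for z using pos that by (cases z) simp
    have "0 \<le> (\<Sum>z\<leftarrow>zs. ?f k z)" by (intro sum_list_nonneg) (use f1 zs in fastforce)
    then show ?thesis using f1[of z] resolution_pos zs unfolding t by simp
  qed
  show "tail I b k \<le> ?U" unfolding t by simp
  show "tail I b (Suc k) \<le> tail I b k"
  proof -
    have "(\<Sum>z\<leftarrow>b. ?f (Suc k) z) \<le> (\<Sum>z\<leftarrow>b. ?f k z)"
    proof (rule sum_list_mono)
      fix z assume z: "z \<in> set b"
      obtain x q where xq: "z = (x, q)" by force
      have "of_int ?U * q * ?c (Suc k) x \<le> of_int ?U * q * ?c k x"
        using b_nonneg z xq resolution_pos by (intro mult_left_mono) auto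
      then show "?f (Suc k) z \<le> ?f k z" unfolding xq prod.case by (simp add: floor_mono)
    qed
    then show ?thesis unfolding t by (rule min.mono[OF order_refl])
  qed
qed

lemma digit_bounds:
  "real_of_int (tail I b k) * G / tail I b 0 \<le> digit I b k"
  "digit I b k \<le> real_of_int (tail I b k) * G / tail I b 0 + 1"
  "digit I b k \<le> G" "digit I b (Suc k) \<le> digit I b k"
proof -
  have t0: "0 < tail I b 0" using tail_bounds(3)[of 0] by simp
  have le0: "tail I b k \<le> tail I b 0" for k
    by (induction k) (auto intro: order_trans[OF tail_bounds(5)])
  have d: "digit I b k = nat \<lceil>real_of_int (tail I b k) * G / tail I b 0\<rceil>" for k
    using ceiling_div[OF t0, of "tail I b k * int G"] by (simp add: digit_def)
  have p: "0 \<le> real_of_int (tail I b k) * G / tail I b 0" for k using t0 tail_bounds(3)[of k] by simp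
  show "real_of_int (tail I b k) * G / tail I b 0 \<le> digit I b k" unfolding d using p[of k] by linarith
  show "digit I b k \<le> real_of_int (tail I b k) * G / tail I b 0 + 1" unfolding d using p[of k] by linarith
  have "real_of_int (tail I b k) * G / tail I b 0 \<le> G"
    using t0 le0[of k] by (simp add: divide_le_eq mult.commute mult_left_mono)
  then show "digit I b k \<le> G" unfolding d by (simp add: nat_le_iff ceiling_le_iff)
  have "real_of_int (tail I b (Suc k)) * G / tail I b 0 \<le> real_of_int (tail I b k) * G / tail I b 0"
    using t0 tail_bounds(5)[of k] by (intro divide_right_mono mult_right_mono) auto
  then show "digit I b (Suc k) \<le> digit I b k" unfolding d by (intro nat_mono ceiling_mono)
qed

lemma level_bounds:
  assumes "\<not> light I b"
  shows "real_of_int (tail I b 0) / resolution I \<le> level I b / H"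
    "level I b / H \<le> real_of_int (tail I b 0) / resolution I + 1 / H" "1 \<le> level I b" "level I b \<le> H"
proof -
  let ?x = "real_of_int (tail I b 0) * H / resolution I"
  have U: "0 < resolution I" using resolution_pos by simp
  have l: "level I b = nat \<lceil>?x\<rceil>"
    using assms ceiling_div[OF U, of "tail I b 0 * int H"] by (simp add: level_def)
  have p: "0 < ?x" using U H tail_bounds(3)[of 0] by simp
  have "?x \<le> level I b" "level I b \<le> ?x + 1" unfolding l using p by linarith+
  then show "real_of_int (tail I b 0) / resolution I \<le> level I b / H"
    "level I b / H \<le> real_of_int (tail I b 0) / resolution I + 1 / H"
    using H U by (auto simp: field_simps)
  show "1 \<le> level I b" unfolding l using p by linarith
  have "?x \<le> H" using tail_bounds(4)[of 0] U by (simp add: divide_le_eq mult.commute mult_left_mono)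
  then show "level I b \<le> H" unfolding l by (simp add: nat_le_iff ceiling_le_iff)
qed

lemma class_of_in_classes: "class_of I b \<in> classes"
proof -
  have "level I b \<le> H" using level_bounds(4) by (cases "light I b") (auto simp: level_def)
  moreover have "map (digit I b) [0..<2 * g] \<in> directions"
    unfolding directions_def using digit_bounds(3,4) by blast
  ultimately show ?thesis by (simp add: class_of_def classes_def)
qed

lemma light_iff: "light I b \<longleftrightarrow> hd (class_of I b) = 0"
  using level_bounds(3) by (cases "light I b") (auto simp: class_of_def level_def)

lemma weight_bounds: "1 \<le> weight I b" "weight I b \<le> unit I"
  using tail_bounds(3)[of 0] unit_pos by (auto simp: weight_def light_def)

end

end

end

text \<open>\<open>M\<close> is to bound the mass of a feasible bin. By
  \<open>few_directions\<close>, one unit \<open>1/D\<close> for every light class amounts to a mass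
  of at most 1. By \<open>levels\<close> the same holds for rounding the heavy masses, as a bin of
  rounded mass \<open>M + 1\<close> has at most \<open>(M + 1) * D\<close> heavy items.\<close>

locale rounding = grid + smooth_step +
  fixes M :: real
  assumes M: "0 \<le> M" and few_directions: "card directions \<le> D" and levels: "(M + 1) * D \<le> H"
begin

text \<open>For a light class this is the mass of one unit of room, not of an item.\<close>

definition magnitude :: "nat list \<Rightarrow> real" where
  "magnitude t = (if hd t = 0 then 1 / D else real (hd t) / H)"

text \<open>Position 0 of a class holds the level, hence \<open>Suc k\<close>. The value 0 beyond
  the grid keeps the tails nonincreasing, as \<open>tails_prob\<close> demands of all
  indices.\<close>

definition direction :: "nat list \<Rightarrow> (real \<Rightarrow>\<^sub>0 real)" where
  "direction t = tails g (2 * g) (\<lambda>k. if k < 2 * g then real (t ! Suc k) / G else 0)"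

text \<open>
  A configuration \<open>cp\<close> gives the room for each class in a bin: the number of heavy items, or the
  total mass of the light ones in multiples of \<open>1/D\<close>. Its distribution does not depend on the
  instance.
\<close>

definition canonical :: "(nat list \<Rightarrow> nat) \<Rightarrow> (real \<Rightarrow>\<^sub>0 real)" where
  "canonical cp = (\<Prod>t\<in>classes. bern (magnitude t) (direction t) ^ cp t)"

definition config_mass :: "(nat list \<Rightarrow> nat) \<Rightarrow> real" where
  "config_mass cp = (\<Sum>t\<in>classes. cp t * magnitude t)"

lemma direction_prob:
  assumes "t \<in> classes" shows "direction t \<in> prob"
proof -
  from assms obtain l d where t: "t = l # map d [0..<2 * g]" "d 0 \<le> G" "\<And>k. d (Suc k) \<le> d k"
    by (auto simp: classes_def directions_def)
  have "t ! Suc k = d k" if "k < 2 * g" for k using that t(1) by simp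
  then show ?thesis unfolding direction_def
    by (intro tails_prob) (use t(2,3) G g in \<open>auto simp: divide_right_mono\<close>)
qed

lemma magnitude_bounds: "t \<in> classes \<Longrightarrow> 0 \<le> magnitude t \<and> magnitude t \<le> 1"
  using D H by (auto simp: magnitude_def classes_def divide_le_eq)

lemma light_classes_sum:
  "(\<Sum>t\<in>classes. if hd t = 0 then c else 0) = real (card directions) * c"
proof -
  have "(\<Sum>t\<in>classes. if hd t = 0 then c else 0) = (\<Sum>t\<in>{t\<in>classes. hd t = 0}. c)"
    by (rule sum.inter_filter[symmetric, OF finite_classes])
  then show ?thesis by (simp add: card_light_classes)
qed

context
  fixes I :: sbp
  assumes I: "sbp_instance I"
begin

abbreviation item :: "nat \<Rightarrow> item" where "item i \<equiv> items I ! i"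
abbreviation class' :: "nat \<Rightarrow> nat list" where "class' i \<equiv> class_of I (item i)"
abbreviation U :: real where "U \<equiv> of_int (resolution I)"
abbreviation m' :: "nat \<Rightarrow> real" where "m' i \<equiv> tail I (item i) 0 / U"
abbreviation r' :: "nat \<Rightarrow> nat \<Rightarrow> real" where "r' i \<equiv> ramps g (scaled_item (of_rat (capacity I)) (item i))"

text \<open>A light item keeps its mass \<open>m' i\<close>, because light masses are summed within
  their class before they are rounded; only heavy masses are replaced individually.\<close>

definition rounded :: "nat \<Rightarrow> (real \<Rightarrow>\<^sub>0 real)" where
  "rounded i = bern (if light I (item i) then m' i else magnitude (class' i)) (direction (class' i))"

lemma U_eq: "U = real D * of_int (unit I)" "0 < U"
proof -
  show "U = real D * of_int (unit I)" by (simp add: resolution_def)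
  show "0 < U" using resolution_pos[OF I] by simp
qed

lemma m'_bounds:
  assumes "i < length (items I)" shows "r' i 0 \<le> m' i" "0 \<le> m' i" "m' i \<le> 1"
    "m' i \<le> r' i 0 + length (item i) / U"
  using tail_bounds[OF I assms refl, of 0] U_eq by (auto simp: divide_le_eq)

lemma heavy_magnitude:
  assumes "i < length (items I)" "\<not> light I (item i)"
  shows "m' i \<le> magnitude (class' i)" "magnitude (class' i) \<le> m' i + 1 / H" "1 / D \<le> m' i"
proof -
  show "m' i \<le> magnitude (class' i)" "magnitude (class' i) \<le> m' i + 1 / H"
    using level_bounds[OF I assms(1) refl assms(2)] by (auto simp: magnitude_def class_of_def)
  have "real_of_int (unit I) \<le> tail I (item i) 0" using assms(2) by (simp add: light_def)
  then show "1 / D \<le> m' i" using U_eq D unit_pos[OF I] by (simp add: field_simps)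
qed

lemma rounded_prob: "i < length (items I) \<Longrightarrow> rounded i \<in> prob"
  using m'_bounds magnitude_bounds[OF class_of_in_classes[OF I _ refl]]
  unfolding rounded_def by (auto intro!: prob_bern direction_prob class_of_in_classes[OF I _ refl])

text \<open>All roundings go up, so one direction is free of error. In the other the three terms are
  due to the integer tails, to the digits of the direction, scaled by the mass, and to the level of
  a heavy item.\<close>

lemma rounded_le:
  assumes i: "i < length (items I)"
  shows "le_upto 0 (tails g (2 * g) (r' i)) (rounded i)"
    and "le_upto (length (item i) / U + m' i / G + (if light I (item i) then 0 else 1 / H))
      (rounded i) (tails g (2 * g) (r' i))" (is "le_upto ?e _ _")
proof -
  let ?b = "item i"
  define \<mu> where "\<mu> = (if light I ?b then m' i else magnitude (class' i))"
  define a where "a = (\<lambda>k. if k < 2 * g then real (class' i ! Suc k) / G else 0)"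
  have R: "rounded i = tails g (2 * g) (\<lambda>k. \<mu> * a k)"
    by (simp add: tails_scale rounded_def \<mu>_def direction_def a_def)
  note tb = tail_bounds[OF I i refl] and db = digit_bounds[OF I i refl]
  have t0: "0 < real_of_int (tail I ?b 0)" using tb(3)[of 0] by linarith
  have mu: "m' i \<le> \<mu>" "\<mu> \<le> m' i + (if light I ?b then 0 else 1 / H)"
    using heavy_magnitude[OF i] by (auto simp: \<mu>_def)
  have m: "0 \<le> m' i" using m'_bounds[OF i] by simp
  have k: "tail I ?b k / U \<le> \<mu> * a k \<and> \<mu> * a k \<le> tail I ?b k / U + m' i / G + (if light I ?b then 0 else 1 / H)"
    if "k < 2 * g" for k
  proof -
    have a: "a k = digit I ?b k / G" using that by (simp add: a_def class_of_def)
    have a1: "0 \<le> a k" "a k \<le> 1" using db(3)[of k] G by (auto simp: a divide_le_eq)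
    have lo: "real_of_int (tail I ?b k) / tail I ?b 0 \<le> a k"
      using db(1)[of k] G by (simp add: a le_divide_eq)
    have hi: "a k \<le> real_of_int (tail I ?b k) / tail I ?b 0 + 1 / G"
      using db(2)[of k] G by (simp add: a field_simps)
    have q: "m' i * (real_of_int (tail I ?b k) / tail I ?b 0) = tail I ?b k / U" using t0 by simp
    have "tail I ?b k / U \<le> m' i * a k" using mult_left_mono[OF lo m] q by simp
    also have "\<dots> \<le> \<mu> * a k" using mu(1) a1(1) by (rule mult_right_mono)
    finally have 1: "tail I ?b k / U \<le> \<mu> * a k" .
    have "\<mu> * a k \<le> (m' i + (if light I ?b then 0 else 1 / H)) * a k"
      using mu(2) a1 by (intro mult_right_mono)
    also have "\<dots> \<le> m' i * a k + (if light I ?b then 0 else 1 / H)"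
      using a1 by (auto simp: distrib_right divide_right_mono)
    also have "m' i * a k \<le> tail I ?b k / U + m' i / G"
      using mult_left_mono[OF hi m] q by (simp add: distrib_left)
    finally show ?thesis using 1 by simp
  qed
  show "le_upto 0 (tails g (2 * g) (r' i)) (rounded i)"
    unfolding R by (rule tails_le) (use k tb(1) order_trans in \<open>fastforce+\<close>)
  show "le_upto ?e (rounded i) (tails g (2 * g) (r' i))"
    unfolding R
  proof (rule tails_le)
    show "\<mu> * a k \<le> r' i k + ?e" if "k < 2 * g" for k
      using k[OF that] tb(2)[of k] by linarith
    have "0 \<le> m' i / G" by (intro divide_nonneg_nonneg m) simp
    moreover have "0 \<le> length (item i) / U" using U_eq(2) by (intro divide_nonneg_pos) auto
    ultimately show "0 \<le> ?e" by simp
  qed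
qed

section \<open>The items of a single bin and their configuration\<close>

context
  fixes B :: "nat set"
  assumes B: "B \<subseteq> {..<length (items I)}"
begin

abbreviation part :: "nat list \<Rightarrow> nat set" where "part t \<equiv> {i \<in> B. class' i = t}"

lemma finite_B: "finite B"
  using B finite_subset by blast

lemma B_less: "i \<in> B \<Longrightarrow> i < length (items I)"
  using B by auto

lemma class'_image: "class' ` B \<subseteq> classes"
  using class_of_in_classes[OF I _ refl] B_less by auto

lemma sum_part: "(\<Sum>t\<in>classes. \<Sum>i\<in>part t. f i) = (\<Sum>i\<in>B. f i)" for f :: "nat \<Rightarrow> real"
  by (rule sum.group[OF finite_B finite_classes class'_image])

lemma prod_part: "(\<Prod>t\<in>classes. \<Prod>i\<in>part t. f i) = (\<Prod>i\<in>B. f i)" for f :: "nat \<Rightarrow> (real \<Rightarrow>\<^sub>0 real)"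
  by (rule prod.group[OF finite_B finite_classes class'_image])

lemma elem_rounded:
  "le_upto (\<kappa> / (real g)\<^sup>2 * (\<Sum>i\<in>B. r' i 0)) (\<Prod>i\<in>B. elem I i) (\<Prod>i\<in>B. rounded i)"
proof -
  have "le_upto (\<Sum>i\<in>B. \<kappa> / (real g)\<^sup>2 * r' i 0 + 0) (\<Prod>i\<in>B. elem I i) (\<Prod>i\<in>B. rounded i)"
  proof (rule le_upto_prod[OF finite_B])
    fix i assume "i \<in> B"
    then have i: "i < length (items I)" by (rule B_less)
    show "elem I i \<in> prob" "rounded i \<in> prob" using i by (auto intro: elem_prob[OF I] rounded_prob)
    show "le_upto (\<kappa> / (real g)\<^sup>2 * r' i 0 + 0) (elem I i) (rounded i)"
      using item_elem_tails(1)[OF g scaled_item_nonneg[OF I i] scaled_item_sum[OF I i]] rounded_le(1)[OF i]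
      by (rule le_upto_trans) auto
  qed
  then show ?thesis by (simp add: sum_distrib_left)
qed

lemma rounded_elem:
  "le_upto ((\<Sum>i\<in>B. length (item i) / U + m' i / G + (if light I (item i) then 0 else 1 / H)) +
     \<kappa> / (real g)\<^sup>2 * (\<Sum>i\<in>B. r' i 0)) (\<Prod>i\<in>B. rounded i) (\<Prod>i\<in>B. elem I i)"
proof -
  have "le_upto (\<Sum>i\<in>B. (length (item i) / U + m' i / G + (if light I (item i) then 0 else 1 / H)) +
      \<kappa> / (real g)\<^sup>2 * r' i 0) (\<Prod>i\<in>B. rounded i) (\<Prod>i\<in>B. elem I i)"
  proof (rule le_upto_prod[OF finite_B])
    fix i assume "i \<in> B"
    then have i: "i < length (items I)" by (rule B_less)
    show "elem I i \<in> prob" "rounded i \<in> prob" using i by (auto intro: elem_prob[OF I] rounded_prob)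
    show "le_upto ((length (item i) / U + m' i / G + (if light I (item i) then 0 else 1 / H)) +
      \<kappa> / (real g)\<^sup>2 * r' i 0) (rounded i) (elem I i)"
      using rounded_le(2)[OF i] item_elem_tails(2)[OF g scaled_item_nonneg[OF I i] scaled_item_sum[OF I i]]
      by (rule le_upto_trans) auto
  qed
  then show ?thesis by (simp add: sum_distrib_left sum.distrib)
qed

lemma part_light: "i \<in> part t \<Longrightarrow> light I (item i) \<longleftrightarrow> hd t = 0"
  using light_iff[OF I B_less refl] by auto

lemma part_light_prod:
  assumes "hd t = 0"
  shows "(\<Prod>i\<in>part t. rounded i) =
    (\<Prod>i\<in>part t. bern (real (nat (weight I (item i))) * (1 / (real D * nat (unit I)))) (direction t))"
proof (rule prod.cong[OF refl])
  fix i assume i: "i \<in> part t"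
  have l: "light I (item i)" using part_light[OF i] assms by simp
  have "m' i = real (nat (weight I (item i))) * (1 / (real D * nat (unit I)))"
    using l weight_bounds(1)[OF I B_less refl, of i] i unit_pos[OF I] by (simp add: weight_def U_eq)
  then show "rounded i = bern (real (nat (weight I (item i))) * (1 / (real D * nat (unit I)))) (direction t)"
    using l i by (simp add: rounded_def)
qed

lemma part_heavy_prod:
  assumes "hd t \<noteq> 0"
  shows "(\<Prod>i\<in>part t. rounded i) = bern (magnitude t) (direction t) ^ card (part t)"
proof -
  have "(\<Prod>i\<in>part t. rounded i) = (\<Prod>i\<in>part t. bern (magnitude t) (direction t))"
    by (rule prod.cong[OF refl]) (use part_light assms in \<open>auto simp: rounded_def\<close>)
  then show ?thesis by simp
qed

lemma part_facts:
  assumes "t \<in> classes"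
  shows "finite (part t)" "direction t \<in> prob" "1 \<le> nat (unit I)" "1 \<le> D"
    "i \<in> part t \<Longrightarrow> nat (weight I (item i)) \<le> nat (unit I)"
  using finite_B direction_prob[OF assms] unit_pos[OF I] D weight_bounds[OF I B_less refl, of i] by auto

lemma nat_weight_sum: "int (\<Sum>i\<in>part t. nat (weight I (item i))) = (\<Sum>i\<in>part t. weight I (item i))"
proof -
  have "int (\<Sum>i\<in>part t. nat (weight I (item i))) = (\<Sum>i\<in>part t. int (nat (weight I (item i))))" by simp
  also have "\<dots> = (\<Sum>i\<in>part t. weight I (item i))"
  proof (rule sum.cong[OF refl])
    fix i assume "i \<in> part t"
    then show "int (nat (weight I (item i))) = weight I (item i)"
      using weight_bounds(1)[OF I B_less refl, of i] by auto
  qed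
  finally show ?thesis .
qed

text \<open>Applied to the bins of the output, with one light item in excess per class. Passing to
  \<open>rounded\<close> costs only the Lindeberg term; light classes are replaced by
  \<open>bern_upper\<close>, and a heavy class consists of at most \<open>cp t\<close> identical
  variables. All errors are governed by \<open>config_mass cp\<close>.\<close>

theorem config_upper:
  assumes fits: "\<And>t. t \<in> classes \<Longrightarrow>
      (if hd t = 0 then (\<Sum>i\<in>part t. weight I (item i)) \<le> (int (cp t) + 1) * unit I
       else card (part t) \<le> cp t)"
  shows "ga_ev \<phi> (\<Prod>i\<in>B. elem I i) \<le> ga_ev \<phi> (canonical cp) +
    (\<kappa> / (real g)\<^sup>2 * (config_mass cp + 1) + 2 * config_mass cp / D + 3 * card directions / D)"
proof -
  let ?\<eta> = "1 / real D"
  let ?e = "\<lambda>t. if hd t = 0 then 2 * (real (cp t) + 1) * ?\<eta>\<^sup>2 + ?\<eta> else 0"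
  have "le_upto (\<Sum>t\<in>classes. ?e t) (\<Prod>t\<in>classes. \<Prod>i\<in>part t. rounded i) (canonical cp)"
    unfolding canonical_def
  proof (rule le_upto_prod[OF finite_classes])
    fix t assume t: "t \<in> classes"
    show "(\<Prod>i\<in>part t. rounded i) \<in> prob" by (intro prob_prod rounded_prob B_less) auto
    show q: "bern (magnitude t) (direction t) ^ cp t \<in> prob"
      using magnitude_bounds[OF t] by (intro prob_power prob_bern direction_prob t) auto
    show "le_upto (?e t) (\<Prod>i\<in>part t. rounded i) (bern (magnitude t) (direction t) ^ cp t)"
    proof (cases "hd t = 0")
      case True
      have "int (\<Sum>i\<in>part t. nat (weight I (item i))) \<le> (int (cp t) + 1) * unit I"
        unfolding nat_weight_sum using fits[OF t] True by simp
      also have "\<dots> = int ((cp t + 1) * nat (unit I))"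
          using unit_pos[OF I] by (simp add: distrib_right)
      finally have *: "(\<Sum>i\<in>part t. nat (weight I (item i))) \<le> (cp t + 1) * nat (unit I)"
        by (simp only: of_nat_le_iff)
      show ?thesis
        using bern_upper[OF part_facts(1-4)[OF t] refl refl part_facts(5)[OF t] *] True
        by (simp add: part_light_prod magnitude_def)
    next
      case False
      then show ?thesis
        using fits[OF t] magnitude_bounds[OF t]
        by (auto simp: part_heavy_prod intro!: le_upto_power_mono prob_bern direction_prob t)
    qed
  qed
  from le_upto_trans[OF elem_rounded this[unfolded prod_part]]
  have 1: "ga_ev \<phi> (\<Prod>i\<in>B. elem I i) \<le> ga_ev \<phi> (canonical cp) +
      (\<kappa> / (real g)\<^sup>2 * (\<Sum>i\<in>B. r' i 0) + (\<Sum>t\<in>classes. ?e t))" by (rule le_uptoD)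
  have "(\<Sum>t\<in>classes. ?e t) \<le> (\<Sum>t\<in>classes. 2 * ?\<eta> * (cp t * magnitude t) + (if hd t = 0 then 3 * ?\<eta> else 0))"
  proof (rule sum_mono)
    fix t assume t: "t \<in> classes"
    have "2 * ?\<eta>\<^sup>2 \<le> 2 * ?\<eta>" using D by (simp add: power2_eq_square field_simps)
    moreover have "0 \<le> 2 * ?\<eta> * (cp t * magnitude t)"
      using magnitude_bounds[OF t] by (intro mult_nonneg_nonneg) auto
    moreover have "?e t = 2 * ?\<eta> * (cp t * magnitude t) + 2 * ?\<eta>\<^sup>2 + ?\<eta>" if "hd t = 0"
      using that by (simp add: magnitude_def power2_eq_square algebra_simps add_divide_distrib)
    ultimately show "?e t \<le> 2 * ?\<eta> * (cp t * magnitude t) + (if hd t = 0 then 3 * ?\<eta> else 0)"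
      by (cases "hd t = 0") auto
  qed
  also have "\<dots> = 2 * config_mass cp / D + 3 * card directions / D"
    by (simp add: sum.distrib light_classes_sum config_mass_def sum_distrib_left sum_divide_distrib mult.commute)
  finally have 2: "(\<Sum>t\<in>classes. ?e t) \<le> 2 * config_mass cp / D + 3 * card directions / D" .
  \<comment> \<open>The Lindeberg term needs the mass of the bin: at most the room of
    \<open>cp\<close> plus one unit of \<open>1/D\<close> for each light class.\<close>
  have "(\<Sum>i\<in>B. r' i 0) \<le> (\<Sum>i\<in>B. m' i)" by (intro sum_mono m'_bounds B_less)
  also have "\<dots> = (\<Sum>t\<in>classes. \<Sum>i\<in>part t. m' i)" by (simp add: sum_part)
  also have "\<dots> \<le> (\<Sum>t\<in>classes. cp t * magnitude t + (if hd t = 0 then ?\<eta> else 0))"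
  proof (rule sum_mono)
    fix t assume t: "t \<in> classes"
    show "(\<Sum>i\<in>part t. m' i) \<le> cp t * magnitude t + (if hd t = 0 then ?\<eta> else 0)"
    proof (cases "hd t = 0")
      case True
      have "(\<Sum>i\<in>part t. m' i) = (\<Sum>i\<in>part t. real_of_int (weight I (item i)) / U)"
        by (rule sum.cong[OF refl]) (use part_light True in \<open>auto simp: weight_def\<close>)
      also have "\<dots> = real_of_int (\<Sum>i\<in>part t. weight I (item i)) / U" by (simp add: sum_divide_distrib)
      also have "\<dots> \<le> real_of_int ((int (cp t) + 1) * unit I) / U"
        using fits[OF t] True U_eq by (intro divide_right_mono) (auto simp only: of_int_le_iff if_True)
      also have "\<dots> = (cp t + 1) * ?\<eta>" using unit_pos[OF I] D by (simp add: U_eq)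
      finally show ?thesis using True by (simp add: magnitude_def algebra_simps add_divide_distrib)
    next
      case False
      have "(\<Sum>i\<in>part t. m' i) \<le> (\<Sum>i\<in>part t. magnitude t)"
        by (rule sum_mono) (use heavy_magnitude(1)[OF B_less] part_light False in auto)
      also have "\<dots> \<le> cp t * magnitude t"
        using fits[OF t] False magnitude_bounds[OF t] by (simp add: mult_right_mono)
      finally show ?thesis using False by simp
    qed
  qed
  also have "\<dots> = config_mass cp + real (card directions) * ?\<eta>"
    by (simp add: sum.distrib light_classes_sum config_mass_def)
  also have "\<dots> \<le> config_mass cp + 1" using few_directions D by simp
  finally have "\<kappa> / (real g)\<^sup>2 * (\<Sum>i\<in>B. r' i 0) \<le> \<kappa> / (real g)\<^sup>2 * (config_mass cp + 1)"
    using kappa by (intro mult_left_mono) auto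
  with 1 2 show ?thesis by linarith
qed

text \<open>Applied to the bins of an optimal packing. The configuration is read off from the bin,
  and every error term is summed against the mass, at most \<open>M + 1\<close> after rounding. The
  extra 3 consists of 1 for the integer tails, 1 for the heavy levels and 1 for the light
  classes.\<close>

theorem config_lower:
  assumes mass: "(\<Sum>i\<in>B. r' i 0) \<le> M"
  shows "\<exists>cp. (\<forall>t. t \<notin> classes \<longrightarrow> cp t = 0) \<and> config_mass cp \<le> M + 3 \<and>
    (\<forall>t\<in>classes. (\<Sum>i\<in>part t. weight I (item i)) \<le> int (cp t) * unit I) \<and>
    ga_ev \<phi> (canonical cp) \<le> ga_ev \<phi> (\<Prod>i\<in>B. elem I i) +
      ((2 * M + 4 + card directions) / D + 1 / K + (M + 1) / G + (M + 1) * D / H + \<kappa> / (real g)\<^sup>2 * M)"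
proof -
  let ?\<eta> = "1 / real D" and ?N = "real (card directions)"
  let ?w = "\<lambda>t. \<Sum>i\<in>part t. weight I (item i)"
  let ?c = "\<lambda>t. nat \<lceil>real_of_int (?w t) / unit I\<rceil>"
  \<comment> \<open>Light weights are rounded up to whole units, heavy items are counted; the value
    0 elsewhere makes the set of configurations finite.\<close>
  define cp where "cp = (\<lambda>t. if t \<in> classes then (if hd t = 0 then ?c t else card (part t)) else 0)"
  have V: "0 < real_of_int (unit I)" using unit_pos[OF I] by simp
  have w0: "0 \<le> ?w t" for t
    using weight_bounds(1)[OF I B_less refl] by (intro sum_nonneg) force
  have c: "?w t \<le> int (?c t) * unit I" "int (?c t) * unit I \<le> ?w t + unit I" for t
  proof -
    have "0 \<le> real_of_int (?w t) / unit I" using w0 V by (simp add: divide_nonneg_pos del: of_int_sum)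
    then have "real_of_int (?w t) / unit I \<le> ?c t" "?c t \<le> real_of_int (?w t) / unit I + 1" by linarith+
    then have "real_of_int (?w t) \<le> ?c t * unit I" "?c t * real_of_int (unit I) \<le> real_of_int (?w t) + unit I"
      using V by (auto simp: field_simps simp del: of_int_sum)
    then have "real_of_int (?w t) \<le> real_of_int (int (?c t) * unit I)"
      "real_of_int (int (?c t) * unit I) \<le> real_of_int (?w t + unit I)" by (auto simp del: of_int_sum)
    then show "?w t \<le> int (?c t) * unit I" "int (?c t) * unit I \<le> ?w t + unit I"
      by (simp_all only: of_int_le_iff)
  qed
  \<comment> \<open>\<open>unit I\<close> was chosen as \<open>K\<close> times more than the number
    of all list entries of the instance.\<close>
  have lengths: "(\<Sum>i\<in>B. length (item i) / U) \<le> 1 / K"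
  proof -
    have "(\<Sum>i\<in>B. real (length (item i))) \<le> (\<Sum>i<length (items I). real (length (item i)))"
      by (rule sum_mono2) (use B in auto)
    also have "\<dots> = real_of_int (\<Sum>b\<leftarrow>items I. int (length b))"
      by (simp add: sum_list_sum_nth atLeast0LessThan)
    finally have "K * (\<Sum>i\<in>B. real (length (item i))) \<le> K * real_of_int ((\<Sum>b\<leftarrow>items I. int (length b)) + 1)"
      by (intro mult_left_mono) auto
    also have "\<dots> = real_of_int (unit I)" by (simp add: unit_def)
    also have "\<dots> \<le> U" using D V by (simp add: U_eq)
    finally show ?thesis using U_eq(2) K by (simp add: sum_divide_distrib[symmetric] field_simps)
  qed
  have m_sum: "(\<Sum>i\<in>B. m' i) \<le> M + 1"
  proof -
    have "(\<Sum>i\<in>B. m' i) \<le> (\<Sum>i\<in>B. r' i 0 + length (item i) / U)" by (intro sum_mono m'_bounds B_less)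
    also have "\<dots> \<le> M + 1 / K" using mass lengths by (simp add: sum.distrib)
    also have "1 / real K \<le> 1" using K by simp
    finally show ?thesis by simp
  qed
  \<comment> \<open>A heavy item has mass at least \<open>1/D\<close>, so its error
    \<open>1/H\<close> is at most \<open>D/H\<close> times its mass.\<close>
  have heavy: "(\<Sum>i\<in>B. if light I (item i) then 0 else 1 / real H) \<le> (M + 1) * D / H"
  proof -
    have "(\<Sum>i\<in>B. if light I (item i) then 0 else 1 / real H) \<le> (\<Sum>i\<in>B. m' i * (D / H))"
    proof (rule sum_mono)
      fix i assume "i \<in> B"
      then have i: "i < length (items I)" by (rule B_less)
      show "(if light I (item i) then 0 else 1 / real H) \<le> m' i * (D / H)"
      proof (cases "light I (item i)")
        case True
        have "0 \<le> m' i * (D / H)" by (intro mult_nonneg_nonneg m'_bounds(2)[OF i]) simp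
        with True show ?thesis by simp
      next
        case False
        have "1 \<le> m' i * D" using heavy_magnitude(3)[OF i False] D by (simp add: divide_le_eq)
        from divide_right_mono[OF this, of "real H"] False show ?thesis by simp
      qed
    qed
    also have "\<dots> = (\<Sum>i\<in>B. m' i) * (D / H)" by (rule sum_distrib_right[symmetric])
    also have "\<dots> \<le> (M + 1) * (D / H)" by (intro mult_right_mono m_sum) auto
    finally show ?thesis by simp
  qed
  have light_m: "real_of_int (?w t) / U = (\<Sum>i\<in>part t. m' i)" if "hd t = 0" for t
  proof -
    have "(\<Sum>i\<in>part t. m' i) = (\<Sum>i\<in>part t. real_of_int (weight I (item i)) / U)"
      by (rule sum.cong[OF refl]) (use part_light that in \<open>auto simp: weight_def\<close>)
    then show ?thesis by (simp add: sum_divide_distrib)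
  qed
  have mass_le: "config_mass cp \<le> M + 3"
  proof -
    have "config_mass cp \<le> (\<Sum>t\<in>classes. ((\<Sum>i\<in>part t. m' i) +
        (\<Sum>i\<in>part t. if light I (item i) then 0 else 1 / real H)) + (if hd t = 0 then ?\<eta> else 0))"
      unfolding config_mass_def
    proof (rule sum_mono)
      fix t assume t: "t \<in> classes"
      show "cp t * magnitude t \<le> ((\<Sum>i\<in>part t. m' i) +
        (\<Sum>i\<in>part t. if light I (item i) then 0 else 1 / real H)) + (if hd t = 0 then ?\<eta> else 0)"
      proof (cases "hd t = 0")
        case True
        define c0 where "c0 = ?c t"
        have "real_of_int (int c0 * unit I) / U \<le> real_of_int (?w t + unit I) / U"
          using c(2)[of t, folded c0_def] U_eq(2) by (intro divide_right_mono) (auto simp only: of_int_le_iff)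
        then have "c0 * ?\<eta> \<le> real_of_int (?w t) / U + ?\<eta>"
          using V D by (simp add: U_eq(1) add_divide_distrib del: of_int_sum)
        then have "cp t * magnitude t \<le> (\<Sum>i\<in>part t. m' i) + ?\<eta>"
        proof -
          have "cp t = c0" using t True unfolding cp_def c0_def by (simp only: if_True refl)
          then show ?thesis using \<open>c0 * ?\<eta> \<le> _\<close> light_m[OF True] True by (simp add: magnitude_def)
        qed
        moreover have "0 \<le> (\<Sum>i\<in>part t. if light I (item i) then 0 else 1 / real H)"
          by (intro sum_nonneg) auto
        ultimately show ?thesis using True by simp
      next
        case False
        have "cp t * magnitude t = (\<Sum>i\<in>part t. magnitude t)" using t False by (simp add: cp_def)
        also have "\<dots> \<le> (\<Sum>i\<in>part t. m' i + (if light I (item i) then 0 else 1 / real H))"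
        proof (rule sum_mono)
          fix i assume i: "i \<in> part t"
          then show "magnitude t \<le> m' i + (if light I (item i) then 0 else 1 / real H)"
            using heavy_magnitude(2)[OF B_less, of i] part_light[OF i] False by auto
        qed
        finally show ?thesis using False by (simp add: sum.distrib)
      qed
    qed
    also have "\<dots> = (\<Sum>i\<in>B. m' i) + (\<Sum>i\<in>B. if light I (item i) then 0 else 1 / real H) + ?N * ?\<eta>"
      by (simp only: sum.distrib sum_part light_classes_sum)
    also have "\<dots> \<le> (M + 1) + 1 + 1"
    proof (intro add_mono m_sum)
      show "(\<Sum>i\<in>B. if light I (item i) then 0 else 1 / real H) \<le> 1"
        using heavy levels H by (simp add: order_trans[OF heavy] divide_le_eq)
      show "?N * ?\<eta> \<le> 1" using few_directions D by simp
    qed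
    finally show ?thesis by simp
  qed
  have fits: "?w t \<le> int (cp t) * unit I" if "t \<in> classes" for t
  proof (cases "hd t = 0")
    case True
    then show ?thesis using c(1)[of t] that by (simp add: cp_def)
  next
    case False
    have "?w t = (\<Sum>i\<in>part t. unit I)"
      by (rule sum.cong[OF refl]) (use part_light False in \<open>auto simp: weight_def\<close>)
    then show ?thesis using that False by (simp add: cp_def)
  qed
  let ?e = "\<lambda>t. if hd t = 0 then ?\<eta> * (\<Sum>i\<in>part t. m' i) + cp t * ?\<eta>\<^sup>2 + ?\<eta> else 0"
  have "le_upto (\<Sum>t\<in>classes. ?e t) (canonical cp) (\<Prod>t\<in>classes. \<Prod>i\<in>part t. rounded i)"
    unfolding canonical_def
  proof (rule le_upto_prod[OF finite_classes])
    fix t assume t: "t \<in> classes"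
    show "(\<Prod>i\<in>part t. rounded i) \<in> prob" by (intro prob_prod rounded_prob B_less) auto
    show q: "bern (magnitude t) (direction t) ^ cp t \<in> prob"
      using magnitude_bounds[OF t] by (intro prob_power prob_bern direction_prob t) auto
    show "le_upto (?e t) (bern (magnitude t) (direction t) ^ cp t) (\<Prod>i\<in>part t. rounded i)"
    proof (cases "hd t = 0")
      case True
      have "int (cp t * nat (unit I)) = int (?c t) * unit I" using t True unit_pos[OF I] by (simp add: cp_def)
      also have "\<dots> \<le> int ((\<Sum>i\<in>part t. nat (weight I (item i))) + nat (unit I))"
        using c(2)[of t] unit_pos[OF I] by (simp only: of_nat_add nat_weight_sum)
      finally have *: "cp t * nat (unit I) \<le> (\<Sum>i\<in>part t. nat (weight I (item i))) + nat (unit I)"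
        by (simp only: of_nat_le_iff)
      have "(\<Sum>i\<in>part t. real (nat (weight I (item i))) * (1 / (real D * nat (unit I)))) = (\<Sum>i\<in>part t. m' i)"
      proof (rule sum.cong[OF refl])
        fix i assume i: "i \<in> part t"
        then show "real (nat (weight I (item i))) * (1 / (real D * nat (unit I))) = m' i"
          using part_light[OF i] True weight_bounds(1)[OF I B_less refl, of i] unit_pos[OF I]
          by (simp add: weight_def U_eq)
      qed
      then show ?thesis
        using bern_lower[OF part_facts(1-4)[OF t] refl refl part_facts(5)[OF t] *] True
        by (simp add: part_light_prod magnitude_def)
    next
      case False
      then show ?thesis using t by (simp add: part_heavy_prod cp_def le_upto_refl)
    qed
  qed
  from le_upto_trans[OF this[unfolded prod_part] rounded_elem]
  have 1: "ga_ev \<phi> (canonical cp) \<le> ga_ev \<phi> (\<Prod>i\<in>B. elem I i) + ((\<Sum>t\<in>classes. ?e t) +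
      ((\<Sum>i\<in>B. length (item i) / U + m' i / G + (if light I (item i) then 0 else 1 / H)) +
       \<kappa> / (real g)\<^sup>2 * (\<Sum>i\<in>B. r' i 0)))" by (rule le_uptoD)
  have "(\<Sum>t\<in>classes. ?e t) \<le> (\<Sum>t\<in>classes. ?\<eta> * (\<Sum>i\<in>part t. m' i) + ?\<eta> * (cp t * magnitude t) +
      (if hd t = 0 then ?\<eta> else 0))"
  proof (rule sum_mono)
    fix t assume t: "t \<in> classes"
    have "0 \<le> ?\<eta> * (\<Sum>i\<in>part t. m' i) + ?\<eta> * (cp t * magnitude t)"
      using magnitude_bounds[OF t] m'_bounds(2)[OF B_less]
      by (intro add_nonneg_nonneg mult_nonneg_nonneg sum_nonneg) auto
    then show "?e t \<le> ?\<eta> * (\<Sum>i\<in>part t. m' i) + ?\<eta> * (cp t * magnitude t) + (if hd t = 0 then ?\<eta> else 0)"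
      by (cases "hd t = 0") (simp add: magnitude_def power2_eq_square, simp)
  qed
  also have "\<dots> = ?\<eta> * (\<Sum>i\<in>B. m' i) + ?\<eta> * config_mass cp + ?N * ?\<eta>"
    by (simp only: sum.distrib sum_distrib_left[symmetric] sum_part light_classes_sum config_mass_def)
  also have "\<dots> \<le> ?\<eta> * (M + 1) + ?\<eta> * (M + 3) + ?N * ?\<eta>"
    using D by (intro add_mono mult_left_mono m_sum mass_le) auto
  also have "\<dots> = (2 * M + 4 + card directions) / D" using D by (simp add: field_simps)
  finally have 2: "(\<Sum>t\<in>classes. ?e t) \<le> (2 * M + 4 + card directions) / D" .
  have "(\<Sum>i\<in>B. m' i / G) \<le> (M + 1) / G"
    unfolding sum_divide_distrib[symmetric, where r = "real G"] by (intro divide_right_mono m_sum) simp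
  then have 3: "(\<Sum>i\<in>B. length (item i) / U + m' i / G + (if light I (item i) then 0 else 1 / H)) \<le>
      1 / K + (M + 1) / G + (M + 1) * D / H"
    using lengths heavy by (simp add: sum.distrib)
  have "\<kappa> / (real g)\<^sup>2 * (\<Sum>i\<in>B. r' i 0) \<le> \<kappa> / (real g)\<^sup>2 * M"
    using kappa by (intro mult_left_mono mass) auto
  with 1 2 3 have "ga_ev \<phi> (canonical cp) \<le> ga_ev \<phi> (\<Prod>i\<in>B. elem I i) +
      ((2 * M + 4 + card directions) / D + 1 / K + (M + 1) / G + (M + 1) * D / H + \<kappa> / (real g)\<^sup>2 * M)"
    by linarith
  then show ?thesis using mass_le fits by (intro exI[of _ cp]) (auto simp: cp_def)
qed

end

end

end

section \<open>Filling a list of bins\<close>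

definition class_weight :: "nat \<Rightarrow> (nat \<times> int) list \<Rightarrow> int" where
  "class_weight t xs = (\<Sum>(t', w)\<leftarrow>xs. if t' = t then w else 0)"

definition room :: "(nat \<Rightarrow> nat \<Rightarrow> nat) \<Rightarrow> nat \<Rightarrow> nat list \<Rightarrow> int" where
  "room cp t v = (\<Sum>z\<leftarrow>v. int (cp z t))"

text \<open>
  The items of a class are laid out on a line, the last one first, and so is the room of the bins.
  An item goes to the bin that contains its left end, so a bin receives at most one item in excess
  of its room. The last element of \<open>v\<close> is bin \<open>0\<close>; the result is \<open>length v\<close> if there is not enough
  room.
\<close>

definition bin_of :: "(nat \<Rightarrow> nat \<Rightarrow> nat) \<Rightarrow> int \<Rightarrow> nat list \<Rightarrow> nat \<Rightarrow> int \<Rightarrow> int" where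
  "bin_of cp V v t W = sum_list (map_rest (\<lambda>z r. of_bool (V * room cp t (z # r) \<le> W)) v)"

definition assign :: "(nat \<Rightarrow> nat \<Rightarrow> nat) \<Rightarrow> int \<Rightarrow> nat list \<Rightarrow> (nat \<times> int) list \<Rightarrow> nat list" where
  "assign cp V v = map_rest (\<lambda>(t, w) r. nat (bin_of cp V v t (class_weight t r)))"

lemma nth_map_rest: "i < length xs \<Longrightarrow> map_rest f xs ! i = f (xs ! i) (drop (Suc i) xs)"
  by (induction xs arbitrary: i) (auto simp: nth_Cons split: nat.split)

lemma room_simps [simp]: "room cp t [] = 0" "room cp t (z # v) = int (cp z t) + room cp t v"
  by (simp_all add: room_def)

lemma bin_of_simps [simp]: "bin_of cp V [] t W = 0"
    "bin_of cp V (z # v) t W = of_bool (V * room cp t (z # v) \<le> W) + bin_of cp V v t W"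
  by (simp_all add: bin_of_def)

lemma room_drop: "room cp t (drop k v) \<le> room cp t v"
proof (induction v arbitrary: k)
  case (Cons z v)
  show ?case
  proof (cases k)
    case (Suc k')
    then show ?thesis using Cons[of k'] by simp
  qed simp
qed simp

text \<open>\<open>room\<close> grows with the suffix, so the counted suffixes of \<open>v\<close>
  are exactly the shortest ones. \<open>drop m v\<close> is the longest suffix whose room ends at or
  before \<open>W\<close>, and \<open>drop (m - 1) v\<close> has one more bin and reaches
  beyond.\<close>

lemma bin_of_bounds:
  assumes "0 \<le> W" "0 \<le> V"
  shows "0 \<le> bin_of cp V v t W \<and> bin_of cp V v t W \<le> length v \<and>
    (bin_of cp V v t W = length v \<longrightarrow> V * room cp t v \<le> W) \<and>
    (bin_of cp V v t W < length v \<longrightarrow>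
      (let m = length v - nat (bin_of cp V v t W) in
        V * room cp t (drop m v) \<le> W \<and> W < V * room cp t (drop (m - 1) v)))"
proof (induction v)
  case Nil
  then show ?case using assms by simp
next
  case (Cons z v)
  have mono: "V * room cp t (drop k v) \<le> V * room cp t (z # v)" for k
    using room_drop[of cp t k v] assms(2) by (intro mult_left_mono) auto
  let ?j = "bin_of cp V v t W"
  show ?case
  proof (cases "V * room cp t (z # v) \<le> W")
    case True
    have "\<not> ?j < length v"
    proof
      assume "?j < length v"
      then have "W < V * room cp t (drop (length v - nat ?j - 1) v)" using Cons by (auto simp: Let_def)
      with mono True show False by (meson not_le order_trans)
    qed
    then show ?thesis using Cons True by simp
  next
    case False
    have j: "0 \<le> ?j" "?j \<le> length v" using Cons by auto
    have "V * room cp t (drop (length (z # v) - nat ?j) (z # v)) \<le> W \<and>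
       W < V * room cp t (drop (length (z # v) - nat ?j - 1) (z # v))"
    proof (cases "?j = length v")
      case True
      then show ?thesis using Cons False by simp
    next
      case ne: False
      then have "?j < length v" using j by simp
      then have "nat ?j < length v" using j by linarith
      then obtain k where k: "length v - nat ?j = Suc k" by (metis Suc_diff_Suc)
      then have k': "length (z # v) - nat ?j = Suc (Suc k)" using \<open>nat ?j < length v\<close> by simp
      have "V * room cp t (drop (length v - nat ?j) v) \<le> W"
        "W < V * room cp t (drop (length v - nat ?j - 1) v)" using Cons \<open>?j < length v\<close> by (auto simp: Let_def)
      then show ?thesis unfolding k k' by simp
    qed
    then show ?thesis using False j by (simp add: Let_def)
  qed
qed

lemma class_weight_simps [simp]: "class_weight t [] = 0"
    "class_weight t ((t', w) # xs) = (if t' = t then w else 0) + class_weight t xs"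
  by (simp_all add: class_weight_def)

lemma class_weight_append: "class_weight t (ys @ zs) = class_weight t ys + class_weight t zs"
  by (simp add: class_weight_def)

lemma class_weight_nonneg:
  "(\<And>t' w. (t', w) \<in> set xs \<Longrightarrow> 0 \<le> w) \<Longrightarrow> 0 \<le> class_weight t xs"
proof (induction xs)
  case (Cons x xs)
  obtain t' w where x: "x = (t', w)" by force
  have "0 \<le> class_weight t xs" by (rule Cons.IH, rule Cons.prems, rule list.set_intros(2))
  moreover have "0 \<le> w" using Cons.prems[of t' w] x by simp
  ultimately show ?case by (simp add: x)
qed simp

definition window :: "nat \<Rightarrow> int \<Rightarrow> int \<Rightarrow> (nat \<times> int) list \<Rightarrow> int" where
  "window t a b xs = sum_list (map_rest
     (\<lambda>(t', w) r. if t' = t \<and> a \<le> class_weight t r \<and> class_weight t r < b then w else 0) xs)"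

text \<open>The items of a class lie end to end, so an item that starts before \<open>b\<close> ends
  before \<open>b + V\<close>. The overshoot \<open>V\<close> is the one light item in
  excess.\<close>

lemma window_le:
  assumes "\<And>t' w. (t', w) \<in> set xs \<Longrightarrow> 0 \<le> w \<and> w \<le> V"
  shows "window t a b xs \<le> max 0 (min (class_weight t xs) (b + V) - a)"
  using assms
proof (induction xs)
  case (Cons x xs)
  obtain t' w where x: "x = (t', w)" by force
  have IH: "window t a b xs \<le> max 0 (min (class_weight t xs) (b + V) - a)"
    by (rule Cons.IH, rule Cons.prems, rule list.set_intros(2))
  have w: "0 \<le> w" "w \<le> V" using Cons.prems[of t' w] x by simp_all
  have "window t a b (x # xs) = (if t' = t \<and> a \<le> class_weight t xs \<and> class_weight t xs < b then w else 0)
      + window t a b xs" by (simp add: window_def x)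
  then show ?case using IH w by (simp add: x split: if_splits) linarith
qed (simp add: window_def)

text \<open>Here all item ends and bin boundaries are multiples of \<open>V\<close>, so an item that
  starts before a boundary ends no later than there and nothing overshoots. Divisibility is carried
  along in the induction.\<close>

lemma window_le_heavy:
  assumes "\<And>w. (t, w) \<in> set xs \<Longrightarrow> w = V" "0 < V"
  shows "window t (V * a) (V * b) xs \<le> max 0 (min (class_weight t xs) (V * b) - V * a) \<and> V dvd class_weight t xs"
  using assms
proof (induction xs)
  case (Cons x xs)
  obtain t' w where x: "x = (t', w)" by force
  have IH: "window t (V * a) (V * b) xs \<le> max 0 (min (class_weight t xs) (V * b) - V * a)"
      "V dvd class_weight t xs"
    using Cons.IH[OF _ assms(2)] Cons.prems by (simp_all add: x)
  have w: "w = V" if "t' = t" using Cons.prems(1)[of w] that x by simp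
  have 1: "window t (V * a) (V * b) (x # xs) =
      (if t' = t \<and> V * a \<le> class_weight t xs \<and> class_weight t xs < V * b then w else 0)
      + window t (V * a) (V * b) xs" by (simp add: window_def x)
  from IH(2) obtain k where k: "class_weight t xs = V * k" by blast
  have "V * k + V \<le> V * b" if "V * k < V * b"
  proof -
    have "k + 1 \<le> b" using that assms(2) by simp
    then have "V * (k + 1) \<le> V * b" using assms(2) by (intro mult_left_mono) auto
    then show ?thesis by (simp add: distrib_left)
  qed
  note step = this
  have arith: "(if c \<and> A \<le> W \<and> W < B then w else 0) + F \<le> max 0 (min ((if c then w else 0) + W) B - A)"
    if "F \<le> max 0 (min W B - A)" "W < B \<Longrightarrow> W + V \<le> B" "c \<Longrightarrow> w = V" for c F A B W
    using that assms(2) by (cases c; cases "A \<le> W"; cases "W < B"; simp; linarith)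
  have "window t (V * a) (V * b) (x # xs) \<le> max 0 (min (class_weight t (x # xs)) (V * b) - V * a)"
    unfolding 1[unfolded x] x class_weight_simps by (rule arith[OF IH(1)]) (use step k w in auto)
  moreover have "V dvd class_weight t (x # xs)" using IH(2) w by (simp add: x)
  ultimately show ?case ..
qed (simp add: window_def)

lemma sum_list_map_rest:
  "sum_list (map_rest f xs) = (\<Sum>i<length xs. f (xs ! i) (drop (Suc i) xs))" for f :: "'a \<Rightarrow> 'a list \<Rightarrow> int"
proof (induction xs)
  case (Cons x xs)
  have "(\<Sum>i<length (x # xs). f ((x # xs) ! i) (drop (Suc i) (x # xs))) =
      f x xs + (\<Sum>i<length xs. f (xs ! i) (drop (Suc i) xs))"
    by (simp only: list.size add_Suc_right add_0_right sum.lessThan_Suc_shift) simp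
  then show ?case using Cons by simp
qed simp

lemma length_assign [simp]: "length (assign cp V v xs) = length xs"
  by (simp add: assign_def)

context
  fixes cp :: "nat \<Rightarrow> nat \<Rightarrow> nat" and V :: int and v :: "nat list" and xs :: "(nat \<times> int) list"
  assumes V: "0 < V" and w: "\<And>t w. (t, w) \<in> set xs \<Longrightarrow> 0 < w \<and> w \<le> V"
begin

lemma class_weight_drop_nonneg: "0 \<le> class_weight t (drop k xs)"
  by (rule class_weight_nonneg) (use w set_drop_subset[of k xs] in fastforce)

lemma assign_nth: "i < length xs \<Longrightarrow>
    assign cp V v xs ! i = nat (bin_of cp V v (fst (xs ! i)) (class_weight (fst (xs ! i)) (drop (Suc i) xs)))"
  by (simp add: assign_def nth_map_rest case_prod_unfold)

lemma assign_window:
  assumes j: "j < length v"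
  shows "(\<Sum>i\<in>{i. i < length xs \<and> assign cp V v xs ! i = j \<and> fst (xs ! i) = t}. snd (xs ! i)) \<le>
    window t (V * room cp t (drop (length v - j) v)) (V * room cp t (drop (length v - j - 1) v)) xs"
    (is "_ \<le> window t ?a ?b xs")
proof -
  have "(\<Sum>i\<in>{i. i < length xs \<and> assign cp V v xs ! i = j \<and> fst (xs ! i) = t}. snd (xs ! i)) =
      (\<Sum>i<length xs. if assign cp V v xs ! i = j \<and> fst (xs ! i) = t then snd (xs ! i) else 0)"
    by (subst sum.inter_filter[symmetric]) (auto intro: sum.cong)
  also have "\<dots> \<le> (\<Sum>i<length xs. if fst (xs ! i) = t \<and> ?a \<le> class_weight t (drop (Suc i) xs) \<and>
      class_weight t (drop (Suc i) xs) < ?b then snd (xs ! i) else 0)"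
  proof (rule sum_mono)
    fix i assume i: "i \<in> {..<length xs}"
    have sn: "0 \<le> snd (xs ! i)" using w[of "fst (xs ! i)" "snd (xs ! i)"] i by simp
    let ?W = "class_weight t (drop (Suc i) xs)"
    have "?a \<le> ?W \<and> ?W < ?b" if "assign cp V v xs ! i = j" "fst (xs ! i) = t"
    proof -
      have bb: "nat (bin_of cp V v t ?W) = j" using assign_nth that i by simp
      note * = bin_of_bounds[of ?W V cp v t, OF class_weight_drop_nonneg less_imp_le[OF V]]
      have "bin_of cp V v t ?W < length v" using bb j by linarith
      then show ?thesis using * bb by (auto simp: Let_def)
    qed
    then show "(if assign cp V v xs ! i = j \<and> fst (xs ! i) = t then snd (xs ! i) else 0) \<le>
      (if fst (xs ! i) = t \<and> ?a \<le> ?W \<and> ?W < ?b then snd (xs ! i) else 0)" using sn by auto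
  qed
  also have "\<dots> = window t ?a ?b xs"
    by (simp add: window_def sum_list_map_rest case_prod_unfold)
  finally show ?thesis .
qed

lemma room_bin:
  assumes "j < length v"
  shows "room cp t (drop (length v - j - 1) v) =
    int (cp (v ! (length v - j - 1)) t) + room cp t (drop (length v - j) v)"
proof -
  have "drop (length v - j - 1) v = v ! (length v - j - 1) # drop (Suc (length v - j - 1)) v"
    using assms by (intro Cons_nth_drop_Suc[symmetric]) simp
  moreover have "Suc (length v - j - 1) = length v - j" using assms by simp
  ultimately show ?thesis by simp
qed

lemma assign_light:
  assumes j: "j < length v"
  shows "(\<Sum>i\<in>{i. i < length xs \<and> assign cp V v xs ! i = j \<and> fst (xs ! i) = t}. snd (xs ! i)) \<le>
    (int (cp (v ! (length v - j - 1)) t) + 1) * V"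
proof -
  let ?a = "V * room cp t (drop (length v - j) v)" and ?b = "V * room cp t (drop (length v - j - 1) v)"
  have "window t ?a ?b xs \<le> max 0 (min (class_weight t xs) (?b + V) - ?a)"
    by (rule window_le) (use w in force)
  also have "\<dots> \<le> max 0 ((?b + V) - ?a)" by linarith
  also have "\<dots> = (int (cp (v ! (length v - j - 1)) t) + 1) * V"
    using V unfolding room_bin[OF j] by (simp add: algebra_simps max_def)
  finally show ?thesis using assign_window[OF j, of t] by linarith
qed

lemma assign_heavy:
  assumes j: "j < length v" and h: "\<And>w. (t, w) \<in> set xs \<Longrightarrow> w = V"
  shows "card {i. i < length xs \<and> assign cp V v xs ! i = j \<and> fst (xs ! i) = t} \<le> cp (v ! (length v - j - 1)) t"
proof -
  let ?S = "{i. i < length xs \<and> assign cp V v xs ! i = j \<and> fst (xs ! i) = t}"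
  let ?a = "V * room cp t (drop (length v - j) v)" and ?b = "V * room cp t (drop (length v - j - 1) v)"
  have "(\<Sum>i\<in>?S. snd (xs ! i)) = (\<Sum>i\<in>?S. V)"
    by (intro sum.cong refl h) (metis (mono_tags, lifting) mem_Collect_eq nth_mem prod.collapse)
  then have "int (card ?S) * V = (\<Sum>i\<in>?S. snd (xs ! i))" by simp
  also have "\<dots> \<le> window t ?a ?b xs" by (rule assign_window[OF j])
  also have "\<dots> \<le> max 0 (min (class_weight t xs) ?b - ?a)"
    using window_le_heavy[of t xs V, OF h V] by blast
  also have "\<dots> \<le> max 0 (?b - ?a)" by linarith
  also have "\<dots> = int (cp (v ! (length v - j - 1)) t) * V"
    using V unfolding room_bin[OF j] by (simp add: algebra_simps)
  finally show ?thesis using V by simp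
qed

text \<open>Since weights are positive, the left end of an item lies strictly below the weight of
  its class and thus strictly inside the room of the bins.\<close>

lemma assign_success:
  assumes "\<And>t. class_weight t xs \<le> V * room cp t v" and j: "j \<in> set (assign cp V v xs)"
  shows "j < length v"
proof -
  from j obtain i where i: "i < length xs" "assign cp V v xs ! i = j" by (metis in_set_conv_nth length_assign)
  let ?t = "fst (xs ! i)"
  let ?W = "class_weight ?t (drop (Suc i) xs)"
  have jb: "j = nat (bin_of cp V v ?t ?W)" using assign_nth i by simp
  note * = bin_of_bounds[of ?W V cp v ?t, OF class_weight_drop_nonneg less_imp_le[OF V]]
  have "class_weight ?t xs = class_weight ?t (take i xs) + (snd (xs ! i) + ?W)"
  proof -
    have "class_weight ?t xs = class_weight ?t (take i xs) + class_weight ?t (drop i xs)"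
      by (simp flip: class_weight_append)
    also have "drop i xs = (?t, snd (xs ! i)) # drop (Suc i) xs"
      using i(1) by (simp add: Cons_nth_drop_Suc)
    finally show ?thesis by (simp only: class_weight_simps if_True refl)
  qed
  moreover have "0 \<le> class_weight ?t (take i xs)"
    by (rule class_weight_nonneg) (use w set_take_subset[of i xs] in fastforce)
  moreover have "0 < snd (xs ! i)" using w[of ?t "snd (xs ! i)"] i(1) by simp
  ultimately have "?W < V * room cp ?t v" using assms(1)[of ?t] by linarith
  then have "bin_of cp V v ?t ?W \<noteq> length v" using * by auto
  then show ?thesis using * jb by linarith
qed

end

text \<open>The list \<open>ys\<close> serves as a unary counter: each configuration gets a block of
  fewer than \<open>length ys\<close> copies. That makes \<open>length ys ^ length zs\<close>
  candidates, polynomially many for fixed \<open>zs\<close>. The reversals fit the accumulating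
  loops, and the order of the candidates is immaterial.\<close>

fun candidates :: "nat list \<Rightarrow> 'x list \<Rightarrow> nat list list" where
  "candidates [] ys = [[]]"
| "candidates (z # zs) ys =
     rev (concat (map (\<lambda>v. map_rest (\<lambda>y r. rev (map (\<lambda>_. z) r) @ v) ys) (candidates zs ys)))"

lemma set_map_rest_replicate:
  "set (map_rest (\<lambda>y r. rev (map (\<lambda>_. z) r) @ v) ys) = {replicate k z @ v | k. k < length ys}"
proof (induction ys)
  case (Cons y ys)
  have "rev (map (\<lambda>_. z) ys) = replicate (length ys) z" by (simp add: map_replicate_const rev_replicate)
  then show ?case using Cons by (auto simp: less_Suc_eq)
qed simp

lemma candidates_iff:
  "v \<in> set (candidates zs ys) \<longleftrightarrow>
     (zs = [] \<and> v = []) \<or> (\<exists>z zs' k v'. zs = z # zs' \<and> v = replicate k z @ v' \<and> k < length ys \<and>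
        v' \<in> set (candidates zs' ys))"
  by (cases zs) (auto simp: set_map_rest_replicate)

lemma candidates_subset: "v \<in> set (candidates zs ys) \<Longrightarrow> set v \<subseteq> set zs"
proof (induction zs arbitrary: v)
  case (Cons z zs)
  then obtain k v' where "v = replicate k z @ v'" "v' \<in> set (candidates zs ys)"
    unfolding candidates_iff[of v "z # zs"] by auto
  then show ?case using Cons.IH[of v'] by auto
qed simp

lemma candidates_complete:
  "(\<And>z. k z < length ys) \<Longrightarrow> concat (map (\<lambda>z. replicate (k z) z) zs) \<in> set (candidates zs ys)"
proof (induction zs)
  case (Cons z zs)
  then show ?case unfolding candidates_iff[of _ "z # zs"] by auto
qed simp

definition bad :: "nat list \<Rightarrow> nat list \<Rightarrow> int" where
  "bad v f = (\<Sum>j\<leftarrow>f. of_bool (length v \<le> j))"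

text \<open>A misplaced item costs more than \<open>length xs\<close> bins, and the optimum is at most that.\<close>

definition trial :: "(nat \<Rightarrow> nat \<Rightarrow> nat) \<Rightarrow> int \<Rightarrow> (nat \<times> int) list \<Rightarrow> nat list \<Rightarrow> int \<times> nat list" where
  "trial cp V xs v = (int (length v) + bad v (assign cp V v xs) * (int (length xs) + 1), assign cp V v xs)"

text \<open>The dummy entry \<open>(0, 0)\<close> admits multiplicities up to
  \<open>length xs\<close>. The initial key \<open>length xs + 1\<close> loses against every success
  with at most \<open>length xs\<close> bins.\<close>

definition pack :: "(nat \<Rightarrow> nat \<Rightarrow> nat) \<Rightarrow> nat list \<Rightarrow> int \<Rightarrow> (nat \<times> int) list \<Rightarrow> nat list" where
  "pack cp zs V xs = snd (tfold (\<lambda>y x r. if fst x \<le> fst y then x else y) (int (length xs) + 1, [])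
     (map (trial cp V xs) (candidates zs ((0, 0) # xs))))"

lemma tfold_min:
  fixes y :: "int \<times> 'b"
  shows "(let m = tfold (\<lambda>y x r. if fst x \<le> fst y then x else y) y xs in
    (m = y \<or> m \<in> set xs) \<and> fst m \<le> fst y \<and> (\<forall>x\<in>set xs. fst m \<le> fst x))"
proof (induction xs arbitrary: y)
  case (Cons x xs)
  show ?case using Cons[of x] Cons[of y] by (auto simp: Let_def)
qed simp

lemma bad_nonneg: "0 \<le> bad v f"
  unfolding bad_def by (intro sum_list_nonneg) auto

lemma bad_eq_0_iff: "bad v f = 0 \<longleftrightarrow> (\<forall>j\<in>set f. j < length v)"
proof -
  have "bad v f = 0 \<longleftrightarrow> (\<forall>x\<in>set (map (\<lambda>j. of_bool (length v \<le> j)) f). x = (0::int))"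
    unfolding bad_def by (rule sum_list_nonneg_eq_0_iff) auto
  then show ?thesis by (auto simp: not_le)
qed

text \<open>The minimal key is at most \<open>length v0\<close>, hence less than the price of a
  single misplaced item. The winner \<open>v\<close> may differ from \<open>v0\<close>, but it
  consists of configurations from \<open>zs\<close> as well.\<close>

theorem pack_correct:
  assumes v0: "v0 \<in> set (candidates zs ((0, 0) # xs))" "length v0 \<le> length xs"
    and ok: "\<And>j. j \<in> set (assign cp V v0 xs) \<Longrightarrow> j < length v0"
  shows "\<exists>v. set v \<subseteq> set zs \<and> length v \<le> length v0 \<and> pack cp zs V xs = assign cp V v xs \<and>
    (\<forall>j\<in>set (assign cp V v xs). j < length v)"
proof -
  let ?vs = "candidates zs ((0, 0) # xs)"
  define m where "m = tfold (\<lambda>y x r. if fst x \<le> fst y then x else y) (int (length xs) + 1, [])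
      (map (trial cp V xs) ?vs)"
  have m: "m = (int (length xs) + 1, []) \<or> m \<in> set (map (trial cp V xs) ?vs)"
     "\<forall>x\<in>set (map (trial cp V xs) ?vs). fst m \<le> fst x"
    using tfold_min[of "(int (length xs) + 1, [])" "map (trial cp V xs) ?vs"]
    unfolding m_def Let_def by blast+
  have "bad v0 (assign cp V v0 xs) = 0" using ok by (simp add: bad_eq_0_iff)
  then have "fst (trial cp V xs v0) = length v0" by (simp add: trial_def)
  moreover have "trial cp V xs v0 \<in> set (map (trial cp V xs) ?vs)" using v0 by simp
  ultimately have le: "fst m \<le> length v0" using m(2) by metis
  then have "m \<noteq> (int (length xs) + 1, [])" using v0(2) by auto
  then obtain v where v: "v \<in> set ?vs" "m = trial cp V xs v" using m(1) by auto
  let ?n = "int (length xs) + 1" and ?b = "bad v (assign cp V v xs)"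
  have f: "int (length v) + ?b * ?n \<le> length v0" using le v(2) by (simp add: trial_def)
  have b: "?b = 0"
  proof (rule ccontr)
    assume "?b \<noteq> 0"
    then have "1 \<le> ?b" using bad_nonneg[of v "assign cp V v xs"] by linarith
    from mult_right_mono[OF this, of ?n] have "?n \<le> ?b * ?n" by simp
    with f have "int (length v) + ?n \<le> length v0" by (rule order_trans[OF add_left_mono, rotated])
    then show False using v0(2) by linarith
  qed
  have "pack cp zs V xs = assign cp V v xs" using v(2) by (simp add: pack_def trial_def flip: m_def)
  moreover have "length v \<le> length v0" using f b by simp
  ultimately show ?thesis using b candidates_subset[OF v(1)] by (auto simp: bad_eq_0_iff)
qed

section \<open>The packing is computable in polynomial time\<close>

lemma poly_time_pair_fst:
  assumes "poly_time A e f" "\<And>p. p \<in> B \<Longrightarrow> fst p \<in> A"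
  shows "poly_time B (enc_pair e enc) (\<lambda>p. f (fst p))"
proof -
  have "poly_time B (enc_pair e enc) (\<lambda>p. left (enc_pair e enc p))"
    by (intro poly_time_left poly_time_id)
  then have "poly_time B (enc_pair e enc) (\<lambda>p. e (fst p))"
    by (rule poly_time_cong) (auto simp: enc_pair_def)
  then show ?thesis by (rule poly_time_comp[OF _ assms(2,1)])
qed

lemma poly_time_pair_snd: "poly_time B (enc_pair e enc) (\<lambda>p. enc (snd p))"
proof -
  have "poly_time B (enc_pair e enc) (\<lambda>p. right (enc_pair e enc p))"
    by (intro poly_time_right poly_time_id)
  then show ?thesis by (rule poly_time_cong) (auto simp: enc_pair_def)
qed

lemma poly_time_rest_fst:
  assumes "poly_time A e f"
  shows "poly_time (rests A xs) (enc_rest e enc) (\<lambda>p. f (fst p))"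
proof -
  have "poly_time (rests A xs) (enc_rest e enc) (\<lambda>p. left (enc_rest e enc p))"
    by (intro poly_time_left poly_time_id)
  then have "poly_time (rests A xs) (enc_rest e enc) (\<lambda>p. e (fst p))"
    by (rule poly_time_cong) (auto simp: enc_rest_def)
  then show ?thesis by (rule poly_time_comp[OF _ _ assms]) (auto simp: rests_def)
qed

lemma poly_time_rest_head: "poly_time (rests A xs) (enc_rest e enc) (\<lambda>p. enc (fst (snd p)))"
proof -
  have "poly_time (rests A xs) (enc_rest e enc) (\<lambda>p. left (right (enc_rest e enc p)))"
    by (intro poly_time_left poly_time_right poly_time_id)
  then show ?thesis by (rule poly_time_cong) (auto simp: enc_rest_def)
qed

lemma poly_time_rest_tail:
  "poly_time (rests A xs) (enc_rest e enc) (\<lambda>p. encode_list enc (snd (snd p)))"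
proof -
  have "poly_time (rests A xs) (enc_rest e enc) (\<lambda>p. right (right (enc_rest e enc p)))"
    by (intro poly_time_right poly_time_id)
  then show ?thesis by (rule poly_time_cong) (auto simp: enc_rest_def)
qed

definition encode_entry :: "rat \<times> rat \<Rightarrow> data" where
  "encode_entry = (\<lambda>(x, q). Node (encode_rat x) (encode_rat q))"

lemma encode_item_eq: "encode_item = encode_list encode_entry"
  by (simp add: encode_item_def encode_entry_def)

lemma left_encode_rat: "left (encode_rat r) = Atom (fst (quotient_of r))"
  and right_encode_rat: "right (encode_rat r) = Atom (snd (quotient_of r))"
  by (simp_all add: encode_rat_def case_prod_unfold)

lemma poly_time_nat:
  assumes "poly_time A e (\<lambda>a. Atom (f a))"
  shows "poly_time A e (\<lambda>a. Atom (int (nat (f a))))"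
  using poly_time_max[OF assms poly_time_const[of A e "Atom 0"]] by (simp add: max_def)
    (rule poly_time_cong, assumption, auto)

lemma poly_time_uminus:
  assumes "poly_time A e (\<lambda>a. Atom (f a))"
  shows "poly_time A e (\<lambda>a. Atom (- f a))"
  using poly_time_diff[OF poly_time_const[of A e "Atom 0"] assms] by simp

abbreviation instances :: "sbp set" where "instances \<equiv> {I. sbp_instance I}"

text \<open>The machine has integers only. Everything is brought to the positive denominator
  \<open>d q * den\<close>, and the floor of the fraction is \<open>div\<close>.\<close>

lemma floor_entry:
  fixes x q C :: rat and U :: int and g k :: nat
  assumes C: "0 < C"
  defines "n \<equiv> \<lambda>r. fst (quotient_of r)" and "d \<equiv> \<lambda>r. snd (quotient_of r)"
  defines "den \<equiv> d x * n C"
  defines "num \<equiv> n x * d C * int g - int k * den"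
  shows "\<lfloor>of_int U * q * max 0 (min 1 (of_nat g * x / C - of_nat k))\<rfloor> =
    (U * n q * max 0 (min den num)) div (d q * den)"
proof -
  have d: "0 < d r" for r
    using quotient_of_denom_pos[of r "n r" "d r"] by (simp add: n_def d_def)
  have r: "of_int (n r) / of_int (d r) = r" for r
    using quotient_of_div[of r "n r" "d r"] by (simp add: n_def d_def)
  have n: "of_int (n r) = r * of_int (d r)" for r
    using r[of r] d[of r] by (simp add: divide_eq_eq)
  have "0 < of_int (n C) / (of_int (d C) :: rat)" using C by (simp add: r)
  then have nC: "0 < n C" using d[of C] by (simp add: zero_less_divide_iff)
  have den: "0 < den" using nC d[of x] by (simp add: den_def)
  have "of_nat g * x / C - of_nat k = of_int num / of_int den"
  proof -
    have "of_nat g * x / C = of_nat g * (of_int (n x) / of_int (d x)) / (of_int (n C) / of_int (d C))"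
      by (simp only: r)
    then show ?thesis
      using d[of x] d[of C] nC by (simp add: num_def den_def field_simps)
  qed
  also have "max 0 (min 1 (of_int num / of_int den)) = of_int (max 0 (min den num)) / (of_int den :: rat)"
    using den by (auto simp: max_def min_def field_simps)
  finally have "of_int U * q * max 0 (min 1 (of_nat g * x / C - of_nat k)) =
      of_int (U * n q * max 0 (min den num)) / of_int (d q * den)"
    using d[of q] by (simp add: n[of q])
  then show ?thesis by (simp only: floor_divide_of_int_eq)
qed

section \<open>Classes and weights of the items of an instance\<close>

definition encode_class :: "nat \<times> int \<Rightarrow> data" where
  "encode_class = (\<lambda>(t, w). Node (Atom (int t)) (Atom w))"

context grid
begin

definition classified :: "sbp \<Rightarrow> (nat \<times> int) list" where
  "classified I = map (\<lambda>b. (to_nat (class_of I b), weight I b)) (items I)"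

definition item_env :: "(sbp \<times> item) set" where
  "item_env = {(I, b). I \<in> instances \<and> b \<in> set (items I)}"

abbreviation enc_item_env :: "sbp \<times> item \<Rightarrow> data" where
  "enc_item_env \<equiv> enc_pair encode_sbp encode_item"

lemma item_envD:
  assumes "(I, b) \<in> item_env"
  obtains i where "sbp_instance I" "i < length (items I)" "b = items I ! i"
  using assms by (auto simp: item_env_def in_set_conv_nth)

lemma poly_time_items: "poly_time instances encode_sbp (\<lambda>I. encode_list encode_item (items I))"
  using poly_time_left[OF poly_time_id[of instances encode_sbp]] by (simp add: encode_sbp_def)

lemma poly_time_capacity: "poly_time instances encode_sbp (\<lambda>I. encode_rat (capacity I))"
  using poly_time_left[OF poly_time_right[OF poly_time_id[of instances encode_sbp]]] by (simp add: encode_sbp_def)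

lemma poly_time_overflow_prob: "poly_time instances encode_sbp (\<lambda>I. encode_rat (overflow_prob I))"
  using poly_time_right[OF poly_time_right[OF poly_time_id[of instances encode_sbp]]] by (simp add: encode_sbp_def)

lemma poly_time_unit: "poly_time instances encode_sbp (\<lambda>I. Atom (unit I))"
proof -
  have "poly_time item_env enc_item_env (\<lambda>p. Atom (int (length (snd p))))"
    by (rule poly_time_length[where enc = encode_entry])
      (use poly_time_pair_snd in \<open>simp add: encode_item_eq[symmetric]\<close>)
  then have "poly_time instances encode_sbp (\<lambda>I. Atom (\<Sum>b\<leftarrow>items I. int (length b)))"
    by (intro poly_time_sum[OF poly_time_items]) (simp add: case_prod_unfold item_env_def)
  then show ?thesis unfolding unit_def
    by (intro poly_time_mult poly_time_add poly_time_const)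
qed

lemma poly_time_resolution: "poly_time instances encode_sbp (\<lambda>I. Atom (resolution I))"
  unfolding resolution_def by (intro poly_time_mult poly_time_unit poly_time_const)

lemma poly_time_of_instance:
  "poly_time instances encode_sbp f \<Longrightarrow> poly_time item_env enc_item_env (\<lambda>p. f (fst p))"
  by (rule poly_time_pair_fst) (auto simp: item_env_def)

lemma poly_time_tail: "poly_time item_env enc_item_env (\<lambda>p. Atom (tail (fst p) (snd p) k))"
proof -
  let ?B = "{(p, z). p \<in> item_env \<and> z \<in> set (snd p)}"
  let ?e = "enc_pair enc_item_env encode_entry"
  let ?n = "\<lambda>r. fst (quotient_of r)" and ?d = "\<lambda>r. snd (quotient_of r)"
  have ent: "poly_time ?B ?e (\<lambda>z. encode_entry (snd z))" by (rule poly_time_pair_snd)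
  have x: "poly_time ?B ?e (\<lambda>z. encode_rat (fst (snd z)))"
    using poly_time_left[OF ent] by (simp add: encode_entry_def case_prod_unfold)
  have q: "poly_time ?B ?e (\<lambda>z. encode_rat (snd (snd z)))"
    using poly_time_right[OF ent] by (simp add: encode_entry_def case_prod_unfold)
  have c: "poly_time ?B ?e (\<lambda>z. encode_rat (capacity (fst (fst z))))"
    by (rule poly_time_pair_fst[OF poly_time_of_instance[OF poly_time_capacity]]) auto
  have U: "poly_time ?B ?e (\<lambda>z. Atom (resolution (fst (fst z))))"
    by (rule poly_time_pair_fst[OF poly_time_of_instance[OF poly_time_resolution]]) auto
  note parts = poly_time_left[OF x, unfolded left_encode_rat] poly_time_right[OF x, unfolded right_encode_rat]
    poly_time_left[OF q, unfolded left_encode_rat] poly_time_right[OF q, unfolded right_encode_rat]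
    poly_time_left[OF c, unfolded left_encode_rat] poly_time_right[OF c, unfolded right_encode_rat] U
  define den where "den = (\<lambda>z :: (sbp \<times> item) \<times> rat \<times> rat. ?d (fst (snd z)) * ?n (capacity (fst (fst z))))"
  define num where "num = (\<lambda>z :: (sbp \<times> item) \<times> rat \<times> rat. ?n (fst (snd z)) * ?d (capacity (fst (fst z))) * int g - int k * den z)"
  have den: "poly_time ?B ?e (\<lambda>z. Atom (den z))" unfolding den_def by (intro poly_time_mult parts)
  have num: "poly_time ?B ?e (\<lambda>z. Atom (num z))" unfolding num_def
    by (intro poly_time_diff poly_time_mult parts den poly_time_const)
  have "poly_time ?B ?e (\<lambda>z. Atom ((resolution (fst (fst z)) * ?n (snd (snd z)) * max 0 (min (den z) (num z))) div
      (?d (snd (snd z)) * den z) + 1))"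
    by (intro poly_time_add poly_time_div poly_time_mult poly_time_max poly_time_min parts num den poly_time_const)
  then have t: "poly_time ?B ?e (\<lambda>(p, x, q). Atom (\<lfloor>of_int (resolution (fst p)) * q *
      max 0 (min 1 (of_nat g * x / capacity (fst p) - of_nat k))\<rfloor> + 1))"
  proof (rule poly_time_cong)
    fix z assume "z \<in> ?B"
    then obtain I b x q where z: "z = ((I, b), x, q)" "sbp_instance I" by (auto simp: item_env_def)
    then have "0 < capacity I" by (simp add: sbp_instance_def)
    from floor_entry[OF this, where k = k]
    show "Atom ((resolution (fst (fst z)) * ?n (snd (snd z)) * max 0 (min (den z) (num z))) div
      (?d (snd (snd z)) * den z) + 1) = (case z of (p, x, q) \<Rightarrow> Atom (\<lfloor>of_int (resolution (fst p)) * q *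
      max 0 (min 1 (of_nat g * x / capacity (fst p) - of_nat k))\<rfloor> + 1))"
      by (simp add: z(1) den_def num_def)
  qed
  have b: "poly_time item_env enc_item_env (\<lambda>p. encode_list encode_entry (snd p))"
    using poly_time_pair_snd[of item_env encode_sbp encode_item] by (simp add: encode_item_eq)
  have "poly_time item_env enc_item_env (\<lambda>p. Atom (\<Sum>(x, q)\<leftarrow>snd p. \<lfloor>of_int (resolution (fst p)) * q *
      max 0 (min 1 (of_nat g * x / capacity (fst p) - of_nat k))\<rfloor> + 1))"
    by (rule poly_time_sum[OF b]) (use t in \<open>simp add: case_prod_unfold\<close>)
  then show ?thesis unfolding tail_def
    by (intro poly_time_min poly_time_of_instance[OF poly_time_resolution])
qed

lemma poly_time_light: "poly_time item_env enc_item_env (\<lambda>p. Atom (of_bool (light (fst p) (snd p))))"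
  unfolding light_def by (intro poly_time_leq poly_time_tail poly_time_of_instance[OF poly_time_unit])

lemma poly_time_digit: "poly_time item_env enc_item_env (\<lambda>p. Atom (int (digit (fst p) (snd p) k)))"
  unfolding digit_def
  by (intro poly_time_nat poly_time_uminus poly_time_div poly_time_mult poly_time_tail poly_time_const)

lemma poly_time_level: "poly_time item_env enc_item_env (\<lambda>p. Atom (int (level (fst p) (snd p))))"
proof -
  have 1: "poly_time item_env enc_item_env
     (\<lambda>p. Atom (int (nat (- ((- (tail (fst p) (snd p) 0 * int H)) div resolution (fst p))))))"
    by (intro poly_time_nat poly_time_uminus poly_time_div poly_time_mult poly_time_tail
        poly_time_of_instance[OF poly_time_resolution] poly_time_const)
  have "poly_time item_env enc_item_env (\<lambda>p. if light (fst p) (snd p) then Atom 0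
     else Atom (int (nat (- ((- (tail (fst p) (snd p) 0 * int H)) div resolution (fst p))))))"
    by (intro poly_time_If poly_time_light poly_time_const poly_time_subset[OF 1]) auto
  then show ?thesis by (rule poly_time_cong) (simp add: level_def)
qed

text \<open>The code \<open>to_nat\<close> need not be computed: level and digits are bounded by
  constants, so it is looked up in a finite table.\<close>

lemma poly_time_class:
  "poly_time item_env enc_item_env (\<lambda>p. Atom (int (to_nat (class_of (fst p) (snd p)))))"
proof -
  let ?fs = "(\<lambda>p. level (fst p) (snd p)) # map (\<lambda>k p. digit (fst p) (snd p) k) [0..<2 * g]"
  have "poly_time item_env enc_item_env (\<lambda>p. (\<lambda>ds. Atom (int (to_nat ds))) (map (\<lambda>f. f p) ?fs))"
  proof (rule poly_time_finite_list[where K = "G + H + 1"])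
    fix f assume f: "f \<in> set ?fs"
    then show "poly_time item_env enc_item_env (\<lambda>p. Atom (int (f p)))"
      using poly_time_level poly_time_digit by auto
    fix p assume "p \<in> item_env"
    then obtain I b i where p: "p = (I, b)" "sbp_instance I" "i < length (items I)" "b = items I ! i"
      by (metis item_envD surj_pair)
    have "level I b \<le> H" using level_bounds(4)[OF p(2-4)] by (cases "light I b") (auto simp: level_def)
    then show "f p < G + H + 1" using f p(1) digit_bounds(3)[OF p(2-4)]
      by (auto simp: less_Suc_eq_le intro: le_trans trans_le_add1)
  qed
  then show ?thesis by (simp add: class_of_def o_def)
qed

lemma poly_time_weight: "poly_time item_env enc_item_env (\<lambda>p. Atom (weight (fst p) (snd p)))"
proof -
  have "poly_time item_env enc_item_env (\<lambda>p. if light (fst p) (snd p) then Atom (tail (fst p) (snd p) 0)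
     else Atom (unit (fst p)))"
    by (intro poly_time_If poly_time_light poly_time_subset[OF poly_time_tail]
        poly_time_subset[OF poly_time_of_instance[OF poly_time_unit]]) auto
  then show ?thesis by (rule poly_time_cong) (simp add: weight_def)
qed

lemma poly_time_classified:
  "poly_time instances encode_sbp (\<lambda>I. encode_list encode_class (classified I))"
  unfolding classified_def
proof (rule poly_time_map[OF poly_time_items])
  show "poly_time {(I, b). I \<in> instances \<and> b \<in> set (items I)} enc_item_env
     (\<lambda>(I, b). encode_class (to_nat (class_of I b), weight I b))"
    using poly_time_Node[OF poly_time_class poly_time_weight]
    by (simp add: encode_class_def case_prod_unfold item_env_def)
qed

end

abbreviation encode_nat :: "nat \<Rightarrow> data" where "encode_nat j \<equiv> Atom (int j)"

definition encode_state :: "(nat \<times> int) list \<times> int \<Rightarrow> data" where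
  "encode_state = (\<lambda>(xs, V). Node (encode_list encode_class xs) (Atom V))"

section \<open>The search for the best multiset, for a fixed table of configurations\<close>

context
  fixes cp :: "nat \<Rightarrow> nat \<Rightarrow> nat" and T Z :: nat
begin

definition states :: "((nat \<times> int) list \<times> int) set" where
  "states = {(xs, V). \<forall>(t, w)\<in>set xs. t < T}"

definition trial_env :: "(((nat \<times> int) list \<times> int) \<times> nat list) set" where
  "trial_env = {(s, v). s \<in> states \<and> set v \<subseteq> {..<Z}}"

abbreviation enc_trial_env :: "((nat \<times> int) list \<times> int) \<times> nat list \<Rightarrow> data" where
  "enc_trial_env \<equiv> enc_pair encode_state (encode_list encode_nat)"

lemma poly_time_state_items: "poly_time A encode_state (\<lambda>s. encode_list encode_class (fst s))"
  using poly_time_left[OF poly_time_id[of A encode_state]] by (simp add: encode_state_def case_prod_unfold)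

lemma poly_time_state_unit: "poly_time A encode_state (\<lambda>s. Atom (snd s))"
  using poly_time_right[OF poly_time_id[of A encode_state]] by (simp add: encode_state_def case_prod_unfold)

lemma poly_time_of_state:
  "poly_time states encode_state f \<Longrightarrow> poly_time trial_env enc_trial_env (\<lambda>p. f (fst p))"
  by (rule poly_time_pair_fst) (auto simp: trial_env_def)

lemma poly_time_trial_bins: "poly_time trial_env enc_trial_env (\<lambda>p. encode_list encode_nat (snd p))"
  by (rule poly_time_pair_snd)

definition place_env where "place_env = rests trial_env (\<lambda>p. fst (fst p))"

abbreviation "enc_place_env \<equiv> enc_rest enc_trial_env encode_class"

lemma poly_time_place_class: "poly_time place_env enc_place_env (\<lambda>p. encode_nat (fst (fst (snd p))))"
  using poly_time_left[OF poly_time_rest_head[of trial_env "\<lambda>p. fst (fst p)" enc_trial_env encode_class]]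
  by (simp add: place_env_def encode_class_def case_prod_unfold)

lemma poly_time_class_weight:
  "poly_time place_env enc_place_env (\<lambda>p. Atom (class_weight (fst (fst (snd p))) (snd (snd p))))"
proof -
  have r: "poly_time place_env enc_place_env (\<lambda>p. encode_list encode_class (snd (snd p)))"
    unfolding place_env_def by (rule poly_time_rest_tail)
  let ?B = "{(p, y). p \<in> place_env \<and> y \<in> set (snd (snd p))}"
  let ?e = "enc_pair enc_place_env encode_class"
  have t: "poly_time ?B ?e (\<lambda>z. encode_nat (fst (fst (snd (fst z)))))"
    by (rule poly_time_pair_fst[OF poly_time_place_class]) auto
  have y: "poly_time ?B ?e (\<lambda>z. encode_class (snd z))" by (rule poly_time_pair_snd)
  have t': "poly_time ?B ?e (\<lambda>z. encode_nat (fst (snd z)))"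
    using poly_time_left[OF y] by (simp add: encode_class_def case_prod_unfold)
  have w: "poly_time ?B ?e (\<lambda>z. Atom (snd (snd z)))"
    using poly_time_right[OF y] by (simp add: encode_class_def case_prod_unfold)
  have "poly_time ?B ?e (\<lambda>z. Atom (of_bool (int (fst (snd z)) = int (fst (fst (snd (fst z))))) * snd (snd z)))"
    by (intro poly_time_mult poly_time_of_bool_eq t t' w)
  then have "poly_time ?B ?e (\<lambda>(p, t', w). Atom (if t' = fst (fst (snd p)) then w else 0))"
    by (rule poly_time_cong) auto
  then show ?thesis unfolding class_weight_def
    by (intro poly_time_sum[OF r]) (simp add: case_prod_unfold)
qed

definition bin_env where "bin_env = rests place_env (\<lambda>p. snd (fst p))"

abbreviation "enc_bin_env \<equiv> enc_rest enc_place_env encode_nat"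

lemma poly_time_of_place: "poly_time place_env enc_place_env f \<Longrightarrow> poly_time bin_env enc_bin_env (\<lambda>p. f (fst p))"
  unfolding bin_env_def by (rule poly_time_rest_fst)

lemma poly_time_of_trial: "poly_time trial_env enc_trial_env f \<Longrightarrow> poly_time place_env enc_place_env (\<lambda>p. f (fst p))"
  unfolding place_env_def by (rule poly_time_rest_fst)

text \<open>\<open>cp\<close> is an arbitrary function. The constant bounds \<open>T\<close> on
  class codes and \<open>Z\<close> on configuration numbers make its relevant part a finite
  table.\<close>

lemma poly_time_room:
  "poly_time bin_env enc_bin_env
     (\<lambda>p. Atom (room cp (fst (fst (snd (fst p)))) (fst (snd p) # snd (snd p))))"
proof -
  have 1: "poly_time bin_env enc_bin_env (\<lambda>p. encode_nat (fst (snd p)))"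
    unfolding bin_env_def by (rule poly_time_rest_head)
  have 2: "poly_time bin_env enc_bin_env (\<lambda>p. encode_list encode_nat (snd (snd p)))"
    unfolding bin_env_def by (rule poly_time_rest_tail)
  have v: "poly_time bin_env enc_bin_env (\<lambda>p. encode_list encode_nat (fst (snd p) # snd (snd p)))"
    using poly_time_Node[OF 1 2] by simp
  let ?B = "{(p, z). p \<in> bin_env \<and> z \<in> set (fst (snd p) # snd (snd p))}"
  let ?e = "enc_pair enc_bin_env encode_nat"
  let ?fs = "[snd, \<lambda>q. fst (fst (snd (fst (fst q))))] :: ((((((nat \<times> int) list \<times> int) \<times> nat list) \<times>
      (nat \<times> int) \<times> (nat \<times> int) list) \<times> nat \<times> nat list) \<times> nat \<Rightarrow> nat) list"
  have t: "poly_time ?B ?e (\<lambda>q. encode_nat (fst (fst (snd (fst (fst q))))))"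
    by (rule poly_time_pair_fst[OF poly_time_of_place[OF poly_time_place_class]]) auto
  have z: "poly_time ?B ?e (\<lambda>q. encode_nat (snd q))" by (rule poly_time_pair_snd)
  have "poly_time ?B ?e (\<lambda>q. (\<lambda>l. encode_nat (cp (l ! 0) (l ! 1))) (map (\<lambda>f. f q) ?fs))"
  proof (rule poly_time_finite_list[where K = "T + Z"])
    fix f assume "f \<in> set ?fs"
    then show "poly_time ?B ?e (\<lambda>a. encode_nat (f a))" using t z by auto
  next
    fix f q assume f: "f \<in> set ?fs" and q: "q \<in> ?B"
    obtain s v t w r z r' y where qq: "q = ((((s, v), (t, w), r), z, r'), y)" by (metis surj_pair)
    have *: "((s, v), (t, w), r) \<in> place_env" "suffix (z # r') v" "y \<in> set (z # r')"
      using q by (auto simp: qq bin_env_def rests_def)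
    then have "(s, v) \<in> trial_env" "suffix ((t, w) # r) (fst s)" by (auto simp: place_env_def rests_def)
    then have "y < Z" "t < T" using set_mono_suffix[OF *(2)] *(3) set_mono_suffix[of "(t, w) # r" "fst s"]
      by (auto simp: trial_env_def states_def)
    then show "f q < T + Z" using f by (auto simp: qq)
  qed
  then have "poly_time ?B ?e (\<lambda>(p, z). encode_nat (cp z (fst (fst (snd (fst p))))))"
    by (simp add: case_prod_unfold)
  then show ?thesis unfolding room_def by (intro poly_time_sum[OF v])
qed

lemma poly_time_bin_of:
  "poly_time place_env enc_place_env
     (\<lambda>p. Atom (bin_of cp (snd (fst (fst p))) (snd (fst p)) (fst (fst (snd p)))
        (class_weight (fst (fst (snd p))) (snd (snd p)))))"
proof -
  have V: "poly_time bin_env enc_bin_env (\<lambda>p. Atom (snd (fst (fst (fst p)))))"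
    by (rule poly_time_of_place[OF poly_time_of_trial[OF poly_time_of_state[OF poly_time_state_unit]]])
  have "poly_time bin_env enc_bin_env (\<lambda>p. Atom (of_bool
      (snd (fst (fst (fst p))) * room cp (fst (fst (snd (fst p)))) (fst (snd p) # snd (snd p)) \<le>
       class_weight (fst (fst (snd (fst p)))) (snd (snd (fst p))))))"
    by (intro poly_time_leq poly_time_mult V poly_time_room poly_time_of_place[OF poly_time_class_weight])
  then show ?thesis unfolding bin_of_def
    by (intro poly_time_sum_rest[OF poly_time_of_trial[OF poly_time_trial_bins]])
      (simp add: case_prod_unfold bin_env_def)
qed

lemma poly_time_assign:
  "poly_time trial_env enc_trial_env
     (\<lambda>p. encode_list encode_nat (assign cp (snd (fst p)) (snd p) (fst (fst p))))"
  unfolding assign_def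
  by (rule poly_time_map_rest[OF poly_time_of_state[OF poly_time_state_items]])
    (use poly_time_nat[OF poly_time_bin_of] in \<open>simp add: case_prod_unfold place_env_def\<close>)

definition encode_trial :: "int \<times> nat list \<Rightarrow> data" where
  "encode_trial = (\<lambda>(key, f). Node (Atom key) (encode_packing f))"

lemma poly_time_trial:
  "poly_time trial_env enc_trial_env (\<lambda>p. encode_trial (trial cp (snd (fst p)) (fst (fst p)) (snd p)))"
proof -
  let ?f = "\<lambda>p. assign cp (snd (fst p)) (snd p) (fst (fst p))"
  note len = poly_time_length[OF poly_time_trial_bins]
  let ?B = "{(p, j). p \<in> trial_env \<and> j \<in> set (?f p)}" and ?e = "enc_pair enc_trial_env encode_nat"
  have l: "poly_time ?B ?e (\<lambda>q. Atom (int (length (snd (fst q)))))"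
    by (rule poly_time_pair_fst[OF len]) auto
  have "poly_time ?B ?e (\<lambda>q. Atom (of_bool (int (length (snd (fst q))) \<le> int (snd q))))"
    by (intro poly_time_leq l poly_time_pair_snd)
  then have "poly_time trial_env enc_trial_env (\<lambda>p. Atom (bad (snd p) (?f p)))"
    unfolding bad_def by (intro poly_time_sum[OF poly_time_assign]) (simp add: case_prod_unfold)
  then have "poly_time trial_env enc_trial_env (\<lambda>p. Node (Atom (int (length (snd p)) + bad (snd p) (?f p) *
      (int (length (fst (fst p))) + 1))) (encode_list encode_nat (?f p)))"
    by (intro poly_time_Node poly_time_add poly_time_mult len poly_time_assign poly_time_const
        poly_time_length[OF poly_time_of_state[OF poly_time_state_items]])
  then show ?thesis by (simp add: encode_trial_def trial_def encode_packing_def)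
qed

text \<open>The induction runs over the constant list \<open>zs\<close> outside the program; every
  configuration contributes a loop, so the degree of the polynomial grows with the number of
  configurations.\<close>

lemma poly_time_candidates:
  assumes "set zs \<subseteq> {..<Z}"
  shows "poly_time states encode_state
     (\<lambda>s. encode_list (encode_list encode_nat) (candidates zs ((0, 0) # fst s)))"
  using assms
proof (induction zs)
  case Nil
  show ?case by (simp add: poly_time_const)
next
  case (Cons z zs)
  let ?ys = "\<lambda>s :: (nat \<times> int) list \<times> int. (0, 0) # fst s"
  let ?B = "{(s, v). s \<in> states \<and> v \<in> set (candidates zs (?ys s))}"
  have cand: "poly_time states encode_state (\<lambda>s. encode_list (encode_list encode_nat) (candidates zs (?ys s)))"
    using Cons by simp
  have "poly_time states encode_state
      (\<lambda>s. Node (Node (Atom 0) (Atom 0)) (encode_list encode_class (fst s)))"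
    by (intro poly_time_Node poly_time_const poly_time_state_items)
  then have "poly_time states encode_state (\<lambda>s. encode_list encode_class (?ys s))"
    by (simp add: encode_class_def)
  then have ys: "poly_time ?B enc_trial_env (\<lambda>p. encode_list encode_class (?ys (fst p)))"
    by (rule poly_time_pair_fst) auto
  have v: "poly_time ?B enc_trial_env (\<lambda>p. encode_list encode_nat (snd p))"
    by (rule poly_time_pair_snd)
  let ?C = "rests ?B (\<lambda>p. ?ys (fst p))" and ?e = "enc_rest enc_trial_env encode_class"
  have r: "poly_time ?C ?e (\<lambda>p. encode_list encode_class (snd (snd p)))" by (rule poly_time_rest_tail)
  have "poly_time ?C ?e (\<lambda>p. encode_list encode_nat (map (\<lambda>_. z) (snd (snd p))))"
    by (rule poly_time_map[OF r]) (simp add: case_prod_unfold poly_time_const)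
  then have "poly_time ?C ?e (\<lambda>p. encode_list encode_nat (rev (map (\<lambda>_. z) (snd (snd p))) @ snd (fst p)))"
    by (rule poly_time_rev_append) (rule poly_time_rest_fst[OF v])
  then have "poly_time ?B enc_trial_env (\<lambda>p. encode_list (encode_list encode_nat)
      (map_rest (\<lambda>y r. rev (map (\<lambda>_. z) r) @ snd p) (?ys (fst p))))"
    by (intro poly_time_map_rest[OF ys]) (simp add: case_prod_unfold)
  then have "poly_time states encode_state (\<lambda>s. encode_list (encode_list (encode_list encode_nat))
      (map (\<lambda>v. map_rest (\<lambda>y r. rev (map (\<lambda>_. z) r) @ v) (?ys s)) (candidates zs (?ys s))))"
    by (intro poly_time_map[OF cand]) (simp add: case_prod_unfold)
  from poly_time_rev_concat[OF this] show ?case by simp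
qed

lemma poly_time_min_trial:
  assumes xs: "poly_time A e (\<lambda>a. encode_list encode_trial (xs a))"
    and ini: "poly_time A e (\<lambda>a. encode_trial (ini a))"
  shows "poly_time A e (\<lambda>a. encode_trial (tfold (\<lambda>y x r. if fst x \<le> fst y then x else y) (ini a) (xs a)))"
proof -
  define P where "P = (\<lambda>a y l. (y = ini a \<or> y \<in> set (xs a)) \<and> set l \<subseteq> set (xs a))"
  have le: "dsize (encode_trial y) \<le> dsize (encode_list encode_trial l)" if "y \<in> set l" for y l
    using that by (induction l) auto
  show ?thesis
  proof (rule poly_time_tfold[where P = P and f = "\<lambda>a y x r. if fst x \<le> fst y then x else y", OF xs ini])
    let ?B = "{(a, y, x, r). a \<in> A \<and> P a y (x # r)}"
    let ?e = "\<lambda>(a, y, x, r). Node (e a) (Node (encode_trial y) (Node (encode_trial x) (encode_list encode_trial r)))"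
    have e: "poly_time ?B ?e ?e" by (rule poly_time_id)
    have y: "poly_time ?B ?e (\<lambda>z. encode_trial (fst (snd z)))"
      using poly_time_left[OF poly_time_right[OF e]] by (rule poly_time_cong) auto
    have x: "poly_time ?B ?e (\<lambda>z. encode_trial (fst (snd (snd z))))"
      using poly_time_left[OF poly_time_right[OF poly_time_right[OF e]]] by (rule poly_time_cong) auto
    have k: "poly_time ?B ?e (\<lambda>z. Atom (fst (fst (snd z))))" "poly_time ?B ?e (\<lambda>z. Atom (fst (fst (snd (snd z)))))"
      using poly_time_left[OF y] poly_time_left[OF x] by (simp_all add: encode_trial_def case_prod_unfold)
    have "poly_time ?B ?e (\<lambda>z. if fst (fst (snd (snd z))) \<le> fst (fst (snd z))
        then encode_trial (fst (snd (snd z))) else encode_trial (fst (snd z)))"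
      by (intro poly_time_If poly_time_leq k poly_time_subset[OF x] poly_time_subset[OF y]) auto
    then show "poly_time ?B ?e (\<lambda>(a, y, x, r). encode_trial (if fst x \<le> fst y then x else y))"
      by (rule poly_time_cong) auto
    show "poly_bounded A e (\<lambda>a. dsize (encode_trial (ini a)) + dsize (encode_list encode_trial (xs a)))"
      by (intro poly_bounded_add poly_time_dsize xs ini)
    show "dsize (encode_trial y) \<le> dsize (encode_trial (ini a)) + dsize (encode_list encode_trial (xs a))"
      if "P a y l" for a y l
      using that le[of y "xs a"] by (auto simp: P_def)
  qed (auto simp: P_def)
qed

lemma poly_time_pack:
  assumes zs: "set zs \<subseteq> {..<Z}"
  shows "poly_time states encode_state (\<lambda>s. encode_packing (pack cp zs (snd s) (fst s)))"
proof -
  let ?ys = "\<lambda>s :: (nat \<times> int) list \<times> int. (0, 0) # fst s"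
  let ?B = "{(s, v). s \<in> states \<and> v \<in> set (candidates zs (?ys s))}"
  have "?B \<subseteq> trial_env" using zs candidates_subset by (fastforce simp: trial_env_def)
  then have "poly_time ?B enc_trial_env (\<lambda>p. encode_trial (trial cp (snd (fst p)) (fst (fst p)) (snd p)))"
    by (rule poly_time_subset[OF poly_time_trial])
  then have 1: "poly_time states encode_state
      (\<lambda>s. encode_list encode_trial (map (trial cp (snd s) (fst s)) (candidates zs (?ys s))))"
    by (intro poly_time_map[OF poly_time_candidates[OF zs]]) (simp add: case_prod_unfold)
  have "poly_time states encode_state (\<lambda>s. Node (Atom (int (length (fst s)) + 1)) (Atom 0))"
    by (intro poly_time_Node poly_time_add poly_time_const poly_time_length[OF poly_time_state_items])
  then have 2: "poly_time states encode_state (\<lambda>s. encode_trial (int (length (fst s)) + 1, []))"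
    by (simp add: encode_trial_def encode_packing_def)
  from poly_time_right[OF poly_time_min_trial[OF 1 2]]
  show ?thesis by (simp add: pack_def encode_trial_def case_prod_unfold)
qed

end

section \<open>The approximation scheme\<close>

text \<open>The budget of an output bin is \<open>\<epsilon> / 2\<close> for the levels of
  \<open>p\<close>, \<open>\<epsilon> / 4\<close> for \<open>lower_error\<close> and
  \<open>\<epsilon> / 8\<close> for \<open>upper_error\<close>. \<open>M\<close> is the bound of
  \<open>ramps_sum_le\<close> for overflow probability at most
  \<open>1 - \<epsilon> / 2\<close>.\<close>

locale scheme = rounding g G H D K \<phi> \<kappa> M
  for g G H D K :: nat and \<phi> :: "real \<Rightarrow> real" and \<kappa> M :: real +
  fixes \<epsilon> :: real and R :: nat
  assumes eps: "0 < \<epsilon>" "\<epsilon> \<le> 1" and R: "1 / R \<le> \<epsilon> / 2" "1 \<le> R"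
    and phi: "\<And>x. x \<le> 1 \<Longrightarrow> \<phi> x \<le> 0" "\<And>x. 1 + \<epsilon> \<le> x \<Longrightarrow> 1 \<le> \<phi> x"
    and M_eq: "M = g * (2 * (1 - ln (\<epsilon> / 2)))"
    and upper_error: "\<kappa> / (real g)\<^sup>2 * (M + 4) + 2 * (M + 3) / D + 3 * card directions / D \<le> \<epsilon> / 8"
    and lower_error: "(2 * M + 4 + card directions) / D + 1 / K + (M + 1) / G + (M + 1) * D / H +
      \<kappa> / (real g)\<^sup>2 * M \<le> \<epsilon> / 4"
begin

text \<open>The bound \<open>M + 3\<close> is the one that \<open>config_lower\<close> guarantees
  for the bins of a feasible packing.\<close>

definition configs :: "(nat list \<Rightarrow> nat) set" where
  "configs = {cp. (\<forall>t. t \<notin> classes \<longrightarrow> cp t = 0) \<and> config_mass cp \<le> M + 3}"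

text \<open>Every class has magnitude at least \<open>1 / (D + H)\<close>, so bounded mass bounds
  the multiplicities.\<close>

lemma finite_configs: "finite configs"
proof -
  let ?b = "nat \<lceil>(M + 3) * (D + H)\<rceil>"
  have "cp t \<le> ?b" if cp: "cp \<in> configs" and t: "t \<in> classes" for cp t
  proof -
    have "real (cp t) * magnitude t \<le> config_mass cp"
      unfolding config_mass_def using magnitude_bounds t finite_classes
      by (intro member_le_sum[of t classes "\<lambda>t. real (cp t) * magnitude t"]) auto
    then have c: "real (cp t) * magnitude t \<le> M + 3" using cp by (simp add: configs_def)
    have "1 \<le> magnitude t * (D + H)"
    proof (cases "hd t = 0")
      case True
      then show ?thesis using D by (simp add: magnitude_def field_simps)
    next
      case False
      then have "1 * (real H) \<le> real (hd t) * (D + H)" by (intro mult_mono) auto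
      then show ?thesis using False H by (simp add: magnitude_def field_simps)
    qed
    then have "real (cp t) * 1 \<le> real (cp t) * (magnitude t * (D + H))" by (intro mult_left_mono) auto
    also have "\<dots> \<le> (M + 3) * (D + H)" using mult_right_mono[OF c, of "real (D + H)"] by (simp add: mult.assoc)
    finally have "real (cp t) \<le> (M + 3) * (D + H)" by simp
    then show ?thesis by linarith
  qed
  then have "configs \<subseteq> {f. \<forall>t. (t \<in> classes \<longrightarrow> f t \<in> {..?b}) \<and> (t \<notin> classes \<longrightarrow> f t = 0)}"
    by (auto simp: configs_def)
  then show ?thesis
    using finite_set_of_finite_funs[OF finite_classes, of "{..?b}" 0] finite_subset by blast
qed

definition config_list :: "(nat list \<Rightarrow> nat) list" where
  "config_list = (SOME cs. set cs = configs)"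

lemma set_config_list: "set config_list = configs"
  unfolding config_list_def using someI_ex[OF finite_list[OF finite_configs]] .

definition config :: "nat \<Rightarrow> nat \<Rightarrow> nat" where
  "config z t = (config_list ! z) (from_nat t)"

text \<open>The program does not evaluate this comparison of reals: for each of the \<open>R\<close>
  levels the resulting list is a constant. \<open>(l + 1) / R\<close> bounds \<open>p\<close> from
  above at level \<open>l\<close>, and \<open>\<epsilon> / 4\<close> is the loss of
  \<open>config_lower\<close>, so the configurations of feasible bins pass.\<close>

definition allowed :: "nat \<Rightarrow> nat list" where
  "allowed l = filter (\<lambda>z. ga_ev \<phi> (canonical (config_list ! z)) \<le> (real l + 1) / R + \<epsilon> / 4)
     [0..<length config_list]"

definition prob_level :: "sbp \<Rightarrow> nat" where
  "prob_level I = nat (fst (quotient_of (overflow_prob I)) * int R div snd (quotient_of (overflow_prob I)))"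

text \<open>The choice depends on the level and not on \<open>p\<close> itself, so that it is
  decided by the finite case distinction, too.\<close>

definition packing :: "sbp \<Rightarrow> nat list" where
  "packing I = (if 1 - \<epsilon> \<le> real (prob_level I) / R then map (\<lambda>_. 0) (items I)
     else pack config (allowed (prob_level I)) (unit I) (classified I))"

lemma prob_level_bounds:
  assumes "sbp_instance I"
  shows "real (prob_level I) / R \<le> of_rat (overflow_prob I)"
    "of_rat (overflow_prob I) \<le> (real (prob_level I) + 1) / R" "prob_level I < R"
proof -
  let ?p = "overflow_prob I"
  let ?n = "fst (quotient_of ?p)" and ?d = "snd (quotient_of ?p)"
  have d: "0 < ?d" using quotient_of_denom_pos[of ?p ?n ?d] by simp
  have p: "of_rat ?p = (real_of_int ?n / real_of_int ?d)"
    using quotient_of_div[of ?p ?n ?d] by (metis of_rat_divide of_rat_of_int_eq prod.collapse)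
  have p01: "0 < real_of_rat ?p" "real_of_rat ?p < 1" using assms by (auto simp: sbp_instance_def)
  have "real_of_rat ?p * R = real_of_int (?n * int R) / real_of_int ?d" by (simp add: p)
  then have f: "?n * int R div ?d = \<lfloor>real_of_rat ?p * R\<rfloor>" by (simp only: floor_divide_of_int_eq)
  have nn: "0 \<le> real_of_rat ?p * R" using p01 by simp
  have l: "real (prob_level I) \<le> real_of_rat ?p * R" "real_of_rat ?p * R \<le> real (prob_level I) + 1"
    unfolding prob_level_def f using nn by linarith+
  have R0: "0 < real R" using R by simp
  show "real (prob_level I) / R \<le> of_rat (overflow_prob I)" using l R0 by (simp add: divide_le_eq)
  show "of_rat (overflow_prob I) \<le> (real (prob_level I) + 1) / R" using l R0 by (simp add: le_divide_eq)
  have "real_of_rat ?p * R < R" using p01 R0 by simp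
  then have "real (prob_level I) < real R" using l by linarith
  then show "prob_level I < R" by simp
qed

lemma poly_time_packing: "poly_time instances encode_sbp (\<lambda>I. encode_packing (packing I))"
proof -
  define T where "T = Suc (Max (to_nat ` classes))"
  have level: "poly_time instances encode_sbp (\<lambda>I. Atom (int (prob_level I)))"
    unfolding prob_level_def
    using poly_time_left[OF poly_time_overflow_prob] poly_time_right[OF poly_time_overflow_prob]
    by (intro poly_time_nat poly_time_div poly_time_mult poly_time_const)
      (simp_all add: left_encode_rat right_encode_rat)
  have 0: "poly_time instances encode_sbp (\<lambda>I. encode_packing (map (\<lambda>_. 0) (items I)))"
    unfolding encode_packing_def
    by (rule poly_time_map[OF poly_time_items]) (simp add: case_prod_unfold poly_time_const)
  have st: "poly_time instances encode_sbp (\<lambda>I. encode_state (classified I, unit I))"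
    using poly_time_Node[OF poly_time_classified poly_time_unit] by (simp add: encode_state_def)
  have in_states: "(classified I, unit I) \<in> states T" if "I \<in> instances" for I
  proof -
    have "to_nat (class_of I b) < T" if "b \<in> set (items I)" for b
    proof -
      from that obtain i where "i < length (items I)" "b = items I ! i" by (auto simp: in_set_conv_nth)
      then have "class_of I b \<in> classes" using class_of_in_classes \<open>I \<in> instances\<close> by auto
      then show ?thesis by (simp add: T_def finite_classes less_Suc_eq_le)
    qed
    then show ?thesis by (auto simp: states_def classified_def)
  qed
  have 1: "poly_time instances encode_sbp
      (\<lambda>I. encode_packing (pack config (allowed l) (unit I) (classified I)))" for l
  proof -
    have "set (allowed l) \<subseteq> {..<length config_list}" by (auto simp: allowed_def)
    from poly_time_comp[OF st in_states poly_time_pack[OF this]] show ?thesis by simp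
  qed
  let ?h = "\<lambda>l I. encode_packing (if 1 - \<epsilon> \<le> real l / R then map (\<lambda>_. 0) (items I)
     else pack config (allowed l) (unit I) (classified I))"
  have "poly_time instances encode_sbp (\<lambda>I. ?h (prob_level I) I)"
  proof (rule poly_time_finite[OF level])
    show "poly_time {I \<in> instances. prob_level I = l} encode_sbp (?h l)" for l
    proof (rule poly_time_subset)
      show "poly_time instances encode_sbp (?h l)"
        using 0 1[of l] by (cases "1 - \<epsilon> \<le> real l / R") simp_all
    qed auto
  qed (use prob_level_bounds(3) in auto)
  then show ?thesis by (simp add: packing_def)
qed

section \<open>Correctness of the computed packing\<close>

context
  fixes I :: sbp
  assumes I: "sbp_instance I"
begin

lemma length_classified: "length (classified I) = length (items I)"
  by (simp add: classified_def)

lemma classified_nth: "i < length (items I) \<Longrightarrow>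
    classified I ! i = (to_nat (class_of I (items I ! i)), weight I (items I ! i))"
  by (simp add: classified_def)

lemma classified_bounds: "(t, w) \<in> set (classified I) \<Longrightarrow> 0 < w \<and> w \<le> unit I"
  using weight_bounds[OF I _ refl] by (fastforce simp: classified_def in_set_conv_nth)

lemma unit_positive: "0 < unit I"
  using unit_pos[OF I] by simp

lemma packed_bin:
  assumes v: "set v \<subseteq> set (allowed (prob_level I))" and j: "j < length v"
  shows "prob_exceeds I (items_in (assign config (unit I) v (classified I)) j) ((1 + \<epsilon>) * of_rat (capacity I))
    \<le> of_rat (overflow_prob I) + \<epsilon>"
proof -
  let ?f = "assign config (unit I) v (classified I)"
  let ?B = "items_in ?f j" and ?z = "v ! (length v - j - 1)"
  let ?cp = "config_list ! ?z"
  have B: "?B \<subseteq> {..<length (items I)}" by (auto simp: items_in_def length_classified)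
  have "?z \<in> set (allowed (prob_level I))" using v j by (auto intro!: subsetD[OF v] nth_mem)
  then have zl: "?z < length config_list"
    and z2: "ga_ev \<phi> (canonical ?cp) \<le> (real (prob_level I) + 1) / R + \<epsilon> / 4"
    by (simp_all add: allowed_def)
  have z1: "?cp \<in> configs" using nth_mem[OF zl] unfolding set_config_list .
  have part: "{i \<in> ?B. class_of I (items I ! i) = t} =
     {i. i < length (classified I) \<and> ?f ! i = j \<and> fst (classified I ! i) = to_nat t}" for t
    by (auto simp: items_in_def length_classified classified_nth)
  have fits: "if hd t = 0
     then (\<Sum>i\<in>{i \<in> ?B. class_of I (items I ! i) = t}. weight I (items I ! i)) \<le> (int (?cp t) + 1) * unit I
     else card {i \<in> ?B. class_of I (items I ! i) = t} \<le> ?cp t" if t: "t \<in> classes" for t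
  proof (cases "hd t = 0")
    case True
    have "(\<Sum>i\<in>{i \<in> ?B. class_of I (items I ! i) = t}. weight I (items I ! i)) =
        (\<Sum>i\<in>{i \<in> ?B. class_of I (items I ! i) = t}. snd (classified I ! i))"
      by (rule sum.cong[OF refl]) (use B in \<open>auto simp: classified_nth\<close>)
    also have "\<dots> \<le> (int (config ?z (to_nat t)) + 1) * unit I"
      unfolding part by (rule assign_light[OF unit_positive classified_bounds j])
    finally show ?thesis using True by (simp add: config_def)
  next
    case False
    have heavy: "w = unit I" if tw: "(to_nat t, w) \<in> set (classified I)" for w
    proof -
      from tw obtain b where b: "b \<in> set (items I)" "class_of I b = t" "w = weight I b"
        by (auto simp: classified_def)
      then obtain i where "i < length (items I)" "b = items I ! i" by (auto simp: in_set_conv_nth)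
      then show ?thesis using light_iff[OF I, of i b] b False by (simp add: weight_def)
    qed
    have "card {i \<in> ?B. class_of I (items I ! i) = t} \<le> config ?z (to_nat t)"
      unfolding part by (rule assign_heavy[OF unit_positive _ j]) (erule classified_bounds, erule heavy)
    then show ?thesis using False by (simp add: config_def)
  qed
  have mass: "config_mass ?cp \<le> M + 3" using z1 by (simp add: configs_def)
  have "prob_exceeds I ?B ((1 + \<epsilon>) * of_rat (capacity I)) \<le> ga_ev \<phi> (\<Prod>i\<in>?B. elem I i)"
    by (rule prob_exceeds_le[OF I B]) (use ge_0 phi in auto)
  also have "\<dots> \<le> ga_ev \<phi> (canonical ?cp) + (\<kappa> / (real g)\<^sup>2 * (config_mass ?cp + 1) +
      2 * config_mass ?cp / D + 3 * card directions / D)"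
    by (rule config_upper[OF I B fits])
  also have "\<dots> \<le> ga_ev \<phi> (canonical ?cp) + (\<kappa> / (real g)\<^sup>2 * (M + 4) + 2 * (M + 3) / D + 3 * card directions / D)"
  proof -
    have "\<kappa> / (real g)\<^sup>2 * (config_mass ?cp + 1) \<le> \<kappa> / (real g)\<^sup>2 * (M + 4)"
      using mass kappa by (intro mult_left_mono) auto
    moreover have "2 * config_mass ?cp / D \<le> 2 * (M + 3) / D"
      using mass by (intro divide_right_mono) auto
    ultimately show ?thesis by linarith
  qed
  also have "\<dots> \<le> (real (prob_level I) + 1) / R + \<epsilon> / 4 + \<epsilon> / 8"
    using z2 upper_error by linarith
  also have "\<dots> = real (prob_level I) / R + 1 / R + \<epsilon> / 4 + \<epsilon> / 8" by (simp add: add_divide_distrib)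
  \<comment> \<open>The four errors are within \<open>\<epsilon>\<close> because
    \<open>1 / R\<close> is at most \<open>\<epsilon> / 2\<close>.\<close>
  also have "\<dots> \<le> of_rat (overflow_prob I) + \<epsilon>"
    using prob_level_bounds(1)[OF I] R(1) eps(1) by linarith
  finally show ?thesis .
qed

lemma feasible_bin_config:
  assumes B: "B \<subseteq> {..<length (items I)}" and le: "prob_exceeds I B (of_rat (capacity I)) \<le> of_rat (overflow_prob I)"
    and small: "real (prob_level I) / R < 1 - \<epsilon>"
  shows "\<exists>z\<in>set (allowed (prob_level I)). \<forall>t\<in>classes.
    (\<Sum>i\<in>{i \<in> B. class_of I (items I ! i) = t}. weight I (items I ! i)) \<le> int (config z (to_nat t)) * unit I"
proof -
  have p: "of_rat (overflow_prob I) \<le> real (prob_level I) / R + 1 / R"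
    using prob_level_bounds(2)[OF I] by (simp add: add_divide_distrib)
  \<comment> \<open>The level lies below \<open>1 - \<epsilon>\<close> and \<open>p\<close> exceeds
    it by at most \<open>1 / R\<close>; the remaining distance \<open>\<epsilon> / 2\<close> from 1
    is the \<open>d\<close> of \<open>ramps_sum_le\<close>.\<close>
  then have "prob_exceeds I B (of_rat (capacity I)) \<le> 1 - \<epsilon> / 2" using le small R(1) by linarith
  then have "(\<Sum>i\<in>B. ramps g (scaled_item (of_rat (capacity I)) (items I ! i)) 0) \<le> M"
    unfolding M_eq by (intro ramps_sum_le[OF I B g]) (use eps in auto)
  from config_lower[OF I B this] obtain cp where cp: "\<forall>t. t \<notin> classes \<longrightarrow> cp t = 0" "config_mass cp \<le> M + 3"
    and fits: "\<forall>t\<in>classes. (\<Sum>i\<in>{i \<in> B. class_of I (items I ! i) = t}. weight I (items I ! i)) \<le> int (cp t) * unit I"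
    and ev: "ga_ev \<phi> (canonical cp) \<le> ga_ev \<phi> (\<Prod>i\<in>B. elem I i) +
      ((2 * M + 4 + card directions) / D + 1 / K + (M + 1) / G + (M + 1) * D / H + \<kappa> / (real g)\<^sup>2 * M)"
    by blast
  have "cp \<in> configs" using cp by (simp add: configs_def)
  then obtain z where z: "z < length config_list" "config_list ! z = cp"
    using set_config_list by (metis in_set_conv_nth)
  have "ga_ev \<phi> (\<Prod>i\<in>B. elem I i) \<le> prob_exceeds I B (of_rat (capacity I))"
    by (rule ev_le_prob_exceeds[OF I B]) (use le_1 phi in auto)
  then have "ga_ev \<phi> (canonical cp) \<le> (real (prob_level I) + 1) / R + \<epsilon> / 4"
    using ev le lower_error prob_level_bounds(2)[OF I] by linarith
  then have "z \<in> set (allowed (prob_level I))" using z by (simp add: allowed_def)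
  moreover have "config z (to_nat t) = cp t" for t using z by (simp add: config_def)
  ultimately show ?thesis using fits by (intro bexI[of _ z]) (simp_all only:)
qed

text \<open>The given packing only serves to show that some candidate succeeds. The configurations
  of its bins form a multiset \<open>v\<close> of the same size whose total room suffices for every
  class; the algorithm may distribute the items differently, since items of a class are
  interchangeable up to their weight.\<close>

lemma packing_of_feasible:
  assumes f: "feasible_packing I f" and small: "real (prob_level I) / R < 1 - \<epsilon>"
  shows "\<exists>v. set v \<subseteq> set (allowed (prob_level I)) \<and> length v \<le> num_bins f \<and>
    packing I = assign config (unit I) v (classified I) \<and> (\<forall>j\<in>set (packing I). j < length v)"
proof -
  let ?zs = "allowed (prob_level I)" and ?xs = "classified I"
  have len: "length f = length (items I)" using f by (simp add: feasible_packing_def is_packing_def)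
  have sub: "items_in f j \<subseteq> {..<length (items I)}" for j using len by (auto simp: items_in_def)
  let ?fits = "\<lambda>j z. z \<in> set ?zs \<and> (\<forall>t\<in>classes.
      (\<Sum>i\<in>{i \<in> items_in f j. class_of I (items I ! i) = t}. weight I (items I ! i))
        \<le> int (config z (to_nat t)) * unit I)"
  have "\<forall>j\<in>set f. \<exists>z. ?fits j z"
  proof
    fix j assume "j \<in> set f"
    then have "prob_exceeds I (items_in f j) (of_rat (capacity I)) \<le> of_rat (overflow_prob I)"
      using f by (simp add: feasible_packing_def)
    from feasible_bin_config[OF sub this small] show "\<exists>z. ?fits j z" unfolding Bex_def .
  qed
  from bchoice[OF this] obtain c where fits: "\<forall>j\<in>set f. ?fits j (c j)" ..
  have c: "c j \<in> set ?zs"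
    "t \<in> classes \<Longrightarrow> (\<Sum>i\<in>{i \<in> items_in f j. class_of I (items I ! i) = t}. weight I (items I ! i))
      \<le> int (config (c j) (to_nat t)) * unit I" if "j \<in> set f" for j t
    using bspec[OF fits that] by (simp_all only: simp_thms)
  \<comment> \<open>Bins with the same configuration are put into one block, the form in which
    \<open>candidates\<close> enumerates multisets.\<close>
  define k where "k = (\<lambda>z. card {j \<in> set f. c j = z})"
  define v where "v = concat (map (\<lambda>z. replicate (k z) z) ?zs)"
  have dist: "distinct ?zs" by (simp add: allowed_def)
  have sum_zs: "(\<Sum>z\<leftarrow>?zs. \<Sum>j\<in>{j \<in> set f. c j = z}. h j) = (\<Sum>j\<in>set f. h j)" for h :: "nat \<Rightarrow> nat"
    unfolding sum_list_distinct_conv_sum_set[OF dist] by (rule sum.group) (use c(1) in auto)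
  have "length v = (\<Sum>z\<leftarrow>?zs. k z)" by (simp add: v_def length_concat o_def)
  also have "\<dots> = num_bins f" using sum_zs[of "\<lambda>_. 1"] by (simp add: k_def num_bins_def)
  finally have lv: "length v = num_bins f" .
  have room: "room config t v = int (\<Sum>j\<in>set f. config (c j) t)" for t
  proof -
    have "room config t (concat (map (\<lambda>z. replicate (k z) z) zs)) = int (\<Sum>z\<leftarrow>zs. k z * config z t)" for zs
      by (induction zs) (auto simp: room_def sum_list_replicate)
    moreover have "(\<Sum>z\<leftarrow>?zs. k z * config z t) = (\<Sum>z\<leftarrow>?zs. \<Sum>j\<in>{j \<in> set f. c j = z}. config (c j) t)"
      by (intro arg_cong[where f = sum_list] map_cong refl) (simp add: k_def)
    ultimately show ?thesis unfolding v_def sum_zs[of "\<lambda>j. config (c j) t"] by simp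
  qed
  have cw: "class_weight t ?xs = (\<Sum>i<length (items I). if to_nat (class_of I (items I ! i)) = t then weight I (items I ! i) else 0)" for t
    by (simp add: class_weight_def sum_list_sum_nth length_classified classified_nth atLeast0LessThan case_prod_unfold cong: if_cong)
  have fit: "class_weight t ?xs \<le> unit I * room config t v" for t
  proof -
    have "class_weight t ?xs = (\<Sum>j\<in>set f. \<Sum>i\<in>{i \<in> {..<length (items I)}. f ! i = j}.
        if to_nat (class_of I (items I ! i)) = t then weight I (items I ! i) else 0)"
      unfolding cw by (rule sum.group[symmetric]) (use len in auto)
    also have "\<dots> \<le> (\<Sum>j\<in>set f. int (config (c j) t) * unit I)"
    proof (rule sum_mono)
      fix j assume j: "j \<in> set f"
      let ?S = "{i \<in> {..<length (items I)}. f ! i = j}"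
      have S: "?S = items_in f j" using len by (auto simp: items_in_def)
      show "(\<Sum>i\<in>?S. if to_nat (class_of I (items I ! i)) = t then weight I (items I ! i) else 0)
          \<le> int (config (c j) t) * unit I"
      proof (cases "\<exists>t'\<in>classes. t = to_nat t'")
        case True
        then obtain t' where t': "t' \<in> classes" "t = to_nat t'" by blast
        have "(\<Sum>i\<in>?S. if to_nat (class_of I (items I ! i)) = t then weight I (items I ! i) else 0) =
            (\<Sum>i\<in>{i \<in> ?S. class_of I (items I ! i) = t'}. weight I (items I ! i))"
          unfolding t' by (subst sum.inter_filter) (auto intro!: sum.cong)
        also have "\<dots> \<le> int (config (c j) t) * unit I" unfolding S t'(2) by (rule c(2)[OF j t'(1)])
        finally show ?thesis .
      next
        case False
        have "(\<Sum>i\<in>?S. if to_nat (class_of I (items I ! i)) = t then weight I (items I ! i) else 0) = 0"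
        proof (rule sum.neutral, rule ballI)
          fix i assume "i \<in> ?S"
          then have "class_of I (items I ! i) \<in> classes" using class_of_in_classes[OF I _ refl] by auto
          then show "(if to_nat (class_of I (items I ! i)) = t then weight I (items I ! i) else 0) = 0"
            using False by auto
        qed
        then show ?thesis using unit_positive by simp
      qed
    qed
    also have "\<dots> = unit I * room config t v" by (simp add: room sum_distrib_left mult.commute)
    finally show ?thesis .
  qed
  have n: "num_bins f \<le> length ?xs" using card_length[of f] len by (simp add: num_bins_def length_classified)
  have "k z \<le> num_bins f" for z unfolding k_def num_bins_def by (rule card_mono) auto
  from order_trans[OF this n] have kz: "k z < length ((0, 0) # ?xs)" for z by (simp add: less_Suc_eq_le)
  have v: "v \<in> set (candidates ?zs ((0, 0) # ?xs))" unfolding v_def by (rule candidates_complete[OF kz])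
  from pack_correct[OF v, of config "unit I"]
  obtain v' where "set v' \<subseteq> set ?zs" "length v' \<le> length v"
    "pack config ?zs (unit I) ?xs = assign config (unit I) v' ?xs"
    "\<forall>j\<in>set (assign config (unit I) v' ?xs). j < length v'"
    using assign_success[OF unit_positive classified_bounds fit] n lv by auto
  moreover have "packing I = pack config ?zs (unit I) ?xs" using small by (simp add: packing_def)
  ultimately show ?thesis using lv by auto
qed

theorem packing_correct:
  assumes "\<exists>f. feasible_packing I f"
  shows "is_packing I (packing I)" "num_bins (packing I) \<le> OPT I"
    "\<forall>j\<in>set (packing I). prob_exceeds I (items_in (packing I) j) ((1 + \<epsilon>) * of_rat (capacity I))
      \<le> of_rat (overflow_prob I) + \<epsilon>"
proof -
  have "\<exists>k f. feasible_packing I f \<and> num_bins f = k" using assms by blast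
  from LeastI_ex[OF this] obtain f where f: "feasible_packing I f" "num_bins f = OPT I"
    unfolding OPT_def by blast
  have "is_packing I (packing I) \<and> num_bins (packing I) \<le> OPT I \<and>
    (\<forall>j\<in>set (packing I). prob_exceeds I (items_in (packing I) j) ((1 + \<epsilon>) * of_rat (capacity I))
      \<le> of_rat (overflow_prob I) + \<epsilon>)"
  proof (cases "1 - \<epsilon> \<le> real (prob_level I) / R")
    case True
    then have P: "packing I = map (\<lambda>_. 0) (items I)" by (simp add: packing_def)
    have "num_bins (packing I) \<le> num_bins f"
    proof (cases "items I = []")
      case False
      then have "f \<noteq> []" using f(1) by (auto simp: feasible_packing_def is_packing_def)
      then have "0 < card (set f)" by (simp add: card_gt_0_iff)
      moreover have "card (set (packing I)) \<le> 1" unfolding P by (rule order_trans[OF card_mono[of "{0}"]]) auto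
      ultimately show ?thesis unfolding num_bins_def by linarith
    qed (simp add: P num_bins_def)
    moreover have "prob_exceeds I S c \<le> of_rat (overflow_prob I) + \<epsilon>" for S c
    proof -
      have "prob_exceeds I S c \<le> 1" by (simp add: prob_exceeds_def)
      then show ?thesis using True prob_level_bounds(1)[OF I] by linarith
    qed
    ultimately show ?thesis using f(2) by (simp add: P is_packing_def)
  next
    case False
    then obtain v where v: "set v \<subseteq> set (allowed (prob_level I))" "length v \<le> num_bins f"
        "packing I = assign config (unit I) v (classified I)" "\<forall>j\<in>set (packing I). j < length v"
      using packing_of_feasible[OF f(1)] by auto
    have "is_packing I (packing I)" by (simp add: v(3) is_packing_def length_classified)
    moreover have "num_bins (packing I) \<le> length v"
      unfolding num_bins_def using card_mono[of "{..<length v}" "set (packing I)"] v(4) by auto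
    ultimately show ?thesis using v packed_bin[OF v(1)] f(2) by auto
  qed
  then show "is_packing I (packing I)" "num_bins (packing I) \<le> OPT I"
    "\<forall>j\<in>set (packing I). prob_exceeds I (items_in (packing I) j) ((1 + \<epsilon>) * of_rat (capacity I))
      \<le> of_rat (overflow_prob I) + \<epsilon>" by auto
qed

end

end

lemma poly_time_program:
  assumes "poly_time A e f"
  obtains c where "polynomial_time_on c (e ` A)" "\<And>a. a \<in> A \<Longrightarrow> outputs c (e a) (f a)"
proof -
  from assms obtain T where T: "poly_bounded A e T" "\<forall>b. \<exists>c. implements c b A e f T"
    by (rule poly_timeE)
  from T(1) obtain k where k: "\<forall>a\<in>A. T a \<le> (dsize (e a) + 1) ^ k" unfolding poly_bounded_def by blast
  from T(2) obtain c where c: "implements c 0 A e f T" by blast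
  have run: "\<exists>t. runs c (e a) t (f a) \<and> t \<le> T a" if "a \<in> A" for a
  proof -
    have "((\<lambda>_. Atom 0)(0 := e a)) 0 = e a" by simp
    from implementsE[where s = "(\<lambda>_. Atom 0)(0 := e a)", OF c that this] obtain t s' where
      "exec c ((\<lambda>_. Atom 0)(0 := e a)) t s'" "s' 0 = f a" "t \<le> T a" by metis
    then show ?thesis by (auto simp: runs_def)
  qed
  have "poly ([:1, 1:] ^ k) n = (n + 1) ^ k" for n :: nat by (simp add: poly_power)
  then have "polynomial_time_on c (e ` A)"
    unfolding polynomial_time_on_def using run k
    by (intro exI[of _ "[:1, 1:] ^ k"]) (fastforce intro: le_trans)
  moreover have "outputs c (e a) (f a)" if "a \<in> A" for a
    using run[OF that] by (auto simp: outputs_def)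
  ultimately show ?thesis using that by blast
qed

text \<open>The order of the choices matters: \<open>M\<close> depends on \<open>g\<close>, the
  number of directions on \<open>g\<close> and \<open>G\<close>, \<open>D\<close> on both, and
  \<open>H\<close> on \<open>D\<close>. The Lindeberg term gets \<open>\<epsilon> / 16\<close>,
  every other error \<open>\<epsilon> / 32\<close>.\<close>

lemma scheme_exists:
  fixes \<epsilon> :: real
  assumes eps: "0 < \<epsilon>" "\<epsilon> \<le> 1"
  shows "\<exists>g G H D K \<phi> \<kappa> M R. scheme g G H D K \<phi> \<kappa> M \<epsilon> R"
proof -
  have ex: "\<exists>n::nat. 1 \<le> n \<and> x \<le> real n" for x :: real
    using real_arch_simple[of "max 1 x"] by (metis max.bounded_iff of_nat_1 of_nat_le_iff)
  have div: "x / real n \<le> y" if "x / y \<le> real n" "0 < y" "1 \<le> n" for x y :: real and n :: nat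
    using that by (simp add: field_simps)
  define \<phi> where "\<phi> = (\<lambda>x. unit_step ((x - 1) / \<epsilon>))"
  define \<kappa> where "\<kappa> = 4 / \<epsilon>\<^sup>2"
  define c where "c = 2 * (1 - ln (\<epsilon> / 2))"
  have "ln (\<epsilon> / 2) < 0" using eps by simp
  then have c: "0 < c" by (simp add: c_def)
  have kappa: "0 < \<kappa>" using eps by (simp add: \<kappa>_def)
  obtain g where g: "1 \<le> g" "\<kappa> * (c + 4) / (\<epsilon> / 16) \<le> real g" using ex by blast
  define M where "M = g * c"
  have M: "0 \<le> M" using c by (simp add: M_def)
  have kM: "\<kappa> / (real g)\<^sup>2 * (M + 4) \<le> \<epsilon> / 16"
  proof -
    \<comment> \<open>\<open>M\<close> grows only linearly in \<open>g\<close>, which the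
      denominator \<open>g\<^sup>2\<close> outweighs.\<close>
    have "M + 4 \<le> g * (c + 4)" using g(1) by (simp add: M_def distrib_left)
    then have "\<kappa> / (real g)\<^sup>2 * (M + 4) \<le> \<kappa> / (real g)\<^sup>2 * (g * (c + 4))" using kappa by (intro mult_left_mono) auto
    also have "\<dots> = \<kappa> * (c + 4) / g" using g(1) by (simp add: power2_eq_square)
    also have "\<dots> \<le> \<epsilon> / 16" using div[OF g(2) _ g(1)] eps by simp
    finally show ?thesis .
  qed
  obtain G where G: "1 \<le> G" "(M + 1) / (\<epsilon> / 32) \<le> real G" using ex by blast
  obtain K where K: "1 \<le> K" "1 / (\<epsilon> / 32) \<le> real K" using ex by blast
  let ?N = "real (card (grid.directions g G))"
  obtain D where D: "1 \<le> D" "(2 * M + 6 + 3 * ?N) / (\<epsilon> / 32) \<le> real D" using ex by blast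
  obtain H where H: "1 \<le> H" "(M + 1) * D / (\<epsilon> / 32) \<le> real H" using ex by blast
  obtain R where R: "1 \<le> R" "1 / (\<epsilon> / 2) \<le> real R" using ex by blast
  interpret smooth_step \<phi> \<kappa> unfolding \<phi>_def \<kappa>_def by (rule smooth_step_scaled[OF eps])
  have dD: "(2 * M + 6 + 3 * ?N) / D \<le> \<epsilon> / 32" using div[OF D(2) _ D(1)] eps by simp
  have dH: "(M + 1) * D / H \<le> \<epsilon> / 32" using div[OF H(2) _ H(1)] eps by simp
  have dG: "(M + 1) / G \<le> \<epsilon> / 32" using div[OF G(2) _ G(1)] eps by simp
  have dK: "1 / K \<le> \<epsilon> / 32" using div[OF K(2) _ K(1)] eps by simp
  have N_le: "?N \<le> real D"
  proof -
    have "2 * M + 6 + 3 * ?N \<le> \<epsilon> / 32 * D" using dD D(1) by (simp add: divide_le_eq)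
    also have "\<dots> \<le> 1 * real D" using eps by (intro mult_right_mono) auto
    finally show ?thesis using M by linarith
  qed
  have levels: "(M + 1) * D \<le> H"
  proof -
    have "(M + 1) * D \<le> \<epsilon> / 32 * H" using dH H(1) by (simp add: divide_le_eq)
    also have "\<dots> \<le> 1 * real H" using eps by (intro mult_right_mono) auto
    finally show ?thesis by simp
  qed
  have "scheme g G H D K \<phi> \<kappa> M \<epsilon> R"
  proof
    show "card (grid.directions g G) \<le> D" using N_le by simp
    show "\<phi> x \<le> 0" if "x \<le> 1" for x using that eps by (simp add: \<phi>_def unit_step_le_0 divide_le_0_iff)
    show "1 \<le> \<phi> x" if "1 + \<epsilon> \<le> x" for x using that eps by (simp add: \<phi>_def unit_step_ge_1)
    show "M = g * (2 * (1 - ln (\<epsilon> / 2)))" by (simp add: M_def c_def)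
    have "2 * (M + 3) / D + real (3 * card (grid.directions g G)) / D = (2 * M + 6 + 3 * ?N) / D"
      by (simp add: add_divide_distrib)
    then show "\<kappa> / (real g)\<^sup>2 * (M + 4) + 2 * (M + 3) / D + real (3 * card (grid.directions g G)) / D \<le> \<epsilon> / 8"
      using kM dD eps by linarith
    have "(2 * M + 4 + ?N) / D \<le> (2 * M + 6 + 3 * ?N) / D" by (intro divide_right_mono) auto
    moreover have "\<kappa> / (real g)\<^sup>2 * M \<le> \<kappa> / (real g)\<^sup>2 * (M + 4)" using kappa by (intro mult_left_mono) auto
    ultimately show "(2 * M + 4 + ?N) / D + 1 / K + (M + 1) / G + (M + 1) * D / H + \<kappa> / (real g)\<^sup>2 * M \<le> \<epsilon> / 4"
      using dD dH dG dK kM eps by linarith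
    show "1 / R \<le> \<epsilon> / 2" using div[OF R(2) _ R(1)] eps by simp
  qed (use g G H D K R eps M levels in auto)
  then show ?thesis by blast
qed

theorem theorem3:
  fixes \<epsilon> :: real
  assumes "\<epsilon> > 0"
  shows "\<exists>algo :: prog.
    polynomial_time_on algo (encode_sbp ` {I. sbp_instance I}) \<and>
    (\<forall>I. sbp_instance I \<and> (\<exists>f. feasible_packing I f) \<longrightarrow>
      (\<exists>f. outputs algo (encode_sbp I) (encode_packing f) \<and>
           is_packing I f \<and>
           num_bins f \<le> OPT I \<and>
           (\<forall>j\<in>set f. prob_exceeds I (items_in f j) ((1 + \<epsilon>) * of_rat (capacity I))
                        \<le> of_rat (overflow_prob I) + \<epsilon>)))"
proof -
  \<comment> \<open>The smooth step must be complete at 2, so the scheme works for parameters up to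
    1 only. For larger \<open>\<epsilon>\<close> the guarantee for \<open>\<delta>\<close> is
    stronger, as exceeding a larger threshold is less likely.\<close>
  define \<delta> where "\<delta> = min \<epsilon> 1"
  have d: "0 < \<delta>" "\<delta> \<le> 1" "\<delta> \<le> \<epsilon>" using assms by (auto simp: \<delta>_def)
  from scheme_exists[OF d(1,2)] obtain g G H D K \<phi> \<kappa> M R where
    "scheme g G H D K \<phi> \<kappa> M \<delta> R" by blast
  then interpret scheme g G H D K \<phi> \<kappa> M \<delta> R .
  from poly_time_program[OF poly_time_packing] obtain algo where
    algo: "polynomial_time_on algo (encode_sbp ` instances)"
      "\<And>I. I \<in> instances \<Longrightarrow> outputs algo (encode_sbp I) (encode_packing (packing I))" by blast
  have "prob_exceeds I (items_in (packing I) j) ((1 + \<epsilon>) * of_rat (capacity I)) \<le> of_rat (overflow_prob I) + \<epsilon>"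
    if I: "sbp_instance I" "\<exists>f. feasible_packing I f" "j \<in> set (packing I)" for I j
  proof -
    have c: "0 < real_of_rat (capacity I)" using I(1) by (simp add: sbp_instance_def)
    have "(1 + \<delta>) * of_rat (capacity I) \<le> (1 + \<epsilon>) * real_of_rat (capacity I)"
      using c d(3) by (intro mult_right_mono) auto
    then have "prob_exceeds I (items_in (packing I) j) ((1 + \<epsilon>) * of_rat (capacity I)) \<le>
        prob_exceeds I (items_in (packing I) j) ((1 + \<delta>) * of_rat (capacity I))"
      unfolding prob_exceeds_def by (intro measure_pmf.finite_measure_mono) auto
    also have "\<dots> \<le> of_rat (overflow_prob I) + \<delta>" using packing_correct(3)[OF I(1,2)] I(3) by blast
    finally show ?thesis using d(3) by linarith
  qed
  then show ?thesis
    using algo packing_correct(1,2) by (intro exI[of _ algo]) blast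
qed

end
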